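(* Let $(R,\mathfrak{m},k)$ be a Noetherian local ring and let $J,K$ be ideals of $R$. Let $(P)$ be any one of the properties "$\mathfrak{m}$-full", "weakly $\mathfrak{m}$-full", "full". Then the following are equivalent: (1) $J$ has property $(P)$; (2) there exists $n_0$ such that $J+K\mathfrak{m}^n$ has property $(P)$ for all $n\geq n_0$.
   Context: Let $(R,\mathfrak{m},k)$ be a local ring. When $k$ is infinite, an ideal $I$ is called $\mathfrak{m}$-full if $\mathfrak{m}I:x=I$ for a general element $x\in\mathfrak{m}$, and full if $I:x=I:\mathfrak{m}$ for a general element $x\in\mathfrak{m}$; here "for a general element $x\in\mathfrak{m}$" means for all $x\in\mathfrak{m}$ whose image in $\mathfrak{m}/\mathfrak{m}^2$ lies in some nonempty Zariski open subset of $\mathfrak{m}/\mathfrak{m}^2$. When $k$ is finite, $I$ is called $\mathfrak{m}$-full (resp. full) if $IS'$ is $\mathfrak{m}S'$-full (resp. full) in the faithfully flat extension $S'=S_{\mathfrak{m}S}$, where $S=R[X_1,\dots,X_n]$ with $n=\mu(\mathfrak{m})$ the minimal number of generators of $\mathfrak{m}$. An ideal $I$ is weakly $\mathfrak{m}$-full if $\mathfrak{m}I:\mathfrak{m}=I$. Colon: $A:B=\{r\in R: rB\subseteq A\}$, $A:x=\{r: rx\in A\}$. *)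

theory Defs
  imports "HOL-Algebra.Algebra"
begin

definition local_ring :: "('a, 'b) ring_scheme \<Rightarrow> bool" where
  "local_ring R \<longleftrightarrow> cring R \<and> (\<exists>!m. maximalideal m R)"

definition max_ideal :: "('a, 'b) ring_scheme \<Rightarrow> 'a set" where
  "max_ideal R = (THE m. maximalideal m R)"

definition colon :: "('a, 'b) ring_scheme \<Rightarrow> 'a set \<Rightarrow> 'a set \<Rightarrow> 'a set" where
  "colon R A B = {r \<in> carrier R. \<forall>b\<in>B. r \<otimes>\<^bsub>R\<^esub> b \<in> A}"

primrec ideal_pow :: "('a, 'b) ring_scheme \<Rightarrow> 'a set \<Rightarrow> nat \<Rightarrow> 'a set" where
  "ideal_pow R I 0 = carrier R"
| "ideal_pow R I (Suc n) = I \<cdot>\<^bsub>R\<^esub> ideal_pow R I n"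

definition min_num_gens :: "('a, 'b) ring_scheme \<Rightarrow> 'a set \<Rightarrow> nat" where
  "min_num_gens R I =
     (LEAST n. \<exists>A. A \<subseteq> carrier R \<and> finite A \<and> card A = n \<and> Idl\<^bsub>R\<^esub> A = I)"

definition residue_field_infinite :: "('a, 'b) ring_scheme \<Rightarrow> bool" where
  "residue_field_infinite R \<longleftrightarrow> infinite (carrier (R Quot (max_ideal R)))"

text \<open>Coordinates: if y_0,...,y_(n-1) is a minimal generating system of m (n = mu(m)),
  their images form a basis of m/m^2 over k = R/m, and every x in m is a combination
  sum a_i y_i whose image in m/m^2 has coordinates (a_i mod m).  A polynomial function
  over k in these coordinates is given by a polynomial with coefficients in R
  (lifting the coefficients), and it is nonzero at (a_i mod m) iff its value at a
  is not in m.  A nonempty Zariski open subset of m/m^2 contains a nonempty basic open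
  set D(g), so "for general x" means: there is g with D(g) nonempty such that every x
  whose image lies in D(g) has the property.\<close>

definition lin_comb :: "('a, 'b) ring_scheme \<Rightarrow> nat \<Rightarrow> (nat \<Rightarrow> 'a) \<Rightarrow> (nat \<Rightarrow> 'a) \<Rightarrow> 'a" where
  "lin_comb R n a ys = finsum R (\<lambda>i. a i \<otimes>\<^bsub>R\<^esub> ys i) {..<n}"

definition mono_eval :: "('a, 'b) ring_scheme \<Rightarrow> nat \<Rightarrow> (nat \<Rightarrow> nat) \<Rightarrow> (nat \<Rightarrow> 'a) \<Rightarrow> 'a" where
  "mono_eval R n e a = finprod R (\<lambda>i. a i [^]\<^bsub>R\<^esub> (e i)) {..<n}"

definition poly_eval ::
  "('a, 'b) ring_scheme \<Rightarrow> nat \<Rightarrow> (nat \<Rightarrow> nat) set \<Rightarrow> ((nat \<Rightarrow> nat) \<Rightarrow> 'a) \<Rightarrow> (nat \<Rightarrow> 'a) \<Rightarrow> 'a" where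
  "poly_eval R n E c a = finsum R (\<lambda>e. c e \<otimes>\<^bsub>R\<^esub> mono_eval R n e a) E"

definition general_elt :: "('a, 'b) ring_scheme \<Rightarrow> ('a \<Rightarrow> bool) \<Rightarrow> bool" where
  "general_elt R P \<longleftrightarrow>
     (let m = max_ideal R; n = min_num_gens R m in
      \<exists>ys E c. (\<forall>i<n. ys i \<in> carrier R) \<and> Idl\<^bsub>R\<^esub> (ys ` {..<n}) = m
        \<and> finite E \<and> (\<forall>e\<in>E. c e \<in> carrier R)
        \<and> (\<exists>a. (\<forall>i<n. a i \<in> carrier R) \<and> poly_eval R n E c a \<notin> m)
        \<and> (\<forall>a. (\<forall>i<n. a i \<in> carrier R) \<and> poly_eval R n E c a \<notin> m
               \<longrightarrow> P (lin_comb R n a ys)))"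

definition m_full_inf :: "('a, 'b) ring_scheme \<Rightarrow> 'a set \<Rightarrow> bool" where
  "m_full_inf R I \<longleftrightarrow>
     general_elt R (\<lambda>x. colon R (max_ideal R \<cdot>\<^bsub>R\<^esub> I) {x} = I)"

definition full_inf :: "('a, 'b) ring_scheme \<Rightarrow> 'a set \<Rightarrow> bool" where
  "full_inf R I \<longleftrightarrow>
     general_elt R (\<lambda>x. colon R I {x} = colon R I (max_ideal R))"

text \<open>Polynomials in the variables X_0..X_(n-1) over R: coefficient functions on
  exponent vectors, finitely supported, only the first n variables occurring.\<close>
definition mpoly_mult :: "('a, 'b) ring_scheme \<Rightarrow> ((nat \<Rightarrow> nat) \<Rightarrow> 'a) \<Rightarrow> ((nat \<Rightarrow> nat) \<Rightarrow> 'a) \<Rightarrow> ((nat \<Rightarrow> nat) \<Rightarrow> 'a)" where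
  "mpoly_mult R p q e = finsum R (\<lambda>(e1, e2). p e1 \<otimes>\<^bsub>R\<^esub> q e2)
       {(e1, e2). (\<forall>i. e1 i + e2 i = e i) \<and> p e1 \<noteq> \<zero>\<^bsub>R\<^esub> \<and> q e2 \<noteq> \<zero>\<^bsub>R\<^esub>}"

definition mpoly_ring :: "('a, 'b) ring_scheme \<Rightarrow> nat \<Rightarrow> ((nat \<Rightarrow> nat) \<Rightarrow> 'a) ring" where
  "mpoly_ring R n =
    \<lparr> partial_object.carrier = {p. (\<forall>e. p e \<in> carrier R) \<and> finite {e. p e \<noteq> \<zero>\<^bsub>R\<^esub>}
                    \<and> (\<forall>e. p e \<noteq> \<zero>\<^bsub>R\<^esub> \<longrightarrow> (\<forall>i\<ge>n. e i = 0))},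
      monoid.mult = mpoly_mult R,
      monoid.one = (\<lambda>e. if e = (\<lambda>_. 0) then \<one>\<^bsub>R\<^esub> else \<zero>\<^bsub>R\<^esub>),
      ring.zero = (\<lambda>e. \<zero>\<^bsub>R\<^esub>),
      ring.add = (\<lambda>p q e. p e \<oplus>\<^bsub>R\<^esub> q e) \<rparr>"

definition mpoly_const :: "('a, 'b) ring_scheme \<Rightarrow> 'a \<Rightarrow> ((nat \<Rightarrow> nat) \<Rightarrow> 'a)" where
  "mpoly_const R r = (\<lambda>e. if e = (\<lambda>_. 0) then r else \<zero>\<^bsub>R\<^esub>)"

definition loc_rel :: "('a, 'b) ring_scheme \<Rightarrow> 'a set \<Rightarrow> (('a \<times> 'a) \<times> ('a \<times> 'a)) set" where
  "loc_rel A U = {((a, s), (b, t)). a \<in> carrier A \<and> b \<in> carrier A \<and> s \<in> U \<and> t \<in> U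
       \<and> (\<exists>u\<in>U. u \<otimes>\<^bsub>A\<^esub> ((a \<otimes>\<^bsub>A\<^esub> t) \<ominus>\<^bsub>A\<^esub> (b \<otimes>\<^bsub>A\<^esub> s)) = \<zero>\<^bsub>A\<^esub>)}"

definition loc_cls :: "('a, 'b) ring_scheme \<Rightarrow> 'a set \<Rightarrow> 'a \<Rightarrow> 'a \<Rightarrow> ('a \<times> 'a) set" where
  "loc_cls A U a s = loc_rel A U `` {(a, s)}"

definition loc_rep :: "('a \<times> 'a) set \<Rightarrow> 'a \<times> 'a" where
  "loc_rep V1 = (SOME p. p \<in> V1)"

definition loc_mult :: "('a, 'b) ring_scheme \<Rightarrow> 'a set \<Rightarrow> ('a \<times> 'a) set \<Rightarrow> ('a \<times> 'a) set \<Rightarrow> ('a \<times> 'a) set" where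
  "loc_mult A U V1 V2 =
      loc_cls A U (fst (loc_rep V1) \<otimes>\<^bsub>A\<^esub> fst (loc_rep V2)) (snd (loc_rep V1) \<otimes>\<^bsub>A\<^esub> snd (loc_rep V2))"

definition loc_add :: "('a, 'b) ring_scheme \<Rightarrow> 'a set \<Rightarrow> ('a \<times> 'a) set \<Rightarrow> ('a \<times> 'a) set \<Rightarrow> ('a \<times> 'a) set" where
  "loc_add A U V1 V2 =
      loc_cls A U ((fst (loc_rep V1) \<otimes>\<^bsub>A\<^esub> snd (loc_rep V2)) \<oplus>\<^bsub>A\<^esub> (fst (loc_rep V2) \<otimes>\<^bsub>A\<^esub> snd (loc_rep V1)))
                  (snd (loc_rep V1) \<otimes>\<^bsub>A\<^esub> snd (loc_rep V2))"

definition localization :: "('a, 'b) ring_scheme \<Rightarrow> 'a set \<Rightarrow> (('a \<times> 'a) set) ring" where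
  "localization A U =
    \<lparr> partial_object.carrier = {loc_cls A U a s | a s. a \<in> carrier A \<and> s \<in> U},
      monoid.mult = loc_mult A U,
      monoid.one = loc_cls A U \<one>\<^bsub>A\<^esub> \<one>\<^bsub>A\<^esub>,
      ring.zero = loc_cls A U \<zero>\<^bsub>A\<^esub> \<one>\<^bsub>A\<^esub>,
      ring.add = loc_add A U \<rparr>"

definition poly_ext_S :: "('a, 'b) ring_scheme \<Rightarrow> ((nat \<Rightarrow> nat) \<Rightarrow> 'a) ring" where
  "poly_ext_S R = mpoly_ring R (min_num_gens R (max_ideal R))"

definition poly_ext_U :: "('a, 'b) ring_scheme \<Rightarrow> ((nat \<Rightarrow> nat) \<Rightarrow> 'a) set" where
  "poly_ext_U R = carrier (poly_ext_S R)
      - Idl\<^bsub>poly_ext_S R\<^esub> (mpoly_const R ` max_ideal R)"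

definition poly_ext :: "('a, 'b) ring_scheme \<Rightarrow> ((((nat \<Rightarrow> nat) \<Rightarrow> 'a) \<times> ((nat \<Rightarrow> nat) \<Rightarrow> 'a)) set) ring" where
  "poly_ext R = localization (poly_ext_S R) (poly_ext_U R)"

definition poly_ext_map :: "('a, 'b) ring_scheme \<Rightarrow> 'a \<Rightarrow> (((nat \<Rightarrow> nat) \<Rightarrow> 'a) \<times> ((nat \<Rightarrow> nat) \<Rightarrow> 'a)) set" where
  "poly_ext_map R r = loc_cls (poly_ext_S R) (poly_ext_U R) (mpoly_const R r) \<one>\<^bsub>poly_ext_S R\<^esub>"

definition ext_ideal :: "('a, 'b) ring_scheme \<Rightarrow> 'a set \<Rightarrow> (((nat \<Rightarrow> nat) \<Rightarrow> 'a) \<times> ((nat \<Rightarrow> nat) \<Rightarrow> 'a)) set set" where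
  "ext_ideal R I = Idl\<^bsub>poly_ext R\<^esub> (poly_ext_map R ` I)"

definition m_full :: "('a, 'b) ring_scheme \<Rightarrow> 'a set \<Rightarrow> bool" where
  "m_full R I \<longleftrightarrow>
     (if residue_field_infinite R then m_full_inf R I
      else m_full_inf (poly_ext R) (ext_ideal R I))"

definition full :: "('a, 'b) ring_scheme \<Rightarrow> 'a set \<Rightarrow> bool" where
  "full R I \<longleftrightarrow>
     (if residue_field_infinite R then full_inf R I
      else full_inf (poly_ext R) (ext_ideal R I))"

definition weakly_m_full :: "('a, 'b) ring_scheme \<Rightarrow> 'a set \<Rightarrow> bool" where
  "weakly_m_full R I \<longleftrightarrow> colon R (max_ideal R \<cdot>\<^bsub>R\<^esub> I) (max_ideal R) = I"

end

theory Submission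
  imports Defs
begin

text \<open>
  An ideal is \<open>\<mm>\<close>-full or full iff \<open>A : x = B\<close> for a general \<open>x \<in> \<mm>\<close>, where \<open>(A, B)\<close> is \<open>(\<mm>J, J)\<close> or
  \<open>(J, J : \<mm>)\<close>. In both cases \<open>\<mm>B \<subseteq> A \<subseteq> B\<close>. If the residue field is infinite, this holds iff some
  \<open>x \<in> \<mm>\<close> is good, meaning that multiplication by \<open>x\<close> from the socle \<open>(B : \<mm>) / B\<close> to \<open>B / A\<close> is injective:
  these are linear maps of finite-dimensional spaces depending linearly on the class of \<open>x\<close> in
  \<open>\<mm> / \<mm>^2\<close>, so goodness is an open condition, and since a general \<open>x\<close> avoids the associated primes of \<open>R / A\<close>
  other than \<open>\<mm>\<close>, a proper inclusion \<open>B \<subset> A : x\<close> is visible in the socle.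

  Replacing \<open>J\<close> by \<open>J + K\<mm>^n\<close> replaces \<open>(A, B)\<close> by \<open>(A + K\<mm>^(n+1), B + K\<mm>^n)\<close> for large \<open>n\<close> (up to a shift of
  \<open>n\<close> in the second case), because \<open>(B + K\<mm>^(n+1)) : \<mm> = (B : \<mm>) + K\<mm>^n\<close>. Goodness passes from the perturbed pair to
  \<open>(A, B)\<close> by Artin-Rees, and in the other direction if \<open>x\<close> is in addition superficial for the filtration
  \<open>K\<mm>^n (R / B)\<close>, which a general \<open>x\<close> is. These asymptotic statements rest on the Noetherian property
  of the Rees algebra \<open>R[\<mm>t]\<close>. For a finite residue field one passes to \<open>S'\<close>, which is again Noetherian
  local, has an infinite residue field unless \<open>\<mm> = 0\<close>, and extends sums, products and \<open>\<mm>\<close> compatibly.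
\<close>

section \<open>Ideals of commutative rings\<close>

text \<open>Goodness can be tested on a single \<open>x\<close> because it is a rank condition over
  the residue field; the equation \<open>A : x = B\<close> concerns all of \<open>R / A\<close> and
  is not visibly open. Returning from goodness to this equation requires \<open>x\<close> to avoid
  associated primes, and perturbing by \<open>K\<mm>^n\<close> requires the same for a graded
  module. Both are instances of one avoidance statement about homogeneous ideals of
  \<open>R[\<mm>t]\<close>, encoded as their sequences of components. Its proof splits such an ideal
  into meet-irreducible ones by Noetherian induction, in place of primary decomposition. What
  escapes it is torsion for the irrelevant ideal, which is controlled by goodness in the first
  instance and vanishes in high degree in the second. The shift by one between the two perturbed
  ideals comes from \<open>\<mm>(B + K\<mm>^n) = \<mm>B + K\<mm>^(n+1)\<close>: it keeps
  \<open>\<mm>B \<subseteq> A\<close> valid for the new pair. If \<open>\<mm> = 0\<close> and the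
  residue field is finite, the extension has no variables and its residue field stays finite; in
  that case \<open>K\<mm>^n = 0\<close> for \<open>n \<ge> 1\<close>, so nothing is
  perturbed.\<close>

lemma (in ring) ideal_add_mem: "\<lbrakk>ideal I R; a \<in> I; b \<in> I\<rbrakk> \<Longrightarrow> a \<oplus> b \<in> I"
  by (rule additive_subgroup.a_closed[OF ideal.axioms(1)])

lemma (in ring) ideal_zero_mem: "ideal I R \<Longrightarrow> \<zero> \<in> I"
  by (rule additive_subgroup.zero_closed[OF ideal.axioms(1)])

lemma (in ring) ideal_neg_mem: "\<lbrakk>ideal I R; a \<in> I\<rbrakk> \<Longrightarrow> \<ominus> a \<in> I"
  by (rule additive_subgroup.a_inv_closed[OF ideal.axioms(1)])

lemma (in ring) ideal_diff_mem: "\<lbrakk>ideal I R; a \<in> I; b \<in> I\<rbrakk> \<Longrightarrow> a \<ominus> b \<in> I"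
  by (simp add: a_minus_def ideal_add_mem ideal_neg_mem)

lemma (in ring) ideal_lmult_mem: "\<lbrakk>ideal I R; a \<in> I; x \<in> carrier R\<rbrakk> \<Longrightarrow> x \<otimes> a \<in> I"
  by (rule ideal.I_l_closed)

lemma (in ring) ideal_rmult_mem: "\<lbrakk>ideal I R; a \<in> I; x \<in> carrier R\<rbrakk> \<Longrightarrow> a \<otimes> x \<in> I"
  by (rule ideal.I_r_closed)

lemma (in ring) ideal_carr: "\<lbrakk>ideal I R; a \<in> I\<rbrakk> \<Longrightarrow> a \<in> carrier R"
  by (rule ideal.Icarr)

lemma (in ring) ideal_sub: "ideal I R \<Longrightarrow> I \<subseteq> carrier R"
  by (auto intro: ideal_carr)

lemmas (in ring) ideal_mem = ideal_add_mem ideal_zero_mem ideal_neg_mem ideal_diff_mem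
  ideal_lmult_mem ideal_rmult_mem

lemma (in ring) idealI':
  assumes "I \<subseteq> carrier R" "\<zero> \<in> I" "\<And>a b. \<lbrakk>a \<in> I; b \<in> I\<rbrakk> \<Longrightarrow> a \<oplus> b \<in> I"
    "\<And>a x. \<lbrakk>a \<in> I; x \<in> carrier R\<rbrakk> \<Longrightarrow> x \<otimes> a \<in> I"
    "\<And>a x. \<lbrakk>a \<in> I; x \<in> carrier R\<rbrakk> \<Longrightarrow> a \<otimes> x \<in> I"
  shows "ideal I R"
proof (rule idealI[OF ring_axioms])
  show "subgroup I (add_monoid R)"
  proof (rule add.subgroupI)
    fix a assume a: "a \<in> I"
    then have "(\<ominus> \<one>) \<otimes> a \<in> I" using assms(4) by simp
    moreover have "(\<ominus> \<one>) \<otimes> a = \<ominus> a" using a assms(1) by (auto simp: l_minus)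
    ultimately show "\<ominus> a \<in> I" by simp
  next
    show "I \<noteq> {}" using assms(2) by blast
  qed (use assms(1,3) in simp_all)
next
  fix a x assume "a \<in> I" "x \<in> carrier R"
  then show "x \<otimes> a \<in> I" "a \<otimes> x \<in> I" using assms(4,5) by simp_all
qed

lemma (in cring) cidealI:
  assumes "I \<subseteq> carrier R" "\<zero> \<in> I" "\<And>a b. \<lbrakk>a \<in> I; b \<in> I\<rbrakk> \<Longrightarrow> a \<oplus> b \<in> I"
    "\<And>a x. \<lbrakk>a \<in> I; x \<in> carrier R\<rbrakk> \<Longrightarrow> x \<otimes> a \<in> I"
  shows "ideal I R"
proof (rule idealI'[OF assms])
  fix a x assume "a \<in> I" "x \<in> carrier R"
  then show "a \<otimes> x \<in> I" using assms(1) assms(4)[of a x] m_comm[of a x] by auto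
qed

lemma (in ring) ideal_cancel_right:
  assumes "ideal I R" "a \<oplus> b \<in> I" "b \<in> I" "a \<in> carrier R"
  shows "a \<in> I"
proof -
  have "b \<in> carrier R" using assms ideal_carr by auto
  then have "a = (a \<oplus> b) \<ominus> b" using assms(4) by algebra
  then show ?thesis using assms ideal_diff_mem by metis
qed

lemma (in ring) ideal_cancel_left:
  assumes "ideal I R" "a \<oplus> b \<in> I" "a \<in> I" "b \<in> carrier R"
  shows "b \<in> I"
  using ideal_cancel_right[OF assms(1), of b a] assms ideal_carr a_comm by metis

section \<open>Sums, products, colons and powers of ideals\<close>

lemma (in ring) set_addI: "\<lbrakk>a \<in> A; b \<in> B\<rbrakk> \<Longrightarrow> a \<oplus> b \<in> A <+>\<^bsub>R\<^esub> B"
  unfolding set_add_def' by blast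

lemma (in ring) set_addE:
  assumes "x \<in> A <+>\<^bsub>R\<^esub> B" obtains a b where "a \<in> A" "b \<in> B" "x = a \<oplus> b"
  using assms unfolding set_add_def' by blast

lemma (in ring) set_add_left:
  assumes "ideal A R" "ideal B R" shows "A \<subseteq> A <+>\<^bsub>R\<^esub> B"
proof
  fix a assume "a \<in> A"
  then have "a \<oplus> \<zero> \<in> A <+>\<^bsub>R\<^esub> B" using assms set_addI ideal_zero_mem by blast
  then show "a \<in> A <+>\<^bsub>R\<^esub> B" using \<open>a \<in> A\<close> assms ideal_carr by simp
qed

lemma (in ring) set_add_right:
  assumes "ideal A R" "ideal B R" shows "B \<subseteq> A <+>\<^bsub>R\<^esub> B"
proof
  fix a assume "a \<in> B"
  then have "\<zero> \<oplus> a \<in> A <+>\<^bsub>R\<^esub> B" using assms set_addI ideal_zero_mem by blast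
  then show "a \<in> A <+>\<^bsub>R\<^esub> B" using \<open>a \<in> B\<close> assms ideal_carr by simp
qed

lemma (in ring) set_add_least:
  assumes "ideal C R" "A \<subseteq> C" "B \<subseteq> C" shows "A <+>\<^bsub>R\<^esub> B \<subseteq> C"
  using assms by (auto elim!: set_addE intro: ideal_add_mem)

lemma (in ring) set_add_mono:
  assumes "A \<subseteq> A'" "B \<subseteq> B'" shows "A <+>\<^bsub>R\<^esub> B \<subseteq> A' <+>\<^bsub>R\<^esub> B'"
  using assms unfolding set_add_def' by blast

lemma (in ring) prod_least:
  assumes "ideal C R" "\<And>a b. \<lbrakk>a \<in> A; b \<in> B\<rbrakk> \<Longrightarrow> a \<otimes> b \<in> C"
  shows "A \<cdot> B \<subseteq> C"
proof
  fix x assume "x \<in> A \<cdot> B" then show "x \<in> C"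
    by induct (use assms ideal_add_mem in auto)
qed

lemma (in ring) prod_mono:
  assumes "A \<subseteq> A'" "B \<subseteq> B'" shows "A \<cdot> B \<subseteq> A' \<cdot> B'"
proof
  fix x assume "x \<in> A \<cdot> B" then show "x \<in> A' \<cdot> B'"
    by induct (use assms in \<open>auto intro: ideal_prod.intros\<close>)
qed

lemma (in cring) colon_ideal:
  assumes "ideal A R" "B \<subseteq> carrier R" shows "ideal (colon R A B) R"
proof (rule cidealI)
  fix a x assume a: "a \<in> colon R A B" and x: "x \<in> carrier R"
  have "x \<otimes> a \<otimes> b \<in> A" if "b \<in> B" for b
  proof -
    have "x \<otimes> (a \<otimes> b) \<in> A" using a x that assms ideal_lmult_mem unfolding colon_def by blast
    then show ?thesis using a x that assms by (simp add: colon_def m_assoc subsetD)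
  qed
  then show "x \<otimes> a \<in> colon R A B" using a x by (auto simp: colon_def)
qed (use assms in \<open>auto simp: colon_def l_distr ideal_zero_mem ideal_add_mem subset_iff\<close>)

lemma (in ring) colonI: "\<lbrakk>r \<in> carrier R; \<And>b. b \<in> B \<Longrightarrow> r \<otimes> b \<in> A\<rbrakk> \<Longrightarrow> r \<in> colon R A B"
  by (simp add: colon_def)

lemma (in ring) pow_ideal: "ideal I R \<Longrightarrow> ideal (ideal_pow R I n) R"
  by (induct n) (auto simp: oneideal ideal_prod_is_ideal)

lemma (in cring) carrier_prod: "ideal I R \<Longrightarrow> carrier R \<cdot> I = I"
  using ideal_prod_one ideal_prod_commute oneideal by metis

lemma (in cring) pow_add:
  assumes "ideal I R"
  shows "ideal_pow R I (i + j) = ideal_pow R I i \<cdot> ideal_pow R I j"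
  using assms by (induct i) (auto simp: carrier_prod pow_ideal ideal_prod_assoc)

lemma (in cring) pow_mult_mem:
  assumes "ideal I R" "a \<in> ideal_pow R I i" "b \<in> ideal_pow R I j"
  shows "a \<otimes> b \<in> ideal_pow R I (i + j)"
  using assms by (auto simp: pow_add intro: ideal_prod.prod)

lemma (in cring) pow_antimono:
  assumes "ideal I R" "i \<le> j"
  shows "ideal_pow R I j \<subseteq> ideal_pow R I i"
proof -
  obtain k where "j = i + k" using assms(2) le_Suc_ex by blast
  then show ?thesis using assms pow_add ideal_prod_inter[of "ideal_pow R I i" "ideal_pow R I k"] pow_ideal
    by auto
qed

lemma (in cring) pow_one: "ideal I R \<Longrightarrow> ideal_pow R I (Suc 0) = I"
  by (simp add: ideal_prod_one)

lemma (in cring) pow_prod_mult: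
  assumes "ideal I R" "ideal K R" "a \<in> ideal_pow R I i" "b \<in> K \<cdot> ideal_pow R I j"
  shows "a \<otimes> b \<in> K \<cdot> ideal_pow R I (i + j)"
proof -
  have "a \<otimes> b \<in> ideal_pow R I i \<cdot> (K \<cdot> ideal_pow R I j)" using assms by (simp add: ideal_prod.prod)
  also have "\<dots> = K \<cdot> ideal_pow R I (i + j)"
    using pow_ideal[OF assms(1)] assms(2)
    by (simp add: pow_add[OF assms(1)] ideal_prod_commute[of K "ideal_pow R I i"] flip: ideal_prod_assoc)
  finally show ?thesis .
qed

lemma (in cring) pow_prod_antimono:
  assumes "ideal I R" "i \<le> j"
  shows "K \<cdot> ideal_pow R I j \<subseteq> K \<cdot> ideal_pow R I i"
  by (rule prod_mono[OF subset_refl pow_antimono[OF assms]])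

section \<open>Finite linear combinations and the ideals they form\<close>

definition lincomb :: "('a, 'b) ring_scheme \<Rightarrow> 'i set \<Rightarrow> ('i \<Rightarrow> 'a) \<Rightarrow> ('i \<Rightarrow> 'a) \<Rightarrow> 'a" where
  "lincomb R I c f = finsum R (\<lambda>i. c i \<otimes>\<^bsub>R\<^esub> f i) I"

lemma lin_comb_lincomb: "lin_comb R n a ys = lincomb R {..<n} a ys"
  by (simp add: lin_comb_def lincomb_def)

context cring
begin

lemma lincomb_closed [simp]:
  "\<lbrakk>\<And>i. i \<in> I \<Longrightarrow> c i \<in> carrier R; \<And>i. i \<in> I \<Longrightarrow> f i \<in> carrier R\<rbrakk> \<Longrightarrow> lincomb R I c f \<in> carrier R"
  unfolding lincomb_def by (intro finsum_closed) auto

lemma lincomb_empty [simp]: "lincomb R {} c f = \<zero>"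
  by (simp add: lincomb_def)

lemma lincomb_insert:
  "\<lbrakk>finite I; i \<notin> I; \<And>j. j \<in> insert i I \<Longrightarrow> c j \<in> carrier R; \<And>j. j \<in> insert i I \<Longrightarrow> f j \<in> carrier R\<rbrakk>
   \<Longrightarrow> lincomb R (insert i I) c f = c i \<otimes> f i \<oplus> lincomb R I c f"
  unfolding lincomb_def by (intro finsum_insert) auto

lemma lincomb_cong:
  assumes "\<And>i. i \<in> I \<Longrightarrow> c i = c' i" "\<And>i. i \<in> I \<Longrightarrow> f i = f' i"
    "\<And>i. i \<in> I \<Longrightarrow> c i \<in> carrier R" "\<And>i. i \<in> I \<Longrightarrow> f i \<in> carrier R"
  shows "lincomb R I c f = lincomb R I c' f'"
  unfolding lincomb_def using assms by (intro finsum_cong') auto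

lemma lincomb_add:
  assumes "\<And>i. i \<in> I \<Longrightarrow> c i \<in> carrier R" "\<And>i. i \<in> I \<Longrightarrow> d i \<in> carrier R"
    "\<And>i. i \<in> I \<Longrightarrow> f i \<in> carrier R"
  shows "lincomb R I (\<lambda>i. c i \<oplus> d i) f = lincomb R I c f \<oplus> lincomb R I d f"
proof -
  have "lincomb R I (\<lambda>i. c i \<oplus> d i) f = (\<Oplus>i\<in>I. c i \<otimes> f i \<oplus> d i \<otimes> f i)"
    unfolding lincomb_def using assms by (intro finsum_cong') (auto simp: l_distr)
  also have "\<dots> = lincomb R I c f \<oplus> lincomb R I d f"
    unfolding lincomb_def using assms by (intro finsum_addf) auto
  finally show ?thesis .
qed

lemma lincomb_smult:
  assumes "\<And>i. i \<in> I \<Longrightarrow> c i \<in> carrier R" "\<And>i. i \<in> I \<Longrightarrow> f i \<in> carrier R" "x \<in> carrier R"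
  shows "lincomb R I (\<lambda>i. x \<otimes> c i) f = x \<otimes> lincomb R I c f"
proof (cases "finite I")
  case True
  then have "lincomb R I (\<lambda>i. x \<otimes> c i) f = (\<Oplus>i\<in>I. x \<otimes> (c i \<otimes> f i))"
    unfolding lincomb_def using assms by (intro finsum_cong') (auto simp: m_assoc)
  also have "\<dots> = x \<otimes> lincomb R I c f"
    unfolding lincomb_def using assms True by (intro finsum_rdistr[symmetric]) auto
  finally show ?thesis .
qed (use assms in \<open>simp add: lincomb_def\<close>)

lemma lincomb_mem:
  assumes "ideal J R" "finite I" "\<And>i. i \<in> I \<Longrightarrow> c i \<otimes> f i \<in> J"
    "\<And>i. i \<in> I \<Longrightarrow> c i \<in> carrier R" "\<And>i. i \<in> I \<Longrightarrow> f i \<in> carrier R"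
  shows "lincomb R I c f \<in> J"
  using assms(2-) 
proof (induct I)
  case (insert x F)
  then show ?case by (subst lincomb_insert) (auto intro: ideal_add_mem[OF assms(1)])
qed (use assms(1) ideal_zero_mem in simp)

text \<open>Matrix form of a double sum: if all vectors are expanded in the common system
  \<open>f\<close>, the coefficients of their combination are obtained by applying the matrix
  \<open>g\<close> to \<open>a\<close>. Multiplication by a linear form is turned into a matrix with
  linear entries in this way.\<close>

lemma lincomb_swap:
  assumes "finite I" "finite L" "\<And>i. i \<in> I \<Longrightarrow> a i \<in> carrier R"
    "\<And>i l. \<lbrakk>i \<in> I; l \<in> L\<rbrakk> \<Longrightarrow> g i l \<in> carrier R" "\<And>l. l \<in> L \<Longrightarrow> f l \<in> carrier R"
  shows "lincomb R I a (\<lambda>i. lincomb R L (g i) f) = lincomb R L (\<lambda>l. lincomb R I a (\<lambda>i. g i l)) f"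
  using assms(1,3-4)
proof (induct I)
  case empty
  have "lincomb R L (\<lambda>l. \<zero>) f = lincomb R L (\<lambda>l. \<zero> \<otimes> \<zero>) f" by simp
  also have "\<dots> = \<zero>" by (subst lincomb_smult) (use assms in auto)
  finally show ?case by simp
next
  case (insert x F)
  have "lincomb R (insert x F) a (\<lambda>i. lincomb R L (g i) f)
      = a x \<otimes> lincomb R L (g x) f \<oplus> lincomb R L (\<lambda>l. lincomb R F a (\<lambda>i. g i l)) f"
    using insert assms by (subst lincomb_insert) auto
  also have "\<dots> = lincomb R L (\<lambda>l. a x \<otimes> g x l \<oplus> lincomb R F a (\<lambda>i. g i l)) f"
    using insert assms by (subst lincomb_add) (auto simp: lincomb_smult)
  also have "\<dots> = lincomb R L (\<lambda>l. lincomb R (insert x F) a (\<lambda>i. g i l)) f"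
  proof (rule lincomb_cong)
    fix l assume "l \<in> L"
    then show "a x \<otimes> g x l \<oplus> lincomb R F a (\<lambda>i. g i l) = lincomb R (insert x F) a (\<lambda>i. g i l)"
      using insert by (subst lincomb_insert) auto
  qed (use insert assms in auto)
  finally show ?case .
qed

lemma lincomb_delta:
  assumes "finite I" "j \<in> I" "x \<in> carrier R" "\<And>i. i \<in> I \<Longrightarrow> f i \<in> carrier R"
  shows "lincomb R I (\<lambda>i. if i = j then x else \<zero>) f = x \<otimes> f j"
proof -
  have "lincomb R I (\<lambda>i. if i = j then x else \<zero>) f = (\<Oplus>i\<in>I. if j = i then x \<otimes> f i else \<zero>)"
    unfolding lincomb_def using assms by (intro finsum_cong') auto
  also have "\<dots> = x \<otimes> f j" by (rule add.finprod_singleton) (use assms in auto)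
  finally show ?thesis .
qed

lemma genideal_lincomb:
  assumes "finite I" "\<And>i. i \<in> I \<Longrightarrow> f i \<in> carrier R"
  shows "Idl (f ` I) = {lincomb R I c f | c. \<forall>i\<in>I. c i \<in> carrier R}" (is "_ = ?S")
proof
  have "ideal ?S R"
  proof (rule cidealI)
    have "lincomb R I (\<lambda>i. \<zero>) f = \<zero>"
      using lincomb_smult[of I "\<lambda>i. \<zero>" f \<zero>] assms by simp
    then show "\<zero> \<in> ?S" by (intro CollectI exI[of _ "\<lambda>i. \<zero>"]) simp
  next
    fix a b assume "a \<in> ?S" "b \<in> ?S"
    then obtain c d where "a = lincomb R I c f" "b = lincomb R I d f"
      "\<forall>i\<in>I. c i \<in> carrier R" "\<forall>i\<in>I. d i \<in> carrier R" by blast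
    then show "a \<oplus> b \<in> ?S" using assms
      by (intro CollectI exI[of _ "\<lambda>i. c i \<oplus> d i"]) (auto simp: lincomb_add)
  next
    fix a x assume "a \<in> ?S" and x: "x \<in> carrier R"
    then obtain c where "a = lincomb R I c f" "\<forall>i\<in>I. c i \<in> carrier R" by blast
    then show "x \<otimes> a \<in> ?S" using assms x
      by (intro CollectI exI[of _ "\<lambda>i. x \<otimes> c i"]) (auto simp: lincomb_smult)
  qed (use assms in auto)
  moreover have "f ` I \<subseteq> ?S"
  proof
    fix y assume "y \<in> f ` I"
    then obtain j where j: "j \<in> I" "y = f j" by blast
    then have "y = lincomb R I (\<lambda>i. if i = j then \<one> else \<zero>) f"
      using lincomb_delta[OF assms(1) j(1), of \<one> f] assms(2) by simp
    then show "y \<in> ?S"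
      by (intro CollectI exI[of _ "\<lambda>i. if i = j then \<one> else \<zero>"]) simp
  qed
  ultimately show "Idl (f ` I) \<subseteq> ?S" by (rule genideal_minimal)
  have fI: "f ` I \<subseteq> carrier R" using assms by auto
  show "?S \<subseteq> Idl (f ` I)"
    using assms genideal_ideal[OF fI] genideal_self[OF fI]
    by (auto intro!: lincomb_mem intro: ideal_lmult_mem)
qed

end

context noetherian_ring
begin

lemma exists_maximal_in:
  assumes "S \<noteq> {}" "\<And>I. I \<in> S \<Longrightarrow> ideal I R"
  shows "\<exists>M\<in>S. \<forall>N\<in>S. M \<subseteq> N \<longrightarrow> N = M"
proof (rule subset_Zorn_nonempty[OF assms(1)])
  fix C assume C: "C \<noteq> {}" "subset.chain S C"
  then have "subset.chain {I. ideal I R} C"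
    using assms(2) unfolding subset_chain_def by blast
  then have "\<Union>C \<in> C" using ideal_chain_is_trivial C(1) by blast
  then show "\<Union>C \<in> S" using C(2) unfolding subset_chain_def by blast
qed

end

section \<open>Noetherian local rings\<close>

lemma (in ring) add_minus_cancel:
  "\<lbrakk>a \<in> carrier R; b \<in> carrier R\<rbrakk> \<Longrightarrow> a \<oplus> b \<ominus> b = a"
  by algebra

lemma (in noetherian_ring) obtain_maximal:
  assumes "P I" "\<And>I. P I \<Longrightarrow> ideal I R"
  obtains M where "P M" "\<And>N. \<lbrakk>P N; M \<subseteq> N\<rbrakk> \<Longrightarrow> N = M"
  using exists_maximal_in[of "Collect P"] assms by auto

locale noetherian_local = noetherian_ring R + cring R for R (structure) +
  assumes local: "local_ring R"
begin

abbreviation \<mm> where "\<mm> \<equiv> max_ideal R"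
abbreviation \<pp> where "\<pp> n \<equiv> ideal_pow R (max_ideal R) n"

lemma mm_max: "maximalideal \<mm> R"
  using local unfolding local_ring_def max_ideal_def by (metis theI')

lemma mm_unique: "maximalideal M R \<Longrightarrow> M = \<mm>"
  using local mm_max unfolding local_ring_def by blast

lemma mm_ideal: "ideal \<mm> R"
  using mm_max maximalideal.axioms(1) by blast

lemma mm_sub: "\<mm> \<subseteq> carrier R" using mm_ideal ideal_sub by blast

lemma mm_carr: "x \<in> \<mm> \<Longrightarrow> x \<in> carrier R" using mm_sub by blast

lemma one_notin_mm: "\<one> \<notin> \<mm>"
  using maximalideal.I_notcarr[OF mm_max] ideal.one_imp_carrier[OF mm_ideal] by auto

lemma pp_ideal: "ideal (\<pp> n) R" using pow_ideal mm_ideal by blast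

text \<open>A maximal member among the proper ideals containing \<open>I\<close> is a maximal ideal
  of the ring, hence equal to \<open>\<mm>\<close>. This makes every element outside
  \<open>\<mm>\<close> invertible.\<close>

lemma proper_ideal_sub_mm:
  assumes "ideal I R" "\<one> \<notin> I" shows "I \<subseteq> \<mm>"
proof -
  obtain M where M: "ideal M R" "\<one> \<notin> M" "I \<subseteq> M"
    "\<And>N. \<lbrakk>ideal N R; \<one> \<notin> N; M \<subseteq> N\<rbrakk> \<Longrightarrow> N = M"
  proof (rule obtain_maximal[of "\<lambda>N. ideal N R \<and> \<one> \<notin> N \<and> I \<subseteq> N" I])
    fix M assume M: "ideal M R \<and> \<one> \<notin> M \<and> I \<subseteq> M"
      "\<And>N. \<lbrakk>ideal N R \<and> \<one> \<notin> N \<and> I \<subseteq> N; M \<subseteq> N\<rbrakk> \<Longrightarrow> N = M"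
    show thesis
    proof (rule that[of M])
      fix N assume "ideal N R" "\<one> \<notin> N" "M \<subseteq> N"
      then show "N = M" using M by auto
    qed (use M(1) in auto)
  qed (use assms in auto)
  have "maximalideal M R"
  proof (rule maximalidealI[OF M(1)])
    show "carrier R \<noteq> M" using M(2) by auto
    fix N assume N: "ideal N R" "M \<subseteq> N" "N \<subseteq> carrier R"
    show "N = M \<or> N = carrier R"
    proof (cases "\<one> \<in> N")
      case True
      then show ?thesis using ideal.one_imp_carrier[OF N(1)] by simp
    next
      case False
      then show ?thesis using M(4)[OF N(1) _ N(2)] by simp
    qed
  qed
  then show ?thesis using M(3) mm_unique by blast
qed

lemma unit_inverse:
  assumes "x \<in> carrier R" "x \<notin> \<mm>"
  obtains y where "y \<in> carrier R" "y \<otimes> x = \<one>"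
proof -
  have "\<one> \<in> PIdl x"
    using proper_ideal_sub_mm[OF cgenideal_ideal[OF assms(1)]] cgenideal_self[OF assms(1)] assms(2) by blast
  then show ?thesis using that unfolding cgenideal_def by auto
qed

lemma unit_cancel_mem:
  assumes "ideal I R" "x \<in> carrier R" "x \<notin> \<mm>" "a \<in> carrier R" "x \<otimes> a \<in> I"
  shows "a \<in> I"
proof -
  obtain y where y: "y \<in> carrier R" "y \<otimes> x = \<one>" using unit_inverse assms by blast
  have "y \<otimes> (x \<otimes> a) \<in> I" using assms y ideal_lmult_mem by blast
  then show ?thesis using assms y by (simp flip: m_assoc)
qed

lemma mm_prime:
  "\<lbrakk>a \<in> carrier R; b \<in> carrier R; a \<otimes> b \<in> \<mm>; a \<notin> \<mm>\<rbrakk> \<Longrightarrow> b \<in> \<mm>"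
  using unit_cancel_mem mm_ideal by blast

lemma one_minus_notin_mm:
  assumes "a \<in> \<mm>" shows "\<one> \<ominus> a \<notin> \<mm>"
proof
  assume "\<one> \<ominus> a \<in> \<mm>"
  then have "(\<one> \<ominus> a) \<oplus> a \<in> \<mm>" using assms mm_ideal ideal_add_mem by blast
  moreover have "(\<one> \<ominus> a) \<oplus> a = \<one>" using assms mm_carr by algebra
  ultimately show False using one_notin_mm by simp
qed

text \<open>The ascending chain condition is applied to the ideals between \<open>N\<close> and
  \<open>N + I\<close> that fail to contain \<open>I\<close>. For a maximal one, \<open>Q\<close>,
  every \<open>z\<close> in \<open>I\<close> outside \<open>Q\<close> satisfies
  \<open>I \<subseteq> Q + (z)\<close>. If a product \<open>y x\<close> with
  \<open>y \<in> \<mm>\<close> and \<open>x \<in> I\<close> were outside \<open>Q\<close>, then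
  \<open>x = q + r y x\<close>; as \<open>1 - r y\<close> is a unit, \<open>x\<close> and with it
  \<open>y x\<close> would lie in \<open>Q\<close>. So \<open>\<mm>I \<subseteq> Q\<close>, and the
  hypothesis gives the contradiction \<open>I \<subseteq> Q\<close>.\<close>

lemma nakayama:
  assumes "ideal I R" "ideal N R" "I \<subseteq> N <+>\<^bsub>R\<^esub> \<mm> \<cdot> I"
  shows "I \<subseteq> N"
proof (rule ccontr)
  assume "\<not> I \<subseteq> N"
  define S where "S Q \<longleftrightarrow> ideal Q R \<and> N \<subseteq> Q \<and> Q \<subseteq> N <+>\<^bsub>R\<^esub> I \<and> \<not> I \<subseteq> Q" for Q
  have NI: "ideal (N <+>\<^bsub>R\<^esub> I) R" using assms add_ideals by blast
  have "S N" using \<open>\<not> I \<subseteq> N\<close> assms set_add_left[OF assms(2,1)] unfolding S_def by simp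
  then obtain Q where Q: "S Q" "\<And>P. \<lbrakk>S P; Q \<subseteq> P\<rbrakk> \<Longrightarrow> P = Q"
    using obtain_maximal[of S N] S_def by metis
  have Qi: "ideal Q R" "N \<subseteq> Q" "Q \<subseteq> N <+>\<^bsub>R\<^esub> I" "\<not> I \<subseteq> Q" using Q(1) by (auto simp: S_def)
  have gen: "I \<subseteq> Q <+>\<^bsub>R\<^esub> PIdl z" if z: "z \<in> I" "z \<notin> Q" for z
  proof -
    have zc: "z \<in> carrier R" using z assms ideal_carr by blast
    have P: "ideal (PIdl z) R" using cgenideal_ideal[OF zc] .
    have i: "ideal (Q <+>\<^bsub>R\<^esub> PIdl z) R" using add_ideals[OF Qi(1) P] .
    have "PIdl z \<subseteq> I" using cgenideal_minimal[OF assms(1) z(1)] .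
    then have "Q <+>\<^bsub>R\<^esub> PIdl z \<subseteq> N <+>\<^bsub>R\<^esub> I"
      using set_add_least[OF NI Qi(3)] set_add_right[OF assms(2,1)] by blast
    moreover have "Q \<subseteq> Q <+>\<^bsub>R\<^esub> PIdl z" "z \<in> Q <+>\<^bsub>R\<^esub> PIdl z"
      using set_add_left[OF Qi(1) P] set_add_right[OF Qi(1) P] cgenideal_self[OF zc] by auto
    ultimately show ?thesis
      using Q(2)[of "Q <+>\<^bsub>R\<^esub> PIdl z"] i Qi(2) z(2) unfolding S_def by (metis order_trans)
  qed
  have "\<mm> \<cdot> I \<subseteq> Q"
  proof (rule prod_least[OF Qi(1)], rule ccontr)
    fix y x assume y: "y \<in> \<mm>" and x: "x \<in> I" and n: "y \<otimes> x \<notin> Q"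
    have xc: "x \<in> carrier R" using x assms ideal_carr by blast
    have yc: "y \<in> carrier R" using y mm_carr by blast
    have "y \<otimes> x \<in> I" using x assms yc ideal_lmult_mem by blast
    then have "x \<in> Q <+>\<^bsub>R\<^esub> PIdl (y \<otimes> x)" using gen n x by blast
    then obtain q r where q: "q \<in> Q" and r: "r \<in> carrier R" "x = q \<oplus> r \<otimes> (y \<otimes> x)"
      unfolding cgenideal_def by (auto elim!: set_addE)
    have qc: "q \<in> carrier R" using q Qi(1) ideal_carr by blast
    have "(\<one> \<ominus> r \<otimes> y) \<otimes> x = x \<ominus> r \<otimes> (y \<otimes> x)" using xc yc r by algebra
    also have "\<dots> = (q \<oplus> r \<otimes> (y \<otimes> x)) \<ominus> r \<otimes> (y \<otimes> x)" using r(2) by simp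
    also have "\<dots> = q" using xc yc qc r(1) by algebra
    finally have "(\<one> \<ominus> r \<otimes> y) \<otimes> x \<in> Q" using q by simp
    moreover have "r \<otimes> y \<in> \<mm>" using y r mm_ideal ideal_lmult_mem by blast
    ultimately have "x \<in> Q"
      using unit_cancel_mem[OF Qi(1) _ one_minus_notin_mm xc, of "r \<otimes> y"] yc r(1) by simp
    then have "y \<otimes> x \<in> Q" using Qi(1) yc ideal_lmult_mem by blast
    then show False using n by blast
  qed
  then have "I \<subseteq> Q" using assms(3) set_add_least[OF Qi(1,2)] by blast
  then show False using Qi(4) by blast
qed

text \<open>The set \<open>A\<close> is a basis of \<open>(V + W) / W\<close>, a vector space over
  the residue field because \<open>\<mm>V \<subseteq> W\<close>; independence means that a relation
  modulo \<open>W\<close> has all its coefficients in \<open>\<mm>\<close>. Among the finite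
  independent sets one is chosen with \<open>W + (A)\<close> maximal, so finite dimension comes
  directly from the Noetherian property.\<close>

lemma independent_generators:
  assumes V: "ideal V R" and W: "ideal W R" and VW: "\<mm> \<cdot> V \<subseteq> W"
  shows "\<exists>A. finite A \<and> A \<subseteq> V
    \<and> (\<forall>x\<in>V. \<exists>c. (\<forall>a\<in>A. c a \<in> carrier R) \<and> x \<ominus> lincomb R A c (\<lambda>a. a) \<in> W)
    \<and> (\<forall>c. (\<forall>a\<in>A. c a \<in> carrier R) \<longrightarrow> lincomb R A c (\<lambda>a. a) \<in> W \<longrightarrow> (\<forall>a\<in>A. c a \<in> \<mm>))"
proof -
  define indep where "indep A \<longleftrightarrow> finite A \<and> A \<subseteq> V \<and>
    (\<forall>c. (\<forall>a\<in>A. c a \<in> carrier R) \<longrightarrow> lincomb R A c (\<lambda>a. a) \<in> W \<longrightarrow> (\<forall>a\<in>A. c a \<in> \<mm>))" for A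
  have carr: "A \<subseteq> carrier R" if "indep A" for A using that V ideal_sub unfolding indep_def by blast
  define S where "S Q \<longleftrightarrow> (\<exists>A. indep A \<and> Q = W <+>\<^bsub>R\<^esub> Idl A)" for Q
  have "indep {}" by (simp add: indep_def)
  then have "S (W <+>\<^bsub>R\<^esub> Idl {})" unfolding S_def by blast
  moreover have "ideal Q R" if Q: "S Q" for Q
  proof -
    obtain A where "indep A" "Q = W <+>\<^bsub>R\<^esub> Idl A" using Q unfolding S_def by blast
    then show ?thesis using add_ideals[OF W genideal_ideal[OF carr]] by simp
  qed
  ultimately obtain Q where Q: "S Q" "\<And>P. \<lbrakk>S P; Q \<subseteq> P\<rbrakk> \<Longrightarrow> P = Q"
    using obtain_maximal[of S] by metis
  then obtain A where A: "indep A"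
    and max: "\<And>B. \<lbrakk>indep B; W <+>\<^bsub>R\<^esub> Idl A \<subseteq> W <+>\<^bsub>R\<^esub> Idl B\<rbrakk> \<Longrightarrow> W <+>\<^bsub>R\<^esub> Idl B = W <+>\<^bsub>R\<^esub> Idl A"
    unfolding S_def by metis
  have Ac: "A \<subseteq> carrier R" and Af: "finite A" using A carr indep_def by auto
  have IA: "Idl A = {lincomb R A c (\<lambda>a. a) | c. \<forall>a\<in>A. c a \<in> carrier R}"
    using genideal_lincomb[OF Af, of "\<lambda>a. a"] Ac by auto
  have IAi: "ideal (Idl A) R" using genideal_ideal Ac by blast
  have "V \<subseteq> W <+>\<^bsub>R\<^esub> Idl A"
  proof (rule ccontr)
    assume "\<not> ?thesis"
    then obtain x where x: "x \<in> V" "x \<notin> W <+>\<^bsub>R\<^esub> Idl A" by blast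
    have xc: "x \<in> carrier R" using x V ideal_carr by blast
    have WA: "ideal (W <+>\<^bsub>R\<^esub> Idl A) R" using W IAi add_ideals by blast
    have xA: "x \<notin> A"
      using genideal_self[OF Ac] set_add_right[OF W IAi] x(2) by blast
    have "indep (insert x A)" unfolding indep_def
    proof (intro conjI allI impI)
      fix c assume c: "\<forall>a\<in>insert x A. c a \<in> carrier R" and
        cW: "lincomb R (insert x A) c (\<lambda>a. a) \<in> W"
      have e: "lincomb R (insert x A) c (\<lambda>a. a) = c x \<otimes> x \<oplus> lincomb R A c (\<lambda>a. a)"
        by (rule lincomb_insert[OF Af xA]) (use c xc Ac in auto)
      have l: "lincomb R A c (\<lambda>a. a) \<in> Idl A" using IA c by blast
      \<comment> \<open>An invertible coefficient would put \<open>x\<close> into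
        \<open>W + (A)\<close>. Once the coefficient is in \<open>\<mm>\<close>, its term lies in
        \<open>\<mm>V \<subseteq> W\<close>, and the relation reduces to one among the elements of
        \<open>A\<close>.\<close>
      have cx: "c x \<in> \<mm>"
      proof (rule ccontr)
        assume "c x \<notin> \<mm>"
        moreover have "c x \<otimes> x \<in> W <+>\<^bsub>R\<^esub> Idl A"
        proof (rule ideal_cancel_right[OF WA])
          show "c x \<otimes> x \<oplus> lincomb R A c (\<lambda>a. a) \<in> W <+>\<^bsub>R\<^esub> Idl A"
            using cW e set_add_left[OF W IAi] by auto
          show "lincomb R A c (\<lambda>a. a) \<in> W <+>\<^bsub>R\<^esub> Idl A" using l set_add_right[OF W IAi] by auto
        qed (use c xc in auto)
        ultimately show False using unit_cancel_mem[OF WA] c xc x(2) by blast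
      qed
      then have "c x \<otimes> x \<in> W" using VW x(1) ideal_prod.prod[of "c x" \<mm> x V R] by blast
      then have "lincomb R A c (\<lambda>a. a) \<in> W"
        using ideal_cancel_left[OF W] cW e l IAi ideal_carr by metis
      then have "\<forall>a\<in>A. c a \<in> \<mm>" using A c unfolding indep_def by blast
      then show "\<forall>a\<in>insert x A. c a \<in> \<mm>" using cx by blast
    qed (use A x Af in \<open>auto simp: indep_def\<close>)
    moreover have xAc: "insert x A \<subseteq> carrier R" using xc Ac by blast
    have "Idl A \<subseteq> Idl (insert x A)" using subset_Idl_subset[OF xAc] by blast
    then have "W <+>\<^bsub>R\<^esub> Idl A \<subseteq> W <+>\<^bsub>R\<^esub> Idl (insert x A)" by (intro set_add_mono) auto
    ultimately have "W <+>\<^bsub>R\<^esub> Idl (insert x A) = W <+>\<^bsub>R\<^esub> Idl A" using max by blast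
    moreover have "x \<in> W <+>\<^bsub>R\<^esub> Idl (insert x A)"
      using genideal_self[OF xAc] set_add_right[OF W genideal_ideal[OF xAc]] by blast
    ultimately show False using x by blast
  qed
  have "\<exists>c. (\<forall>a\<in>A. c a \<in> carrier R) \<and> x \<ominus> lincomb R A c (\<lambda>a. a) \<in> W" if "x \<in> V" for x
  proof -
    have "x \<in> W <+>\<^bsub>R\<^esub> Idl A" using \<open>V \<subseteq> _\<close> that by blast
    then obtain w c where w: "w \<in> W" "\<forall>a\<in>A. c a \<in> carrier R" "x = w \<oplus> lincomb R A c (\<lambda>a. a)"
      unfolding IA by (auto elim!: set_addE)
    have "w \<in> carrier R" using w W ideal_carr by blast
    moreover have "lincomb R A c (\<lambda>a. a) \<in> carrier R" using w(2) Ac by (intro lincomb_closed) auto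
    ultimately have "x \<ominus> lincomb R A c (\<lambda>a. a) = w" unfolding w(3) by (rule add_minus_cancel)
    then show ?thesis using w by auto
  qed
  then show ?thesis using A unfolding indep_def by blast
qed

end

section \<open>Polynomial functions and general elements\<close>

definition coords :: "('a, 'b) ring_scheme \<Rightarrow> nat \<Rightarrow> (nat \<Rightarrow> 'a) set" where
  "coords R n = {a. \<forall>i<n. a i \<in> carrier R}"

text \<open>Only the values on \<open>coords\<close> matter. The coefficients are taken in
  \<open>R\<close> itself: a polynomial over the residue field is represented by a lift, and its
  nonvanishing at a point by a value outside \<open>\<mm>\<close>.\<close>

definition polyfun :: "('a, 'b) ring_scheme \<Rightarrow> nat \<Rightarrow> ((nat \<Rightarrow> 'a) \<Rightarrow> 'a) \<Rightarrow> bool" where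
  "polyfun R n F \<longleftrightarrow> (\<exists>E c. finite E \<and> (\<forall>e\<in>E. c e \<in> carrier R) \<and>
     (\<forall>a\<in>coords R n. F a = poly_eval R n E c a))"

text \<open>Horner form of a polynomial function, with the number as a bound on the degree. The
  recursion makes splitting off a factor \<open>t - r\<close> a simple induction.\<close>

primrec unipoly :: "('a, 'b) ring_scheme \<Rightarrow> nat \<Rightarrow> ('a \<Rightarrow> 'a) \<Rightarrow> bool" where
  "unipoly R 0 f \<longleftrightarrow> (\<exists>c\<in>carrier R. \<forall>t\<in>carrier R. f t = c)"
| "unipoly R (Suc N) f \<longleftrightarrow>
     (\<exists>c\<in>carrier R. \<exists>g. unipoly R N g \<and> (\<forall>t\<in>carrier R. f t = c \<oplus>\<^bsub>R\<^esub> t \<otimes>\<^bsub>R\<^esub> g t))"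

context cring
begin

lemma mono_eval_closed [simp]: "a \<in> coords R n \<Longrightarrow> mono_eval R n e a \<in> carrier R"
  unfolding mono_eval_def coords_def by (intro finprod_closed) auto

lemma poly_eval_insert:
  assumes "finite E" "e \<notin> E" "\<forall>e\<in>insert e E. c e \<in> carrier R" "a \<in> coords R n"
  shows "poly_eval R n (insert e E) c a = c e \<otimes> mono_eval R n e a \<oplus> poly_eval R n E c a"
  unfolding poly_eval_def using assms by (intro finsum_insert) auto

lemma poly_eval_closed:
  assumes "\<forall>e\<in>E. c e \<in> carrier R" "a \<in> coords R n"
  shows "poly_eval R n E c a \<in> carrier R"
  unfolding poly_eval_def using assms by (intro finsum_closed) auto

lemma polyfun_closed: "\<lbrakk>polyfun R n F; a \<in> coords R n\<rbrakk> \<Longrightarrow> F a \<in> carrier R"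
  unfolding polyfun_def by (auto simp: poly_eval_closed)

lemma polyfun_cong:
  assumes "polyfun R n F" "\<And>a. a \<in> coords R n \<Longrightarrow> F a = G a" shows "polyfun R n G"
  using assms unfolding polyfun_def by metis

lemma polyfun_add:
  assumes "polyfun R n F" "polyfun R n G" shows "polyfun R n (\<lambda>a. F a \<oplus> G a)"
proof -
  obtain E c where E: "finite E" "\<forall>e\<in>E. c e \<in> carrier R" "\<forall>a\<in>coords R n. F a = poly_eval R n E c a"
    using assms(1) unfolding polyfun_def by blast
  obtain D d where D: "finite D" "\<forall>e\<in>D. d e \<in> carrier R" "\<forall>a\<in>coords R n. G a = poly_eval R n D d a"
    using assms(2) unfolding polyfun_def by blast
  define c' where "c' e = (if e \<in> E then c e else \<zero>)" for e
  define d' where "d' e = (if e \<in> D then d e else \<zero>)" for e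
  have ext: "poly_eval R n A f a = poly_eval R n (E \<union> D) (\<lambda>e. if e \<in> A then f e else \<zero>) a"
    if "A \<subseteq> E \<union> D" "\<forall>e\<in>A. f e \<in> carrier R" "a \<in> coords R n" for A f a
    unfolding poly_eval_def
    by (rule add.finprod_mono_neutral_cong_left) (use that E D in auto)
  have "F a \<oplus> G a = poly_eval R n (E \<union> D) (\<lambda>e. c' e \<oplus> d' e) a" if a: "a \<in> coords R n" for a
  proof -
    have "poly_eval R n (E \<union> D) (\<lambda>e. c' e \<oplus> d' e) a
      = (\<Oplus>e\<in>E \<union> D. c' e \<otimes> mono_eval R n e a \<oplus> d' e \<otimes> mono_eval R n e a)"
      unfolding poly_eval_def using E D a
      by (intro finsum_cong') (auto simp: c'_def d'_def l_distr)
    also have "\<dots> = poly_eval R n (E \<union> D) c' a \<oplus> poly_eval R n (E \<union> D) d' a"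
      unfolding poly_eval_def using E D a
      by (intro finsum_addf) (auto simp: c'_def d'_def)
    also have "\<dots> = F a \<oplus> G a"
      using ext[of E c a] ext[of D d a] E D a unfolding c'_def d'_def by simp
    finally show ?thesis ..
  qed
  moreover have "\<forall>e\<in>E \<union> D. c' e \<oplus> d' e \<in> carrier R" using E D by (auto simp: c'_def d'_def)
  ultimately show ?thesis using E(1) D(1) unfolding polyfun_def
    by (intro exI[of _ "E \<union> D"] exI[of _ "\<lambda>e. c' e \<oplus> d' e"]) auto
qed

lemma polyfun_term:
  assumes "x \<in> carrier R" shows "polyfun R n (\<lambda>a. x \<otimes> mono_eval R n e a)"
  unfolding polyfun_def
  by (intro exI[of _ "{e}"] exI[of _ "\<lambda>_. x"]) (use assms in \<open>auto simp: poly_eval_def\<close>)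

lemma polyfun_const:
  assumes "x \<in> carrier R" shows "polyfun R n (\<lambda>a. x)"
proof (rule polyfun_cong[OF polyfun_term[OF assms, of n "\<lambda>_. 0"]])
  show "x \<otimes> mono_eval R n (\<lambda>_. 0) a = x" if "a \<in> coords R n" for a
    using assms by (simp add: mono_eval_def)
qed

lemma polyfun_coord:
  assumes "i < n" shows "polyfun R n (\<lambda>a. a i)"
proof (rule polyfun_cong[OF polyfun_term[OF one_closed, of n "\<lambda>j. if j = i then 1 else 0"]])
  fix a assume a: "a \<in> coords R n"
  have "mono_eval R n (\<lambda>j. if j = i then 1 else 0) a = (\<Otimes>j\<in>{..<n}. if i = j then a j else \<one>)"
    unfolding mono_eval_def using a by (intro finprod_cong') (auto simp: coords_def)
  also have "\<dots> = a i" using a assms by (intro finprod_singleton) (auto simp: coords_def)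
  finally show "\<one> \<otimes> mono_eval R n (\<lambda>j. if j = i then 1 else 0) a = a i"
    using a assms by (simp add: coords_def)
qed

text \<open>One monomial is added at a time. The congruence case belongs to the rule because a
  polynomial determines \<open>F\<close> on \<open>coords\<close> only.\<close>

lemma polyfun_induct [consumes 1, case_names cong zero step]:
  assumes "polyfun R n F"
    and cong: "\<And>F G. \<lbrakk>P F; \<And>a. a \<in> coords R n \<Longrightarrow> F a = G a\<rbrakk> \<Longrightarrow> P G"
    and zero: "P (\<lambda>a. \<zero>)"
    and step: "\<And>x e G. \<lbrakk>x \<in> carrier R; polyfun R n G; P G\<rbrakk> \<Longrightarrow> P (\<lambda>a. x \<otimes> mono_eval R n e a \<oplus> G a)"
  shows "P F"
proof -
  obtain E c where E: "finite E" "\<forall>e\<in>E. c e \<in> carrier R" "\<forall>a\<in>coords R n. F a = poly_eval R n E c a"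
    using assms(1) unfolding polyfun_def by blast
  from E(1,2) have "P (poly_eval R n E c)"
  proof (induct E)
    case empty
    show ?case by (rule cong[OF zero]) (simp add: poly_eval_def)
  next
    case (insert e E)
    have "polyfun R n (poly_eval R n E c)" unfolding polyfun_def using insert by blast
    then have "P (\<lambda>a. c e \<otimes> mono_eval R n e a \<oplus> poly_eval R n E c a)"
      using step insert by simp
    then show ?case by (rule cong) (use insert in \<open>auto simp: poly_eval_insert\<close>)
  qed
  then show ?thesis by (rule cong) (use E(3) in auto)
qed

lemma polyfun_term_mult:
  assumes "polyfun R n G" "x \<in> carrier R"
  shows "polyfun R n (\<lambda>a. x \<otimes> mono_eval R n e a \<otimes> G a)"
  using assms(1)
proof (induct rule: polyfun_induct)
  case (cong F G)
  show ?case by (rule polyfun_cong[OF cong(1)]) (simp add: cong(2))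
next
  case zero
  show ?case by (rule polyfun_cong[OF polyfun_const[OF zero_closed]]) (use assms in simp)
next
  case (step y e' G)
  have "polyfun R n (\<lambda>a. (x \<otimes> y) \<otimes> mono_eval R n (\<lambda>i. e i + e' i) a \<oplus> x \<otimes> mono_eval R n e a \<otimes> G a)"
    using polyfun_add polyfun_term step assms by simp
  then show ?case
  proof (rule polyfun_cong)
    fix a assume a: "a \<in> coords R n"
    have "mono_eval R n (\<lambda>i. e i + e' i) a = (\<Otimes>i\<in>{..<n}. a i [^] e i \<otimes> a i [^] e' i)"
      unfolding mono_eval_def using a by (intro finprod_cong') (auto simp: coords_def nat_pow_mult)
    also have "\<dots> = mono_eval R n e a \<otimes> mono_eval R n e' a"
      unfolding mono_eval_def using a by (intro finprod_multf) (auto simp: coords_def)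
    finally have 1: "mono_eval R n (\<lambda>i. e i + e' i) a = mono_eval R n e a \<otimes> mono_eval R n e' a" .
    have "G a \<in> carrier R" "mono_eval R n e a \<in> carrier R" "mono_eval R n e' a \<in> carrier R"
      using step a polyfun_closed by auto
    then show "(x \<otimes> y) \<otimes> mono_eval R n (\<lambda>i. e i + e' i) a \<oplus> x \<otimes> mono_eval R n e a \<otimes> G a
      = x \<otimes> mono_eval R n e a \<otimes> (y \<otimes> mono_eval R n e' a \<oplus> G a)"
      unfolding 1 using step assms by algebra
  qed
qed

lemma polyfun_mult:
  assumes "polyfun R n F" "polyfun R n G" shows "polyfun R n (\<lambda>a. F a \<otimes> G a)"
  using assms(1)
proof (induct rule: polyfun_induct)
  case (cong F F')
  show ?case by (rule polyfun_cong[OF cong(1)]) (simp add: cong(2))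
next
  case zero
  show ?case
    by (rule polyfun_cong[OF polyfun_const[OF zero_closed]]) (use polyfun_closed[OF assms(2)] in simp)
next
  case (step x e F)
  have "polyfun R n (\<lambda>a. x \<otimes> mono_eval R n e a \<otimes> G a \<oplus> F a \<otimes> G a)"
    using polyfun_add polyfun_term_mult step assms by simp
  then show ?case
    by (rule polyfun_cong) (use step assms polyfun_closed in \<open>auto simp: l_distr\<close>)
qed

lemma polyfun_lincomb:
  assumes "finite I" "\<And>i. i \<in> I \<Longrightarrow> polyfun R n (\<lambda>a. F a i)" "\<And>i. i \<in> I \<Longrightarrow> g i \<in> carrier R"
  shows "polyfun R n (\<lambda>a. lincomb R I (F a) g)"
  using assms
proof (induct I)
  case empty
  show ?case using polyfun_const[OF zero_closed] by simp
next
  case (insert i I)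
  have "polyfun R n (\<lambda>a. F a i \<otimes> g i \<oplus> lincomb R I (F a) g)"
    by (intro polyfun_add polyfun_mult polyfun_const) (use insert in auto)
  then show ?case
  proof (rule polyfun_cong)
    fix a assume a: "a \<in> coords R n"
    show "F a i \<otimes> g i \<oplus> lincomb R I (F a) g = lincomb R (insert i I) (F a) g"
      by (rule lincomb_insert[symmetric])
        (use insert a in \<open>auto intro: polyfun_closed[of n "\<lambda>a. F a j" a for j]\<close>)
  qed
qed

section \<open>Polynomial functions in one variable, and restriction to lines\<close>

lemma unipoly_closed: "\<lbrakk>unipoly R N f; t \<in> carrier R\<rbrakk> \<Longrightarrow> f t \<in> carrier R"
  by (induct N arbitrary: f) auto

lemma unipoly_cong: "\<lbrakk>unipoly R N f; \<And>t. t \<in> carrier R \<Longrightarrow> f t = g t\<rbrakk> \<Longrightarrow> unipoly R N g"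
  by (cases N) auto

lemma unipoly_const: "c \<in> carrier R \<Longrightarrow> unipoly R N (\<lambda>t. c)"
proof (induct N arbitrary: c)
  case (Suc N)
  show ?case using Suc(1)[OF zero_closed] Suc(2) by (auto intro!: bexI[of _ c] exI[of _ "\<lambda>t. \<zero>"])
qed auto

lemma unipoly_Suc: "unipoly R N f \<Longrightarrow> unipoly R (Suc N) f"
proof (induct N arbitrary: f)
  case 0
  then obtain c where c: "c \<in> carrier R" "\<forall>t\<in>carrier R. f t = c" by auto
  show ?case by (rule unipoly_cong[OF unipoly_const[OF c(1)]]) (use c in auto)
next
  case (Suc N)
  then obtain c g where "c \<in> carrier R" "unipoly R N g" "\<forall>t\<in>carrier R. f t = c \<oplus> t \<otimes> g t" by auto
  then show ?case using Suc(1)[of g] by (subst unipoly.simps) blast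
qed

lemma unipoly_mono: "\<lbrakk>unipoly R N f; N \<le> M\<rbrakk> \<Longrightarrow> unipoly R M f"
  by (rule dec_induct[of N M "\<lambda>M. unipoly R M f"]) (auto intro: unipoly_Suc simp del: unipoly.simps)

lemma unipoly_add:
  "\<lbrakk>unipoly R N f; unipoly R N g\<rbrakk> \<Longrightarrow> unipoly R N (\<lambda>t. f t \<oplus> g t)"
proof (induct N arbitrary: f g)
  case 0
  then show ?case by auto
next
  case (Suc N)
  obtain c f' where f: "c \<in> carrier R" "unipoly R N f'" "\<forall>t\<in>carrier R. f t = c \<oplus> t \<otimes> f' t"
    using Suc(2) by auto
  obtain d g' where g: "d \<in> carrier R" "unipoly R N g'" "\<forall>t\<in>carrier R. g t = d \<oplus> t \<otimes> g' t"
    using Suc(3) by auto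
  have "f t \<oplus> g t = (c \<oplus> d) \<oplus> t \<otimes> (f' t \<oplus> g' t)" if t: "t \<in> carrier R" for t
  proof -
    have "f' t \<in> carrier R" "g' t \<in> carrier R" using f g t unipoly_closed by auto
    then show ?thesis using f g t by (simp, algebra)
  qed
  then show ?case using Suc(1)[OF f(2) g(2)] f(1) g(1) by (subst unipoly.simps) blast
qed

lemma unipoly_smult:
  "\<lbrakk>unipoly R N f; x \<in> carrier R\<rbrakk> \<Longrightarrow> unipoly R N (\<lambda>t. x \<otimes> f t)"
proof (induct N arbitrary: f)
  case (Suc N)
  obtain c f' where f: "c \<in> carrier R" "unipoly R N f'" "\<forall>t\<in>carrier R. f t = c \<oplus> t \<otimes> f' t"
    using Suc(2) by auto
  have "x \<otimes> f t = x \<otimes> c \<oplus> t \<otimes> (x \<otimes> f' t)" if t: "t \<in> carrier R" for t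
  proof -
    have "f' t \<in> carrier R" using f t unipoly_closed by auto
    then show ?thesis using f t Suc(3) by (simp, algebra)
  qed
  then show ?case using Suc(1)[OF f(2) Suc(3)] f(1) Suc(3) by (subst unipoly.simps) blast
qed auto

lemma unipoly_mult:
  "\<lbrakk>unipoly R N f; unipoly R M g\<rbrakk> \<Longrightarrow> unipoly R (N + M) (\<lambda>t. f t \<otimes> g t)"
proof (induct N arbitrary: f)
  case 0
  then obtain c where c: "c \<in> carrier R" "\<forall>t\<in>carrier R. f t = c" by auto
  show ?case using unipoly_cong[OF unipoly_smult[OF 0(2) c(1)], of "\<lambda>t. f t \<otimes> g t"] c by simp
next
  case (Suc N)
  obtain c f' where f: "c \<in> carrier R" "unipoly R N f'" "\<forall>t\<in>carrier R. f t = c \<oplus> t \<otimes> f' t"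
    using Suc(2) by auto
  have "unipoly R (Suc (N + M)) (\<lambda>t. \<zero> \<oplus> t \<otimes> (f' t \<otimes> g t))"
    using Suc(1)[OF f(2) Suc(3)] by auto
  then have "unipoly R (Suc (N + M)) (\<lambda>t. c \<otimes> g t \<oplus> (\<zero> \<oplus> t \<otimes> (f' t \<otimes> g t)))"
    using unipoly_add unipoly_mono[OF unipoly_smult[OF Suc(3) f(1)], of "Suc (N + M)"]
    by (simp del: unipoly.simps)
  then have "unipoly R (Suc (N + M)) (\<lambda>t. f t \<otimes> g t)"
  proof (rule unipoly_cong)
    fix t assume t: "t \<in> carrier R"
    have "f' t \<in> carrier R" "g t \<in> carrier R" using f Suc(3) t unipoly_closed by auto
    then show "c \<otimes> g t \<oplus> (\<zero> \<oplus> t \<otimes> (f' t \<otimes> g t)) = f t \<otimes> g t" using f t by (simp, algebra)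
  qed
  then show ?case by simp
qed

text \<open>On a line the coordinates are affine functions of the parameter, so monomials and their
  combinations stay polynomial in it. Nonvanishing of several functions at a common point can then
  be decided by counting roots.\<close>

lemma polyfun_line:
  assumes "polyfun R n F" "a \<in> coords R n" "b \<in> coords R n"
  shows "\<exists>N. unipoly R N (\<lambda>t. F (\<lambda>i. a i \<oplus> t \<otimes> b i))"
  using assms(1)
proof (induct rule: polyfun_induct)
  case (cong F G)
  then obtain N where "unipoly R N (\<lambda>t. F (\<lambda>i. a i \<oplus> t \<otimes> b i))" by blast
  then have "unipoly R N (\<lambda>t. G (\<lambda>i. a i \<oplus> t \<otimes> b i))"
    by (rule unipoly_cong) (use cong assms in \<open>auto simp: coords_def\<close>)
  then show ?case by blast
next
  case zero
  show ?case using unipoly_const[OF zero_closed] by blast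
next
  case (step x e G)
  then obtain N where N: "unipoly R N (\<lambda>t. G (\<lambda>i. a i \<oplus> t \<otimes> b i))" by blast
  have lin: "unipoly R (Suc 0) (\<lambda>t. a i \<oplus> t \<otimes> b i)" if "i < n" for i
  proof -
    have "unipoly R 0 (\<lambda>t. b i)" "a i \<in> carrier R"
      using unipoly_const assms(2,3) that unfolding coords_def by auto
    then show ?thesis unfolding unipoly.simps(2)[of R 0] by blast
  qed
  have pw: "\<exists>M. unipoly R M (\<lambda>t. (a i \<oplus> t \<otimes> b i) [^] (k::nat))" if "i < n" for i k
  proof (induct k)
    case 0
    show ?case using unipoly_const[OF one_closed] by (auto simp del: unipoly.simps)
  next
    case (Suc k)
    then obtain M where "unipoly R M (\<lambda>t. (a i \<oplus> t \<otimes> b i) [^] k)" by blast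
    from unipoly_mult[OF this lin[OF that]] show ?case by (auto simp del: unipoly.simps)
  qed
  have "\<exists>M. unipoly R M (\<lambda>t. \<Otimes>i\<in>I. (a i \<oplus> t \<otimes> b i) [^] e i)" if "finite I" "I \<subseteq> {..<n}" for I
    using that
  proof (induct I)
    case empty
    show ?case using unipoly_const[OF one_closed] by (auto simp del: unipoly.simps)
  next
    case (insert i I)
    then obtain M M' where "unipoly R M (\<lambda>t. (a i \<oplus> t \<otimes> b i) [^] e i)"
      "unipoly R M' (\<lambda>t. \<Otimes>i\<in>I. (a i \<oplus> t \<otimes> b i) [^] e i)" using pw by blast
    then have "unipoly R (M + M') (\<lambda>t. (a i \<oplus> t \<otimes> b i) [^] e i \<otimes> (\<Otimes>i\<in>I. (a i \<oplus> t \<otimes> b i) [^] e i))"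
      by (rule unipoly_mult)
    then have "unipoly R (M + M') (\<lambda>t. \<Otimes>i\<in>insert i I. (a i \<oplus> t \<otimes> b i) [^] e i)"
    proof (rule unipoly_cong)
      fix t assume t: "t \<in> carrier R"
      have "\<And>j. j \<in> insert i I \<Longrightarrow> a j \<oplus> t \<otimes> b j \<in> carrier R"
        using assms insert t by (auto simp: coords_def)
      then show "(a i \<oplus> t \<otimes> b i) [^] e i \<otimes> (\<Otimes>i\<in>I. (a i \<oplus> t \<otimes> b i) [^] e i)
        = (\<Otimes>i\<in>insert i I. (a i \<oplus> t \<otimes> b i) [^] e i)"
        using insert by (intro finprod_insert[symmetric]) auto
    qed
    then show ?case by blast
  qed
  then obtain M where M: "unipoly R M (\<lambda>t. mono_eval R n e (\<lambda>i. a i \<oplus> t \<otimes> b i))"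
    unfolding mono_eval_def by blast
  have "unipoly R (max M N) (\<lambda>t. x \<otimes> mono_eval R n e (\<lambda>i. a i \<oplus> t \<otimes> b i) \<oplus> G (\<lambda>i. a i \<oplus> t \<otimes> b i))"
    by (intro unipoly_add unipoly_mono[OF N] unipoly_mono[OF unipoly_smult[OF M step(1)]]) auto
  then show ?case by blast
qed

text \<open>Division by \<open>t - r\<close> with remainder \<open>f r\<close>. If
  \<open>f = c + t g\<close> and \<open>g = g(r) + (t - r) h\<close>, then
  \<open>t g(t) - r g(r) = (t - r) (g(t) + r h(t))\<close>, which gives the quotient of the
  inductive step.\<close>

lemma unipoly_diff:
  "\<lbrakk>unipoly R (Suc N) f; r \<in> carrier R\<rbrakk>
   \<Longrightarrow> \<exists>h. unipoly R N h \<and> (\<forall>t\<in>carrier R. f t = f r \<oplus> (t \<ominus> r) \<otimes> h t)"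
proof (induct N arbitrary: f)
  case 0
  then obtain c g where g: "c \<in> carrier R" "unipoly R 0 g" "\<forall>t\<in>carrier R. f t = c \<oplus> t \<otimes> g t"
    using unipoly.simps(2)[of R 0 f] by blast
  obtain d where "d \<in> carrier R" "\<forall>t\<in>carrier R. g t = d" using g(2) by auto
  with g(1,3) have cd: "c \<in> carrier R" "d \<in> carrier R" "\<forall>t\<in>carrier R. f t = c \<oplus> t \<otimes> d" by simp_all
  have "f t = f r \<oplus> (t \<ominus> r) \<otimes> d" if t: "t \<in> carrier R" for t
  proof -
    have "f t = c \<oplus> t \<otimes> d" "f r = c \<oplus> r \<otimes> d" using cd(3) t 0(2) by auto
    moreover have "c \<oplus> t \<otimes> d = c \<oplus> r \<otimes> d \<oplus> (t \<ominus> r) \<otimes> d" using cd(1,2) t 0(2) by algebra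
    ultimately show ?thesis by metis
  qed
  then show ?case using unipoly_const[OF cd(2), of 0] by blast
next
  case (Suc N)
  obtain c g where g: "c \<in> carrier R" "unipoly R (Suc N) g" "\<forall>t\<in>carrier R. f t = c \<oplus> t \<otimes> g t"
    using Suc(2) unipoly.simps(2)[of R "Suc N" f] by blast
  obtain h where h: "unipoly R N h" "\<forall>t\<in>carrier R. g t = g r \<oplus> (t \<ominus> r) \<otimes> h t"
    using Suc(1)[OF g(2) Suc(3)] by blast
  have "unipoly R (Suc N) (\<lambda>t. g t \<oplus> r \<otimes> h t)"
    by (rule unipoly_add[OF g(2) unipoly_Suc[OF unipoly_smult[OF h(1) Suc(3)]]])
  moreover have "f t = f r \<oplus> (t \<ominus> r) \<otimes> (g t \<oplus> r \<otimes> h t)" if t: "t \<in> carrier R" for t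
  proof -
    have c: "h t \<in> carrier R" "g r \<in> carrier R"
      by (rule unipoly_closed[OF h(1) t] unipoly_closed[OF g(2) Suc(3)])+
    have "f t = c \<oplus> t \<otimes> (g r \<oplus> (t \<ominus> r) \<otimes> h t)" "f r = c \<oplus> r \<otimes> g r" "g t = g r \<oplus> (t \<ominus> r) \<otimes> h t"
      using g(3) h(2) t Suc(3) by metis+
    moreover have "c \<oplus> t \<otimes> (g r \<oplus> (t \<ominus> r) \<otimes> h t)
      = c \<oplus> r \<otimes> g r \<oplus> (t \<ominus> r) \<otimes> (g r \<oplus> (t \<ominus> r) \<otimes> h t \<oplus> r \<otimes> h t)"
      using c g(1) t Suc(3) by algebra
    ultimately show ?thesis by metis
  qed
  ultimately show ?case by blast
qed

end

text \<open>For a fixed system of generators of the maximal ideal this is validity on a nonempty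
  basic open set, the one on which the reduction of \<open>g\<close> modulo the maximal ideal does
  not vanish.\<close>

definition generic :: "('a, 'b) ring_scheme \<Rightarrow> nat \<Rightarrow> ((nat \<Rightarrow> 'a) \<Rightarrow> bool) \<Rightarrow> bool" where
  "generic R n Q \<longleftrightarrow> (\<exists>g. polyfun R n g \<and> (\<exists>a\<in>coords R n. g a \<notin> max_ideal R)
     \<and> (\<forall>a\<in>coords R n. g a \<notin> max_ideal R \<longrightarrow> Q a))"

lemma generic_mono:
  "\<lbrakk>generic R n P; \<And>a. \<lbrakk>a \<in> coords R n; P a\<rbrakk> \<Longrightarrow> Q a\<rbrakk> \<Longrightarrow> generic R n Q"
  unfolding generic_def by blast

lemma generic_ex: "generic R n P \<Longrightarrow> \<exists>a\<in>coords R n. P a"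
  unfolding generic_def by blast

text \<open>Separates the choice of generators from the open condition, so that the openness
  arguments can work with one fixed system \<open>ys\<close>.\<close>

lemma general_elt_iff:
  "general_elt R P \<longleftrightarrow> (\<exists>ys. (\<forall>i<min_num_gens R (max_ideal R). ys i \<in> carrier R)
     \<and> Idl\<^bsub>R\<^esub> (ys ` {..<min_num_gens R (max_ideal R)}) = max_ideal R
     \<and> generic R (min_num_gens R (max_ideal R)) (\<lambda>a. P (lin_comb R (min_num_gens R (max_ideal R)) a ys)))"
  (is "_ \<longleftrightarrow> (\<exists>ys. ?A ys \<and> ?B ys \<and> generic R ?n (?Q ys))")
proof
  assume "general_elt R P"
  then obtain ys E c where *: "?A ys" "?B ys" "finite E" "\<forall>e\<in>E. c e \<in> carrier R"
    "\<exists>a\<in>coords R ?n. poly_eval R ?n E c a \<notin> max_ideal R"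
    "\<forall>a\<in>coords R ?n. poly_eval R ?n E c a \<notin> max_ideal R \<longrightarrow> ?Q ys a"
    unfolding general_elt_def Let_def coords_def mem_Collect_eq Bex_def Ball_def by blast
  then have "polyfun R ?n (poly_eval R ?n E c)" unfolding polyfun_def by blast
  then show "\<exists>ys. ?A ys \<and> ?B ys \<and> generic R ?n (?Q ys)" using * unfolding generic_def by blast
next
  assume "\<exists>ys. ?A ys \<and> ?B ys \<and> generic R ?n (?Q ys)"
  then obtain ys g E c where "?A ys" "?B ys" "finite E" "\<forall>e\<in>E. c e \<in> carrier R"
    "\<forall>a\<in>coords R ?n. g a = poly_eval R ?n E c a" "\<exists>a\<in>coords R ?n. g a \<notin> max_ideal R"
    "\<forall>a\<in>coords R ?n. g a \<notin> max_ideal R \<longrightarrow> ?Q ys a"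
    unfolding generic_def polyfun_def by blast
  then show "general_elt R P" unfolding general_elt_def Let_def coords_def
    by (intro exI[of _ ys] exI[of _ E] exI[of _ c]) auto
qed

section \<open>Root counting and intersections of generic conditions\<close>

context noetherian_local
begin

text \<open>Over the residue field: a polynomial of degree at most \<open>N\<close> with more than
  \<open>N\<close> roots vanishes everywhere. After division by \<open>t - r\<close> the quotient
  still vanishes modulo \<open>\<mm>\<close> on the rest of \<open>T\<close>, because the
  differences \<open>s - r\<close> lie outside the prime ideal \<open>\<mm>\<close>.\<close>

lemma unipoly_roots:
  assumes "unipoly R N f" "T \<subseteq> carrier R" "finite T" "card T > N"
    "\<And>s t. \<lbrakk>s \<in> T; t \<in> T; s \<noteq> t\<rbrakk> \<Longrightarrow> s \<ominus> t \<notin> \<mm>" "\<And>t. t \<in> T \<Longrightarrow> f t \<in> \<mm>" "t \<in> carrier R"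
  shows "f t \<in> \<mm>"
  using assms
proof (induct N arbitrary: f T t)
  case 0
  then obtain c s where c: "c \<in> carrier R" "\<forall>t\<in>carrier R. f t = c" and s: "s \<in> T"
    by (auto simp: card_gt_0_iff)
  then show ?case using "0.prems"(2,6,7) by (metis subsetD)
next
  case (Suc N)
  obtain r where r: "r \<in> T" using Suc.prems(4) by fastforce
  have rc: "r \<in> carrier R" using r Suc.prems by blast
  obtain h where h: "unipoly R N h" "\<forall>t\<in>carrier R. f t = f r \<oplus> (t \<ominus> r) \<otimes> h t"
    using unipoly_diff[OF Suc.prems(1) rc] by blast
  have "h s \<in> \<mm>" if s: "s \<in> T - {r}" for s
  proof -
    have sc: "s \<in> carrier R" "h s \<in> carrier R" using s Suc.prems(2) unipoly_closed[OF h(1)] by auto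
    have "f r \<oplus> (s \<ominus> r) \<otimes> h s \<in> \<mm>" using h(2) sc Suc.prems(6)[of s] s by force
    then have "(s \<ominus> r) \<otimes> h s \<in> \<mm>"
      using ideal_cancel_left[OF mm_ideal] Suc.prems(6)[OF r] sc rc by simp
    then show ?thesis using mm_prime[of "s \<ominus> r" "h s"] Suc.prems(5)[of s r] s r sc rc by simp
  qed
  then have "h t \<in> \<mm>"
  proof (intro Suc.hyps[OF h(1), of "T - {r}" t])
    show "N < card (T - {r})" using Suc.prems(3,4) r by simp
    show "T - {r} \<subseteq> carrier R" using Suc.prems(2) by blast
    show "\<And>s t. \<lbrakk>s \<in> T - {r}; t \<in> T - {r}; s \<noteq> t\<rbrakk> \<Longrightarrow> s \<ominus> t \<notin> \<mm>"
      using Suc.prems(5) by simp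
  qed (use Suc.prems(3,7) in simp_all)
  then have "f r \<oplus> (t \<ominus> r) \<otimes> h t \<in> \<mm>"
    using Suc.prems(6)[OF r] Suc.prems(7) rc mm_ideal by (simp add: ideal_mem)
  then show ?case using h(2) Suc.prems(7) by metis
qed

lemma residue_transversal:
  assumes "residue_field_infinite R"
  obtains T where "T \<subseteq> carrier R" "finite T" "card T = N"
    "\<And>s t. \<lbrakk>s \<in> T; t \<in> T; s \<noteq> t\<rbrakk> \<Longrightarrow> s \<ominus> t \<notin> \<mm>"
proof -
  have "infinite (a_rcosets \<mm>)"
    using assms unfolding residue_field_infinite_def FactRing_def by simp
  then obtain S where S: "S \<subseteq> a_rcosets \<mm>" "finite S" "card S = N"
    using infinite_arbitrarily_large by blast
  have "\<forall>C\<in>S. \<exists>x. x \<in> carrier R \<and> a_r_coset R \<mm> x = C" using S(1) unfolding A_RCOSETS_def' by blast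
  then obtain f where f: "\<And>C. C \<in> S \<Longrightarrow> f C \<in> carrier R"
    "\<And>C. C \<in> S \<Longrightarrow> a_r_coset R \<mm> (f C) = C" by metis
  have inj: "inj_on f S" using f(2) by (metis inj_onI)
  show thesis
  proof (rule that[of "f ` S"])
    show "s \<ominus> t \<notin> \<mm>" if "s \<in> f ` S" "t \<in> f ` S" "s \<noteq> t" for s t
      using that f quotient_eq_iff_same_a_r_cos[OF mm_ideal] by (metis imageE)
  qed (use f S card_image[OF inj] in auto)
qed

text \<open>Affine space over an infinite field is irreducible. A point where \<open>g\<close>
  survives modulo \<open>\<mm>\<close> is joined by a line to one where \<open>h\<close> survives.
  On the line both become one-variable polynomials, of degrees at most \<open>N\<close> and
  \<open>M\<close>, that do not vanish identically modulo \<open>\<mm>\<close>. Among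
  \<open>N + M + 1\<close> parameters that are distinct modulo \<open>\<mm>\<close>, one is a root
  of neither.\<close>

lemma generic_conj:
  assumes inf: "residue_field_infinite R" and P: "generic R n P" and Q: "generic R n Q"
  shows "generic R n (\<lambda>a. P a \<and> Q a)"
proof -
  obtain g a where g: "polyfun R n g" "a \<in> coords R n" "g a \<notin> \<mm>" "\<forall>a\<in>coords R n. g a \<notin> \<mm> \<longrightarrow> P a"
    using P unfolding generic_def by blast
  obtain h b where h: "polyfun R n h" "b \<in> coords R n" "h b \<notin> \<mm>" "\<forall>a\<in>coords R n. h a \<notin> \<mm> \<longrightarrow> Q a"
    using Q unfolding generic_def by blast
  define d where "d i = b i \<ominus> a i" for i
  have d: "d \<in> coords R n" using g h by (auto simp: d_def coords_def)
  define L where "L t = (\<lambda>i. a i \<oplus> t \<otimes> d i)" for t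
  have L: "L t \<in> coords R n" if "t \<in> carrier R" for t using g(2) d that by (auto simp: L_def coords_def)
  \<comment> \<open>Points are functions on all natural numbers with arbitrary values from
    \<open>n\<close> on, so the ends \<open>L \<zero>\<close> and \<open>L \<one>\<close> of the
    line agree with \<open>a\<close> and \<open>b\<close> only below \<open>n\<close>.\<close>
  have ext: "F x = F y" if "polyfun R n F" "\<And>i. i < n \<Longrightarrow> x i = y i" "x \<in> coords R n" for F x y
  proof -
    have "y \<in> coords R n" using that(2,3) by (auto simp: coords_def)
    moreover have "mono_eval R n e x = mono_eval R n e y" for e
      unfolding mono_eval_def using that(2,3) by (intro finprod_cong') (auto simp: coords_def)
    ultimately show ?thesis using that(1,3) unfolding polyfun_def poly_eval_def by auto
  qed
  obtain N where N: "unipoly R N (\<lambda>t. g (L t))" using polyfun_line[OF g(1,2) d] unfolding L_def by blast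
  obtain M where M: "unipoly R M (\<lambda>t. h (L t))" using polyfun_line[OF h(1) g(2) d] unfolding L_def by blast
  have g0: "g (L \<zero>) \<notin> \<mm>"
  proof -
    have "g a = g (L \<zero>)"
      by (rule ext[OF g(1) _ g(2)]) (use g(2) d in \<open>auto simp: L_def coords_def\<close>)
    then show ?thesis using g(3) by simp
  qed
  have h1: "h (L \<one>) \<notin> \<mm>"
  proof -
    have "b i = L \<one> i" if "i < n" for i
    proof -
      have "a i \<in> carrier R" "b i \<in> carrier R" using g(2) h(2) that by (auto simp: coords_def)
      then show ?thesis unfolding L_def d_def by algebra
    qed
    then have "h b = h (L \<one>)" by (rule ext[OF h(1) _ h(2)])
    then show ?thesis using h(3) by simp
  qed
  obtain T where T: "T \<subseteq> carrier R" "finite T" "card T = Suc (N + M)"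
    "\<And>s t. \<lbrakk>s \<in> T; t \<in> T; s \<noteq> t\<rbrakk> \<Longrightarrow> s \<ominus> t \<notin> \<mm>"
    using residue_transversal[OF inf] by blast
  define G where "G = {t\<in>T. g (L t) \<in> \<mm>}"
  define H where "H = {t\<in>T. h (L t) \<in> \<mm>}"
  have "card G \<le> N"
  proof (rule ccontr)
    assume "\<not> card G \<le> N"
    have "g (L \<zero>) \<in> \<mm>"
    proof (rule unipoly_roots[OF N, of G])
      show "N < card G" using \<open>\<not> card G \<le> N\<close> by simp
    qed (use T in \<open>auto simp: G_def\<close>)
    then show False using g0 by simp
  qed
  moreover have "card H \<le> M"
  proof (rule ccontr)
    assume "\<not> card H \<le> M"
    have "h (L \<one>) \<in> \<mm>"
    proof (rule unipoly_roots[OF M, of H])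
      show "M < card H" using \<open>\<not> card H \<le> M\<close> by simp
    qed (use T in \<open>auto simp: H_def\<close>)
    then show False using h1 by simp
  qed
  ultimately have "card (G \<union> H) < card T" using card_Un_le[of G H] T(3) by linarith
  moreover have "G \<union> H \<subseteq> T" unfolding G_def H_def by blast
  ultimately obtain t where t: "t \<in> T" "t \<notin> G" "t \<notin> H" by (metis Un_iff less_irrefl subsetI subset_antisym)
  have tc: "t \<in> carrier R" using t T by blast
  have "\<exists>x\<in>coords R n. g x \<otimes> h x \<notin> \<mm>"
    using t L[OF tc] mm_prime[of "g (L t)" "h (L t)"] polyfun_closed g(1) h(1) unfolding G_def H_def by blast
  moreover have "P x \<and> Q x" if "x \<in> coords R n" "g x \<otimes> h x \<notin> \<mm>" for x
  proof -
    have "g x \<in> carrier R" "h x \<in> carrier R" using that polyfun_closed g(1) h(1) by auto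
    then have "g x \<notin> \<mm>" "h x \<notin> \<mm>" using that(2) mm_ideal ideal_lmult_mem ideal_rmult_mem by blast+
    then show ?thesis using that g(4) h(4) by blast
  qed
  ultimately show ?thesis using polyfun_mult[OF g(1) h(1)] unfolding generic_def by blast
qed

section \<open>Openness of injectivity in a linear family of maps\<close>

lemma lincomb_bool:
  fixes c f :: "bool \<Rightarrow> 'a"
  assumes "c True \<in> carrier R" "c False \<in> carrier R" "f True \<in> carrier R" "f False \<in> carrier R"
  shows "lincomb R UNIV c f = c True \<otimes> f True \<oplus> c False \<otimes> f False"
proof -
  have cl: "c j \<in> carrier R" "f j \<in> carrier R" for j using assms by (cases j; simp)+
  have "lincomb R (insert True {False}) c f = c True \<otimes> f True \<oplus> lincomb R {False} c f"
    by (rule lincomb_insert) (use cl in auto)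
  also have "lincomb R {False} c f = c False \<otimes> f False \<oplus> lincomb R {} c f"
    by (rule lincomb_insert) (use cl in auto)
  finally show ?thesis using assms by (simp add: UNIV_bool insert_commute)
qed

text \<open>The proof is a fraction-free Gaussian elimination; the product of the pivots takes the place of
  the minor that would classically define the open set.\<close>

lemma generic_full_rank:
  assumes "finite A"
    and "\<And>l j. \<lbrakk>l \<in> L; j \<in> A\<rbrakk> \<Longrightarrow> polyfun R n (F l j)" and "x \<in> coords R n"
    and "\<And>c. \<lbrakk>\<forall>j\<in>A. c j \<in> carrier R; \<forall>l\<in>L. lincomb R A c (\<lambda>j. F l j x) \<in> \<mm>\<rbrakk> \<Longrightarrow> \<forall>j\<in>A. c j \<in> \<mm>"
  shows "\<exists>g. polyfun R n g \<and> g x \<notin> \<mm> \<and> (\<forall>a\<in>coords R n. g a \<notin> \<mm> \<longrightarrow>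
    (\<forall>c. (\<forall>j\<in>A. c j \<in> carrier R) \<longrightarrow> (\<forall>l\<in>L. lincomb R A c (\<lambda>j. F l j a) \<in> \<mm>) \<longrightarrow> (\<forall>j\<in>A. c j \<in> \<mm>)))"
  using assms
proof (induct A arbitrary: F)
  case empty
  have "polyfun R n (\<lambda>a. \<one>)" using polyfun_const by simp
  then show ?case using one_notin_mm by (intro exI[of _ "\<lambda>a. \<one>"]) auto
next
  case (insert s A)
  note x = insert.prems(2)
  have Fc: "F l j a \<in> carrier R" if "l \<in> L" "j \<in> insert s A" "a \<in> coords R n" for l j a
    using polyfun_closed insert.prems(1) that by blast
  have split: "lincomb R (insert s A) c (\<lambda>j. F l j a) = c s \<otimes> F l s a \<oplus> lincomb R A c (\<lambda>j. F l j a)"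
    if "l \<in> L" "a \<in> coords R n" "\<forall>j\<in>insert s A. c j \<in> carrier R" for l a c
    by (rule lincomb_insert) (use that Fc insert.hyps in auto)
  \<comment> \<open>A pivot exists in column \<open>s\<close>: if all its entries lay in
    \<open>\<mm>\<close> at the point \<open>x\<close>, the unit vector at \<open>s\<close> would be
    in the kernel modulo \<open>\<mm>\<close>.\<close>
  have "\<exists>i\<in>L. F i s x \<notin> \<mm>"
  proof (rule ccontr)
    assume neg: "\<not> (\<exists>i\<in>L. F i s x \<notin> \<mm>)"
    define c where "c j = (if j = s then \<one> else \<zero>)" for j
    have "lincomb R (insert s A) c (\<lambda>j. F l j x) \<in> \<mm>" if "l \<in> L" for l
    proof -
      have "lincomb R (insert s A) c (\<lambda>j. F l j x) = \<one> \<otimes> F l s x"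
        unfolding c_def by (rule lincomb_delta) (use that Fc x insert.hyps in auto)
      then show ?thesis using neg that Fc[OF that _ x] by auto
    qed
    moreover have "\<forall>j\<in>insert s A. c j \<in> carrier R" by (simp add: c_def)
    ultimately have "c s \<in> \<mm>" using insert.prems(3)[of c] by blast
    then show False using one_notin_mm by (simp add: c_def)
  qed
  then obtain i where i: "i \<in> L" "F i s x \<notin> \<mm>" by blast
  define p where "p = F i s"
  have p: "polyfun R n p" "p x \<notin> \<mm>" using i insert.prems(1) by (auto simp: p_def)
  have pc: "p a \<in> carrier R" if "a \<in> coords R n" for a using polyfun_closed p that by blast
  \<comment> \<open>Cross-multiplication: row \<open>l\<close> times the pivot minus
    \<open>F l s\<close> times row \<open>i\<close>. This cancels column \<open>s\<close> without a
    division, so the new entries are again polynomial functions.\<close>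
  define F' where "F' l j = (\<lambda>a. p a \<otimes> F l j a \<oplus> (\<ominus> \<one>) \<otimes> (F l s a \<otimes> F i j a))" for l j
  have F'p: "polyfun R n (F' l j)" if "l \<in> L" "j \<in> A" for l j
    unfolding F'_def using p insert.prems(1) i that by (intro polyfun_add polyfun_mult polyfun_const) auto
  have F'l: "lincomb R A c (\<lambda>j. F' l j a)
      = p a \<otimes> lincomb R A c (\<lambda>j. F l j a) \<ominus> F l s a \<otimes> lincomb R A c (\<lambda>j. F i j a)"
    if l: "l \<in> L" and a: "a \<in> coords R n" and c: "\<forall>j\<in>A. c j \<in> carrier R" for l a c
  proof -
    \<comment> \<open>The two-term entry is written as a combination indexed by \<open>bool\<close>,
      so that \<open>lincomb_swap\<close> distributes the sum over \<open>A\<close>.\<close>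
    have "lincomb R A c (\<lambda>j. F' l j a)
        = lincomb R A c (\<lambda>j. lincomb R UNIV (\<lambda>b. if b then F l j a else F i j a) (\<lambda>b. if b then p a else \<ominus> F l s a))"
    proof (rule lincomb_cong)
      fix j assume j: "j \<in> A"
      have cc: "F l j a \<in> carrier R" "F i j a \<in> carrier R" "F l s a \<in> carrier R" "p a \<in> carrier R"
        using Fc l a i j pc by auto
      have "F' l j a = F l j a \<otimes> p a \<oplus> F i j a \<otimes> (\<ominus> F l s a)" unfolding F'_def using cc by algebra
      then show "F' l j a = lincomb R UNIV (\<lambda>b. if b then F l j a else F i j a) (\<lambda>b. if b then p a else \<ominus> F l s a)"
        using cc by (subst lincomb_bool) auto
    qed (use F'p polyfun_closed l a c in blast)+
    also have "\<dots> = lincomb R UNIV (\<lambda>b. lincomb R A c (\<lambda>j. if b then F l j a else F i j a)) (\<lambda>b. if b then p a else \<ominus> F l s a)"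
      by (rule lincomb_swap) (use insert.hyps Fc l i a c pc in auto)
    also have "\<dots> = lincomb R A c (\<lambda>j. F l j a) \<otimes> p a \<oplus> lincomb R A c (\<lambda>j. F i j a) \<otimes> (\<ominus> F l s a)"
      by (subst lincomb_bool) (use Fc l i a c pc in \<open>auto intro!: lincomb_closed\<close>)
    also have "\<dots> = p a \<otimes> lincomb R A c (\<lambda>j. F l j a) \<ominus> F l s a \<otimes> lincomb R A c (\<lambda>j. F i j a)"
    proof -
      have "lincomb R A c (\<lambda>j. F l j a) \<in> carrier R" "lincomb R A c (\<lambda>j. F i j a) \<in> carrier R"
        "p a \<in> carrier R" "F l s a \<in> carrier R"
        using Fc l i a c pc by (auto intro!: lincomb_closed)
      moreover have "u \<otimes> p \<oplus> v \<otimes> (\<ominus> w) = p \<otimes> u \<ominus> w \<otimes> v"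
        if "u \<in> carrier R" "v \<in> carrier R" "p \<in> carrier R" "w \<in> carrier R" for u v p w
        using that by algebra
      ultimately show ?thesis by simp
    qed
    finally show ?thesis .
  qed
  have lc: "lincomb R A c (\<lambda>j. F l j a) \<in> carrier R"
    if "l \<in> L" "a \<in> coords R n" "\<forall>j\<in>A. c j \<in> carrier R" for l a c
    using Fc that by (intro lincomb_closed) auto
  have "\<exists>g. polyfun R n g \<and> g x \<notin> \<mm> \<and> (\<forall>a\<in>coords R n. g a \<notin> \<mm> \<longrightarrow>
    (\<forall>c. (\<forall>j\<in>A. c j \<in> carrier R) \<longrightarrow> (\<forall>l\<in>L. lincomb R A c (\<lambda>j. F' l j a) \<in> \<mm>) \<longrightarrow> (\<forall>j\<in>A. c j \<in> \<mm>)))"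
  proof (rule insert.hyps(3)[OF F'p x])
    fix c assume c: "\<forall>j\<in>A. c j \<in> carrier R" "\<forall>l\<in>L. lincomb R A c (\<lambda>j. F' l j x) \<in> \<mm>"
    obtain q where q: "q \<in> carrier R" "q \<otimes> p x = \<one>" using unit_inverse[OF pc[OF x] p(2)] by blast
    \<comment> \<open>A kernel vector of the reduced matrix at \<open>x\<close> is extended to one
      of the full matrix. The coordinate at \<open>s\<close> solves row \<open>i\<close>, with
      \<open>q\<close> the inverse of the pivot at \<open>x\<close>.\<close>
    define d where "d j = (if j = s then \<ominus> (q \<otimes> lincomb R A c (\<lambda>j. F i j x)) else c j)" for j
    have dA: "lincomb R A d (\<lambda>j. F l j x) = lincomb R A c (\<lambda>j. F l j x)" if "l \<in> L" for l
      by (rule lincomb_cong) (use insert.hyps that c Fc x lc[OF i(1) x c(1)] q in \<open>auto simp: d_def\<close>)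
    have dc: "\<forall>j\<in>insert s A. d j \<in> carrier R" using c lc[OF i(1) x c(1)] q by (auto simp: d_def)
    have "lincomb R (insert s A) d (\<lambda>j. F l j x) \<in> \<mm>" if l: "l \<in> L" for l
    proof -
      define u where "u = lincomb R A c (\<lambda>j. F l j x)"
      define v where "v = lincomb R A c (\<lambda>j. F i j x)"
      define w where "w = F l s x"
      have cc: "u \<in> carrier R" "v \<in> carrier R" "w \<in> carrier R" "p x \<in> carrier R"
        unfolding u_def v_def w_def using lc l i x c Fc pc by auto
      have "p x \<otimes> u \<ominus> w \<otimes> v \<in> \<mm>"
        using c(2) l F'l[OF l x c(1)] unfolding u_def v_def w_def by auto
      then have "q \<otimes> (p x \<otimes> u \<ominus> w \<otimes> v) \<in> \<mm>" using q mm_ideal ideal_lmult_mem by blast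
      moreover have "q \<otimes> (p x \<otimes> u \<ominus> w \<otimes> v) = (q \<otimes> p x) \<otimes> u \<ominus> q \<otimes> (w \<otimes> v)"
        using cc q(1) by algebra
      moreover have "\<dots> = \<one> \<otimes> u \<ominus> q \<otimes> (w \<otimes> v)" using q(2) by simp
      moreover have "\<dots> = (\<ominus> (q \<otimes> v)) \<otimes> w \<oplus> u" using cc q(1) by algebra
      ultimately have "(\<ominus> (q \<otimes> v)) \<otimes> w \<oplus> u \<in> \<mm>" by metis
      moreover have "lincomb R (insert s A) d (\<lambda>j. F l j x) = (\<ominus> (q \<otimes> v)) \<otimes> w \<oplus> u"
      proof -
        have "d s = \<ominus> (q \<otimes> v)" by (simp add: d_def v_def)
        then show ?thesis using split[OF l x dc] dA[OF l] unfolding u_def w_def by simp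
      qed
      ultimately show ?thesis by simp
    qed
    then have "\<forall>j\<in>insert s A. d j \<in> \<mm>" using insert.prems(3)[OF dc] by blast
    then show "\<forall>j\<in>A. c j \<in> \<mm>" using insert.hyps(2) unfolding d_def by (metis insertI2)
  qed
  then obtain g where g: "polyfun R n g" "g x \<notin> \<mm>" "\<And>a c. \<lbrakk>a \<in> coords R n; g a \<notin> \<mm>; \<forall>j\<in>A. c j \<in> carrier R;
    \<forall>l\<in>L. lincomb R A c (\<lambda>j. F' l j a) \<in> \<mm>\<rbrakk> \<Longrightarrow> \<forall>j\<in>A. c j \<in> \<mm>" by blast
  \<comment> \<open>The product enforces two conditions at once: row \<open>i\<close> can be solved
    for the coordinate at \<open>s\<close>, and the reduced matrix is injective.\<close>
  have "p x \<otimes> g x \<notin> \<mm>"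
    using mm_prime[OF pc[OF x] polyfun_closed[OF g(1) x]] p(2) g(2) by blast
  moreover have "\<forall>j\<in>insert s A. c j \<in> \<mm>" if a: "a \<in> coords R n" and pg: "p a \<otimes> g a \<notin> \<mm>"
    and c: "\<forall>j\<in>insert s A. c j \<in> carrier R" and cl: "\<forall>l\<in>L. lincomb R (insert s A) c (\<lambda>j. F l j a) \<in> \<mm>" for a c
  proof -
    have ga: "g a \<in> carrier R" using polyfun_closed g a by blast
    have pa: "p a \<notin> \<mm>" using pg ga ideal_rmult_mem[OF mm_ideal] by blast
    have gm: "g a \<notin> \<mm>" using pg pc[OF a] ideal_lmult_mem[OF mm_ideal] by blast
    have cA: "\<forall>j\<in>A. c j \<in> carrier R" and cs: "c s \<in> carrier R" using c by auto
    define v where "v = lincomb R A c (\<lambda>j. F i j a)"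
    have v: "v \<in> carrier R" "c s \<otimes> p a \<oplus> v \<in> \<mm>"
      using lc[OF i(1) a cA] cl i(1) split[OF i(1) a c] unfolding v_def p_def by auto
    have "lincomb R A c (\<lambda>j. F' l j a) \<in> \<mm>" if l: "l \<in> L" for l
    proof -
      define u where "u = lincomb R A c (\<lambda>j. F l j a)"
      define w where "w = F l s a"
      have cc: "u \<in> carrier R" "w \<in> carrier R" "p a \<in> carrier R"
        unfolding u_def w_def using lc[OF l a cA] Fc[OF l _ a] pc[OF a] by auto
      have "c s \<otimes> w \<oplus> u \<in> \<mm>" using cl l split[OF l a c] unfolding u_def w_def by auto
      then have "p a \<otimes> (c s \<otimes> w \<oplus> u) \<ominus> w \<otimes> (c s \<otimes> p a \<oplus> v) \<in> \<mm>"
        using v cc mm_ideal by (intro ideal_diff_mem ideal_lmult_mem)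
      moreover have "p a \<otimes> (c s \<otimes> w \<oplus> u) \<ominus> w \<otimes> (c s \<otimes> p a \<oplus> v) = p a \<otimes> u \<ominus> w \<otimes> v"
        using cc v(1) cs by algebra
      ultimately show ?thesis using F'l[OF l a cA] unfolding u_def v_def w_def by simp
    qed
    then have A: "\<forall>j\<in>A. c j \<in> \<mm>" using g(3)[OF a gm cA] by blast
    have "v \<in> \<mm>" unfolding v_def
      by (rule lincomb_mem[OF mm_ideal insert.hyps(1)])
        (use A cA Fc[OF i(1) _ a] mm_ideal ideal_rmult_mem in auto)
    then have "c s \<otimes> p a \<in> \<mm>" using ideal_cancel_right[OF mm_ideal v(2)] cs pc[OF a] by simp
    then have "c s \<in> \<mm>" using mm_prime[OF pc[OF a] cs] pa m_comm[OF cs pc[OF a]] by simp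
    then show ?thesis using A by blast
  qed
  ultimately show ?case using polyfun_mult[OF p(1) g(1)] by (intro exI[of _ "\<lambda>a. p a \<otimes> g a"]) auto
qed

text \<open>Multiplication by an element of \<open>\<mm>\<close> induces a linear map from
  \<open>V\<close> modulo \<open>W\<close> to \<open>\<mm>V\<close> modulo \<open>Z\<close>; the
  three inclusions make both sides vector spaces over the residue field and the map well defined. In
  bases \<open>A\<close> and \<open>B\<close> its matrix entries are linear forms in the coordinates
  of the multiplier. Injectivity at the point \<open>x\<close> is full column rank there, an open
  condition.\<close>

lemma generic_linear:
  assumes V: "ideal V R" and W: "ideal W R" and Z: "ideal Z R"
    and VW: "\<mm> \<cdot> V \<subseteq> W" and VZ: "\<mm> \<cdot> (\<mm> \<cdot> V) \<subseteq> Z" and WZ: "\<mm> \<cdot> W \<subseteq> Z"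
    and ys: "\<And>i. i < n \<Longrightarrow> ys i \<in> \<mm>" and x: "x \<in> coords R n"
    and good: "\<And>v. \<lbrakk>v \<in> V; lin_comb R n x ys \<otimes> v \<in> Z\<rbrakk> \<Longrightarrow> v \<in> W"
  shows "generic R n (\<lambda>a. \<forall>v\<in>V. lin_comb R n a ys \<otimes> v \<in> Z \<longrightarrow> v \<in> W)"
proof -
  obtain A where A: "finite A" "A \<subseteq> V"
    "\<And>v. v \<in> V \<Longrightarrow> \<exists>c. (\<forall>a\<in>A. c a \<in> carrier R) \<and> v \<ominus> lincomb R A c (\<lambda>a. a) \<in> W"
    "\<And>c. \<lbrakk>\<forall>a\<in>A. c a \<in> carrier R; lincomb R A c (\<lambda>a. a) \<in> W\<rbrakk> \<Longrightarrow> \<forall>a\<in>A. c a \<in> \<mm>"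
    using independent_generators[OF V W VW] by metis
  have mV: "ideal (\<mm> \<cdot> V) R" using mm_ideal V ideal_prod_is_ideal by blast
  obtain B where B: "finite B" "B \<subseteq> \<mm> \<cdot> V"
    "\<And>v. v \<in> \<mm> \<cdot> V \<Longrightarrow> \<exists>c. (\<forall>a\<in>B. c a \<in> carrier R) \<and> v \<ominus> lincomb R B c (\<lambda>a. a) \<in> Z"
    "\<And>c. \<lbrakk>\<forall>a\<in>B. c a \<in> carrier R; lincomb R B c (\<lambda>a. a) \<in> Z\<rbrakk> \<Longrightarrow> \<forall>a\<in>B. c a \<in> \<mm>"
    using independent_generators[OF mV Z VZ] by metis
  have Ac: "a \<in> carrier R" if "a \<in> A" for a using that A(2) V ideal_carr by blast
  have Bc: "b \<in> carrier R" if "b \<in> B" for b using that B(2) mV ideal_carr by blast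
  have yc: "ys i \<in> carrier R" if "i < n" for i using ys that mm_carr by blast
  \<comment> \<open>Structure constants: \<open>\<gamma> v i\<close> expands \<open>ys i\<close>
    times the basis vector \<open>v\<close> in the basis \<open>B\<close> modulo \<open>Z\<close>.
    They are the coefficients of the linear forms \<open>F l v\<close>.\<close>
  have "\<exists>c. v \<in> A \<longrightarrow> i < n \<longrightarrow> (\<forall>b\<in>B. c b \<in> carrier R) \<and> ys i \<otimes> v \<ominus> lincomb R B c (\<lambda>b. b) \<in> Z" for v i
  proof (cases "v \<in> A \<and> i < n")
    case True
    then have "ys i \<otimes> v \<in> \<mm> \<cdot> V" using ys A(2) by (intro ideal_prod.prod) auto
    then show ?thesis using B(3) by blast
  qed auto
  then obtain \<gamma> where \<gamma>c: "\<And>v i b. \<lbrakk>v \<in> A; i < n; b \<in> B\<rbrakk> \<Longrightarrow> \<gamma> v i b \<in> carrier R"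
    and \<gamma>: "\<And>v i. \<lbrakk>v \<in> A; i < n\<rbrakk> \<Longrightarrow> ys i \<otimes> v \<ominus> lincomb R B (\<gamma> v i) (\<lambda>b. b) \<in> Z" by metis
  define F where "F l v a = lincomb R {..<n} a (\<lambda>i. \<gamma> v i l)" for l v a
  have Fp: "polyfun R n (F l v)" if "l \<in> B" "v \<in> A" for l v
    unfolding F_def by (rule polyfun_lincomb) (use polyfun_coord \<gamma>c that in auto)
  have Fc: "F l v a \<in> carrier R" if "l \<in> B" "v \<in> A" "a \<in> coords R n" for l v a
    using polyfun_closed Fp that by blast
  have diff: "lincomb R I c f \<ominus> lincomb R I c h \<in> Z"
    if "finite I" "\<And>i. i \<in> I \<Longrightarrow> c i \<in> carrier R" "\<And>i. i \<in> I \<Longrightarrow> f i \<in> carrier R"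
      "\<And>i. i \<in> I \<Longrightarrow> h i \<in> carrier R" "\<And>i. i \<in> I \<Longrightarrow> f i \<ominus> h i \<in> Z"
    for I :: "'c set" and c f h
    using that
  proof (induct I)
    case (insert i I)
    have "lincomb R (insert i I) c f \<ominus> lincomb R (insert i I) c h
      = (c i \<otimes> f i \<oplus> lincomb R I c f) \<ominus> (c i \<otimes> h i \<oplus> lincomb R I c h)"
      by (subst (1 2) lincomb_insert) (use insert in auto)
    also have "\<dots> = c i \<otimes> (f i \<ominus> h i) \<oplus> (lincomb R I c f \<ominus> lincomb R I c h)"
    proof -
      have "c i \<in> carrier R" "f i \<in> carrier R" "h i \<in> carrier R"
        "lincomb R I c f \<in> carrier R" "lincomb R I c h \<in> carrier R" using insert.prems by auto
      then show ?thesis by algebra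
    qed
    also have "\<dots> \<in> Z" using insert Z by (intro ideal_add_mem ideal_lmult_mem) auto
    finally show ?case .
  qed (use ideal_zero_mem[OF Z] in \<open>simp add: a_minus_def\<close>)
  \<comment> \<open>Membership in \<open>Z\<close> becomes a linear system over the residue field:
    the product is congruent modulo \<open>Z\<close> to the combination of \<open>B\<close> with
    coefficients \<open>G\<close>, and by independence that combination lies in \<open>Z\<close>
    exactly when all of them lie in \<open>\<mm>\<close>.\<close>
  have key: "lin_comb R n a ys \<otimes> lincomb R A c (\<lambda>v. v) \<in> Z \<longleftrightarrow> (\<forall>l\<in>B. lincomb R A c (\<lambda>v. F l v a) \<in> \<mm>)"
    if a: "a \<in> coords R n" and c: "\<forall>v\<in>A. c v \<in> carrier R" for a c
  proof -
    have ac: "a i \<in> carrier R" if "i < n" for i using a that by (simp add: coords_def)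
    define t where "t = lin_comb R n a ys"
    have t: "t \<in> carrier R" unfolding t_def lin_comb_lincomb using ac yc by (intro lincomb_closed) auto
    have tv: "t \<otimes> v \<ominus> lincomb R B (\<lambda>l. F l v a) (\<lambda>b. b) \<in> Z" if v: "v \<in> A" for v
    proof -
      have "t \<otimes> v = lincomb R {..<n} a (\<lambda>i. ys i \<otimes> v)"
      proof -
        have "lincomb R {..<n} a (\<lambda>i. ys i \<otimes> v) = lincomb R {..<n} (\<lambda>i. v \<otimes> a i) ys"
          unfolding lincomb_def using ac yc Ac[OF v] by (intro finsum_cong') (auto simp: m_ac)
        also have "\<dots> = v \<otimes> t" unfolding t_def lin_comb_lincomb
          by (rule lincomb_smult) (use ac yc Ac[OF v] in auto)
        finally show ?thesis using t Ac[OF v] m_comm by simp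
      qed
      moreover have "lincomb R {..<n} a (\<lambda>i. lincomb R B (\<gamma> v i) (\<lambda>b. b)) = lincomb R B (\<lambda>l. F l v a) (\<lambda>b. b)"
        unfolding F_def by (rule lincomb_swap) (use B(1) ac \<gamma>c v Bc in auto)
      moreover have "lincomb R {..<n} a (\<lambda>i. ys i \<otimes> v) \<ominus> lincomb R {..<n} a (\<lambda>i. lincomb R B (\<gamma> v i) (\<lambda>b. b)) \<in> Z"
        by (rule diff) (use ac yc Ac[OF v] Bc \<gamma>c v \<gamma> in auto)
      ultimately show ?thesis by simp
    qed
    define u where "u = lincomb R A c (\<lambda>v. v)"
    have u: "u \<in> carrier R" unfolding u_def using c Ac by (intro lincomb_closed) auto
    define G where "G l = lincomb R A c (\<lambda>v. F l v a)" for l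
    have G: "G l \<in> carrier R" if "l \<in> B" for l unfolding G_def using c Fc that a by (intro lincomb_closed) auto
    define z where "z = lincomb R B G (\<lambda>b. b)"
    have zc: "z \<in> carrier R" unfolding z_def using G Bc by (intro lincomb_closed) auto
    have "t \<otimes> u \<ominus> z \<in> Z"
    proof -
      have "t \<otimes> u = lincomb R A c (\<lambda>v. t \<otimes> v)"
      proof -
        have "t \<otimes> u = lincomb R A (\<lambda>v. t \<otimes> c v) (\<lambda>v. v)"
          unfolding u_def by (rule lincomb_smult[symmetric]) (use t c Ac in auto)
        also have "\<dots> = lincomb R A c (\<lambda>v. t \<otimes> v)"
          unfolding lincomb_def using t c Ac by (intro finsum_cong') (auto simp: m_ac)
        finally show ?thesis .
      qed
      moreover have "z = lincomb R A c (\<lambda>v. lincomb R B (\<lambda>l. F l v a) (\<lambda>b. b))"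
        unfolding z_def G_def by (rule lincomb_swap[symmetric]) (use A(1) B(1) c Fc a Bc in auto)
      moreover have "lincomb R A c (\<lambda>v. t \<otimes> v) \<ominus> lincomb R A c (\<lambda>v. lincomb R B (\<lambda>l. F l v a) (\<lambda>b. b)) \<in> Z"
        by (rule diff) (use A(1) c t Ac Fc a Bc tv in auto)
      ultimately show ?thesis by simp
    qed
    moreover have "t \<otimes> u = (t \<otimes> u \<ominus> z) \<oplus> z" using t u zc by algebra
    moreover have "z = \<ominus> (t \<otimes> u \<ominus> z) \<oplus> t \<otimes> u" using t u zc by algebra
    ultimately have "t \<otimes> u \<in> Z \<longleftrightarrow> z \<in> Z" using Z ideal_add_mem ideal_neg_mem by metis
    also have "\<dots> \<longleftrightarrow> (\<forall>l\<in>B. G l \<in> \<mm>)"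
    proof
      assume "z \<in> Z" then show "\<forall>l\<in>B. G l \<in> \<mm>" using B(4)[of G] G unfolding z_def by blast
    next
      assume "\<forall>l\<in>B. G l \<in> \<mm>"
      then show "z \<in> Z" unfolding z_def using VZ B(2) G Bc
        by (intro lincomb_mem[OF Z B(1)]) (auto intro: ideal_prod.prod)
    qed
    finally show ?thesis unfolding t_def u_def G_def .
  qed
  have uW: "lincomb R A c (\<lambda>v. v) \<in> W" if "\<forall>v\<in>A. c v \<in> \<mm>" for c
    using that VW A(2) mm_carr Ac by (intro lincomb_mem[OF W A(1)]) (auto intro: ideal_prod.prod)
  have uV: "lincomb R A c (\<lambda>v. v) \<in> V" if "\<forall>v\<in>A. c v \<in> carrier R" for c
    using that A(2) Ac V by (intro lincomb_mem[OF V A(1)]) (auto intro: ideal_lmult_mem)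
  have "\<exists>g. polyfun R n g \<and> g x \<notin> \<mm> \<and> (\<forall>a\<in>coords R n. g a \<notin> \<mm> \<longrightarrow>
    (\<forall>c. (\<forall>j\<in>A. c j \<in> carrier R) \<longrightarrow> (\<forall>l\<in>B. lincomb R A c (\<lambda>j. F l j a) \<in> \<mm>) \<longrightarrow> (\<forall>j\<in>A. c j \<in> \<mm>)))"
  proof (rule generic_full_rank[OF A(1) Fp x])
    fix c assume c: "\<forall>j\<in>A. c j \<in> carrier R" "\<forall>l\<in>B. lincomb R A c (\<lambda>j. F l j x) \<in> \<mm>"
    then have "lincomb R A c (\<lambda>v. v) \<in> W" using key[OF x c(1)] good[OF uV[OF c(1)]] by blast
    then show "\<forall>j\<in>A. c j \<in> \<mm>" using A(4) c(1) by blast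
  qed
  then obtain g where g: "polyfun R n g" "g x \<notin> \<mm>" "\<And>a c. \<lbrakk>a \<in> coords R n; g a \<notin> \<mm>; \<forall>j\<in>A. c j \<in> carrier R;
    \<forall>l\<in>B. lincomb R A c (\<lambda>j. F l j a) \<in> \<mm>\<rbrakk> \<Longrightarrow> \<forall>j\<in>A. c j \<in> \<mm>" by blast
  have "v \<in> W" if a: "a \<in> coords R n" and ga: "g a \<notin> \<mm>" and v: "v \<in> V" and vZ: "lin_comb R n a ys \<otimes> v \<in> Z" for a v
  proof -
    obtain c where c: "\<forall>a\<in>A. c a \<in> carrier R" "v \<ominus> lincomb R A c (\<lambda>a. a) \<in> W" using A(3)[OF v] by blast
    define u where "u = lincomb R A c (\<lambda>v. v)"
    define t where "t = lin_comb R n a ys"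
    have t: "t \<in> \<mm>" unfolding t_def lin_comb_lincomb using a yc ys mm_ideal
      by (intro lincomb_mem) (auto simp: coords_def intro: ideal_lmult_mem)
    have cc: "v \<in> carrier R" "u \<in> carrier R" "t \<in> carrier R"
      using v V ideal_carr uV[OF c(1)] mm_carr[OF t] unfolding u_def by blast+
    \<comment> \<open>Replacing \<open>v\<close> by its expansion \<open>u\<close> changes the
      product only by an element of \<open>\<mm>W \<subseteq> Z\<close>.\<close>
    have "t \<otimes> (v \<ominus> u) \<in> Z" using c(2) t WZ ideal_prod.prod[of t \<mm> _ W R] unfolding u_def by blast
    then have "t \<otimes> v \<ominus> t \<otimes> (v \<ominus> u) \<in> Z" using vZ Z ideal_diff_mem unfolding t_def by blast
    moreover have "t \<otimes> v \<ominus> t \<otimes> (v \<ominus> u) = t \<otimes> u" using cc by algebra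
    ultimately have "t \<otimes> u \<in> Z" by simp
    then have "\<forall>j\<in>A. c j \<in> \<mm>" using key[OF a c(1)] g(3)[OF a ga c(1)] unfolding t_def u_def by blast
    then have "u \<in> W" using uW unfolding u_def by blast
    moreover have "v = (v \<ominus> u) \<oplus> u" using cc by algebra
    ultimately show ?thesis using c(2) W ideal_add_mem unfolding u_def by metis
  qed
  then show ?thesis using g(1,2) x unfolding generic_def by blast
qed

end

section \<open>Hilbert's basis theorem\<close>

text \<open>Subrings are subsets of one ambient ring and use its operations. Finitely generated
  algebras can then be built by adjoining elements of the ambient ring, whatever relations these
  satisfy.\<close>

definition subideal :: "('a, 'b) ring_scheme \<Rightarrow> 'a set \<Rightarrow> 'a set \<Rightarrow> bool" where
  "subideal R A I \<longleftrightarrow> I \<subseteq> A \<and> \<zero>\<^bsub>R\<^esub> \<in> I \<and> (\<forall>x\<in>I. \<forall>y\<in>I. x \<oplus>\<^bsub>R\<^esub> y \<in> I) \<and> (\<forall>a\<in>A. \<forall>x\<in>I. a \<otimes>\<^bsub>R\<^esub> x \<in> I)"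

text \<open>Finite generation is expressed by a universal property instead of a generated ideal. In
  applications it suffices to exhibit a suitable ideal \<open>J\<close> that contains the
  generators.\<close>

definition noeth_subring :: "('a, 'b) ring_scheme \<Rightarrow> 'a set \<Rightarrow> bool" where
  "noeth_subring R A \<longleftrightarrow> subring A R \<and> (\<forall>I. subideal R A I \<longrightarrow>
     (\<exists>G. finite G \<and> G \<subseteq> I \<and> (\<forall>J. subideal R A J \<longrightarrow> G \<subseteq> J \<longrightarrow> I \<subseteq> J)))"

text \<open>Sums of terms \<open>a_k z^k\<close> with \<open>k < d\<close> and coefficients in
  \<open>A\<close>. Since \<open>z\<close> may satisfy algebraic relations, one element can have
  several such expressions.\<close>

primrec polys_below :: "('a, 'b) ring_scheme \<Rightarrow> 'a set \<Rightarrow> 'a \<Rightarrow> nat \<Rightarrow> 'a set" where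
  "polys_below R A z 0 = {\<zero>\<^bsub>R\<^esub>}"
| "polys_below R A z (Suc d) = {f \<oplus>\<^bsub>R\<^esub> a \<otimes>\<^bsub>R\<^esub> z [^]\<^bsub>R\<^esub> d | f a. f \<in> polys_below R A z d \<and> a \<in> A}"

context cring
begin

lemma subideal_neg:
  assumes "subring A R" "subideal R A I" "x \<in> I" shows "\<ominus> x \<in> I"
proof -
  have "(\<ominus> \<one>) \<otimes> x \<in> I" using assms subringE(3,5) unfolding subideal_def by metis
  moreover have "x \<in> carrier R" using assms subringE(1)[OF assms(1)] unfolding subideal_def by blast
  ultimately show ?thesis by (simp add: l_minus)
qed

lemma subideal_diff:
  assumes "subring A R" "subideal R A I" "x \<in> I" "y \<in> I" shows "x \<ominus> y \<in> I"
  using subideal_neg[OF assms(1,2,4)] assms(2,3) unfolding subideal_def a_minus_def by blast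

lemma subideal_Int: "\<lbrakk>subideal R A I; subideal R A J\<rbrakk> \<Longrightarrow> subideal R A (I \<inter> J)"
  unfolding subideal_def by blast

lemma subideal_iff_ideal: "subideal R (carrier R) I \<longleftrightarrow> ideal I R"
proof
  assume "subideal R (carrier R) I" then show "ideal I R"
    unfolding subideal_def by (intro cidealI) auto
next
  assume I: "ideal I R" show "subideal R (carrier R) I"
    unfolding subideal_def using ideal_sub[OF I] ideal_mem[OF I] by simp
qed

lemma noeth_subring_carrier:
  assumes "noeth_subring R (carrier R)" shows "noetherian_ring R"
proof (rule noetherian_ringI)
  fix I assume I: "ideal I R"
  then obtain G where G: "finite G" "G \<subseteq> I" "\<forall>J. ideal J R \<longrightarrow> G \<subseteq> J \<longrightarrow> I \<subseteq> J"
    using assms unfolding noeth_subring_def subideal_iff_ideal by blast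
  have Gc: "G \<subseteq> carrier R" using G(2) ideal_sub[OF I] by blast
  have "I = Idl G"
    using genideal_minimal[OF I G(2)] G(3) genideal_ideal[OF Gc] genideal_self[OF Gc] by blast
  then show "\<exists>A\<subseteq>carrier R. finite A \<and> I = Idl A" using Gc G(1) by blast
qed

lemma subideal_chain_stable:
  assumes A: "noeth_subring R A" and L: "\<And>d. subideal R A (L d)" and inc: "\<And>d. L d \<subseteq> L (Suc d)"
  shows "\<exists>N. \<forall>d\<ge>N. L d = L N"
proof -
  have mono: "L d \<subseteq> L e" if "d \<le> e" for d e using lift_Suc_mono_le[of L, OF inc that] .
  have U: "subideal R A (\<Union>d. L d)" unfolding subideal_def
  proof (intro conjI ballI)
    fix x y assume "x \<in> (\<Union>d. L d)" "y \<in> (\<Union>d. L d)"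
    then obtain d e where "x \<in> L d" "y \<in> L e" by blast
    then have "x \<in> L (max d e)" "y \<in> L (max d e)" using mono[of d "max d e"] mono[of e "max d e"] by auto
    then have "x \<oplus> y \<in> L (max d e)" using L unfolding subideal_def by blast
    then show "x \<oplus> y \<in> (\<Union>d. L d)" by blast
  next
    fix a x assume "a \<in> A" "x \<in> (\<Union>d. L d)"
    then obtain d where "x \<in> L d" by blast
    then have "a \<otimes> x \<in> L d" using L[of d] \<open>a \<in> A\<close> unfolding subideal_def by simp
    then show "a \<otimes> x \<in> (\<Union>d. L d)" by blast
  next
    show "(\<Union>d. L d) \<subseteq> A" using L unfolding subideal_def by blast
    show "\<zero> \<in> (\<Union>d. L d)" using L unfolding subideal_def by blast
  qed
  obtain G where G: "finite G" "G \<subseteq> (\<Union>d. L d)" "\<forall>J. subideal R A J \<longrightarrow> G \<subseteq> J \<longrightarrow> (\<Union>d. L d) \<subseteq> J"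
    using A U unfolding noeth_subring_def by blast
  have "\<exists>N. G \<subseteq> L N" using G(1,2)
  proof (induct G)
    case (insert x G)
    then obtain N d where "G \<subseteq> L N" "x \<in> L d" by auto
    then have "insert x G \<subseteq> L (max N d)" using mono[of d "max N d"] mono[of N "max N d"] by auto
    then show ?case by blast
  qed simp
  then obtain N where "G \<subseteq> L N" by blast
  then have "(\<Union>d. L d) \<subseteq> L N" using G(3) L by blast
  then have "\<forall>d\<ge>N. L d = L N" using mono by blast
  then show ?thesis by blast
qed

lemma noeth_subring_image:
  assumes S: "noetherian_ring S" and f: "f \<in> ring_hom S R"
  shows "noeth_subring R (f ` carrier S)"
proof -
  interpret S: noetherian_ring S by fact
  interpret f: ring_hom_ring S R f by (rule ring_hom_ringI2[OF S.ring_axioms ring_axioms f])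
  have sub: "subring (f ` carrier S) R" using f.img_is_subring[OF S.carrier_is_subring] .
  have "\<exists>G. finite G \<and> G \<subseteq> I \<and> (\<forall>J. subideal R (f ` carrier S) J \<longrightarrow> G \<subseteq> J \<longrightarrow> I \<subseteq> J)"
    if I: "subideal R (f ` carrier S) I" for I
  proof -
    have pre: "ideal {x \<in> carrier S. f x \<in> J} S" if J: "subideal R (f ` carrier S) J" for J
    proof (rule S.idealI')
      fix a x assume a: "a \<in> {x \<in> carrier S. f x \<in> J}" and x: "x \<in> carrier S"
      have "f x \<otimes> f a \<in> J" using J a x unfolding subideal_def by auto
      moreover have "f a \<otimes> f x = f x \<otimes> f a" using a x by (simp add: m_comm)
      ultimately show "x \<otimes>\<^bsub>S\<^esub> a \<in> {x \<in> carrier S. f x \<in> J}" "a \<otimes>\<^bsub>S\<^esub> x \<in> {x \<in> carrier S. f x \<in> J}"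
        using a x by auto
    qed (use J in \<open>auto simp: subideal_def\<close>)
    obtain G where G: "G \<subseteq> carrier S" "finite G" "{x \<in> carrier S. f x \<in> I} = Idl\<^bsub>S\<^esub> G"
      using S.finetely_gen[OF pre[OF I]] by blast
    have "I \<subseteq> J" if J: "subideal R (f ` carrier S) J" and "f ` G \<subseteq> J" for J
    proof
      fix y assume y: "y \<in> I"
      then obtain x where x: "x \<in> carrier S" "y = f x" using I unfolding subideal_def by blast
      have "G \<subseteq> {x \<in> carrier S. f x \<in> J}" using G(1) that(2) by blast
      then have "Idl\<^bsub>S\<^esub> G \<subseteq> {x \<in> carrier S. f x \<in> J}" by (rule S.genideal_minimal[OF pre[OF J]])
      then show "y \<in> J" using G(3) x y by blast
    qed
    moreover have "f ` G \<subseteq> I" using G(3) S.genideal_self[OF G(1)] by blast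
    ultimately show ?thesis using G(2) by (intro exI[of _ "f ` G"]) blast
  qed
  then show ?thesis using sub unfolding noeth_subring_def by blast
qed

section \<open>Adjoining one element to a subring\<close>

context
  fixes A z assumes A: "subring A R" and z: "z \<in> carrier R"
begin

abbreviation Pol where "Pol \<equiv> polys_below R A z"

lemma subring_carr: "a \<in> A \<Longrightarrow> a \<in> carrier R"
  using subringE(1)[OF A] by blast

lemma polys_carr: "f \<in> Pol d \<Longrightarrow> f \<in> carrier R"
  by (induct d arbitrary: f) (use z subring_carr in auto)

lemma polys_zero: "\<zero> \<in> Pol d"
proof (induct d)
  case (Suc d)
  have "\<zero> = \<zero> \<oplus> \<zero> \<otimes> z [^] d" using z by simp
  then show ?case using Suc subringE(2)[OF A] by auto
qed simp

lemma polys_Suc: "Pol d \<subseteq> Pol (Suc d)"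
proof
  fix f assume f: "f \<in> Pol d"
  then have "f = f \<oplus> \<zero> \<otimes> z [^] d" using z polys_carr by simp
  then show "f \<in> Pol (Suc d)" using f subringE(2)[OF A] by auto
qed

lemma polys_mono: "d \<le> e \<Longrightarrow> Pol d \<subseteq> Pol e"
  using lift_Suc_mono_le[of Pol, OF polys_Suc] .

lemma polys_add: "\<lbrakk>f \<in> Pol d; g \<in> Pol d\<rbrakk> \<Longrightarrow> f \<oplus> g \<in> Pol d"
proof (induct d arbitrary: f g)
  case (Suc d)
  obtain f' a where f: "f' \<in> Pol d" "a \<in> A" "f = f' \<oplus> a \<otimes> z [^] d" using Suc.prems by auto
  obtain g' b where g: "g' \<in> Pol d" "b \<in> A" "g = g' \<oplus> b \<otimes> z [^] d" using Suc.prems by auto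
  have c: "f' \<in> carrier R" "g' \<in> carrier R" "a \<in> carrier R" "b \<in> carrier R" "z [^] d \<in> carrier R"
    using f g polys_carr subring_carr z by auto
  have "f \<oplus> g = (f' \<oplus> g') \<oplus> (a \<oplus> b) \<otimes> z [^] d" unfolding f(3) g(3) using c by algebra
  then show ?case using Suc.hyps[OF f(1) g(1)] subringE(7)[OF A f(2) g(2)] by auto
qed auto

lemma polys_smult: "\<lbrakk>f \<in> Pol d; b \<in> A\<rbrakk> \<Longrightarrow> b \<otimes> f \<in> Pol d"
proof (induct d arbitrary: f)
  case (Suc d)
  obtain f' a where f: "f' \<in> Pol d" "a \<in> A" "f = f' \<oplus> a \<otimes> z [^] d" using Suc.prems by auto
  have c: "f' \<in> carrier R" "a \<in> carrier R" "b \<in> carrier R" "z [^] d \<in> carrier R"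
    using f polys_carr subring_carr z Suc.prems(2) by auto
  have "b \<otimes> f = b \<otimes> f' \<oplus> (b \<otimes> a) \<otimes> z [^] d" unfolding f(3) using c by algebra
  then show ?case using Suc.hyps[OF f(1) Suc.prems(2)] subringE(6)[OF A Suc.prems(2) f(2)] by auto
qed (use subring_carr in auto)

lemma polys_diff: assumes "f \<in> Pol d" "g \<in> Pol d" shows "f \<ominus> g \<in> Pol d"
proof -
  have "f \<oplus> (\<ominus> \<one>) \<otimes> g \<in> Pol d"
    using assms polys_add polys_smult subringE(3)[OF A] subringE(5)[OF A] by blast
  moreover have "f \<oplus> (\<ominus> \<one>) \<otimes> g = f \<ominus> g"
    using assms polys_carr by (simp add: l_minus a_minus_def)
  ultimately show ?thesis by simp
qed

lemma polys_shift: "f \<in> Pol d \<Longrightarrow> f \<otimes> z \<in> Pol (Suc d)"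
proof (induct d arbitrary: f)
  case 0
  then show ?case using polys_zero[of "Suc 0"] z by simp
next
  case (Suc d)
  obtain f' a where f: "f' \<in> Pol d" "a \<in> A" "f = f' \<oplus> a \<otimes> z [^] d" using Suc.prems by auto
  have c: "f' \<in> carrier R" "a \<in> carrier R" using f polys_carr subring_carr by auto
  have "f \<otimes> z = f' \<otimes> z \<oplus> a \<otimes> z [^] (Suc d)" unfolding f(3) using c z by (simp add: l_distr m_assoc)
  moreover have "f' \<otimes> z \<oplus> a \<otimes> z [^] (Suc d) \<in> Pol (Suc (Suc d))"
    using Suc.hyps[OF f(1)] f(2) by (subst polys_below.simps) blast
  ultimately show ?case by simp
qed

lemma polys_shifts: "f \<in> Pol d \<Longrightarrow> f \<otimes> z [^] (k::nat) \<in> Pol (d + k)"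
proof (induct k)
  case (Suc k)
  have "f \<otimes> z [^] Suc k = f \<otimes> z [^] k \<otimes> z" using Suc.prems polys_carr z by (simp add: m_assoc)
  then show ?case using polys_shift[OF Suc.hyps[OF Suc.prems]] by simp
qed (use polys_carr in simp)

lemma polys_mult: "\<lbrakk>f \<in> Pol d; g \<in> Pol e\<rbrakk> \<Longrightarrow> f \<otimes> g \<in> Pol (d + e)"
proof (induct e arbitrary: g)
  case 0
  then show ?case using polys_zero polys_carr by simp
next
  case (Suc e)
  obtain g' b where g: "g' \<in> Pol e" "b \<in> A" "g = g' \<oplus> b \<otimes> z [^] e" using Suc.prems by auto
  have c: "f \<in> carrier R" "g' \<in> carrier R" "b \<in> carrier R" "z [^] e \<in> carrier R"
    using g polys_carr subring_carr z Suc.prems(1) by auto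
  have "f \<otimes> g = f \<otimes> g' \<oplus> (b \<otimes> f) \<otimes> z [^] e" unfolding g(3) using c by algebra
  moreover have "f \<otimes> g' \<in> Pol (d + e)" "(b \<otimes> f) \<otimes> z [^] e \<in> Pol (d + e)"
    using Suc.hyps[OF Suc.prems(1) g(1)] polys_shifts[OF polys_smult[OF Suc.prems(1) g(2)]] by auto
  ultimately have "f \<otimes> g \<in> Pol (d + e)" using polys_add by simp
  then show ?case using polys_Suc[of "d + e"] by auto
qed

lemma adjoin_A: "A \<subseteq> Pol (Suc 0)"
proof
  fix a assume "a \<in> A"
  then have "a = \<zero> \<oplus> a \<otimes> z [^] (0::nat)" using z subring_carr by simp
  then show "a \<in> Pol (Suc 0)" using \<open>a \<in> A\<close> by auto
qed

lemma adjoin_z: "z \<in> Pol (Suc (Suc 0))"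
  using polys_shift[of \<one> "Suc 0"] adjoin_A subringE(3)[OF A] z by auto

lemma adjoin_subring: "subring (\<Union>d. Pol d) R"
proof (rule subringI)
  fix x y assume "x \<in> (\<Union>d. Pol d)" "y \<in> (\<Union>d. Pol d)"
  then obtain d e where d: "x \<in> Pol d" "y \<in> Pol e" by blast
  then show "x \<otimes> y \<in> (\<Union>d. Pol d)" using polys_mult by blast
  have "x \<in> Pol (max d e)" "y \<in> Pol (max d e)" using d polys_mono[of d "max d e"] polys_mono[of e "max d e"] by auto
  then show "x \<oplus> y \<in> (\<Union>d. Pol d)" using polys_add by blast
next
  fix x assume "x \<in> (\<Union>d. Pol d)"
  then obtain d where "x \<in> Pol d" by blast
  then have "\<zero> \<ominus> x \<in> Pol d" using polys_diff polys_zero by blast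
  then show "\<ominus> x \<in> (\<Union>d. Pol d)" using polys_carr[OF \<open>x \<in> Pol d\<close>] by (auto simp: a_minus_def)
next
  show "\<one> \<in> (\<Union>d. Pol d)" using adjoin_A subringE(3)[OF A] by blast
qed (use polys_carr in blast)

lemma adjoin_least:
  assumes K: "subring K R" "A \<subseteq> K" "z \<in> K" shows "Pol d \<subseteq> K"
proof (induct d)
  case (Suc d)
  have "z [^] k \<in> K" for k :: nat
    by (induct k) (use subringE(3)[OF K(1)] subringE(6)[OF K(1)] K(3) in auto)
  show ?case
  proof
    fix x assume "x \<in> Pol (Suc d)"
    then obtain f a where f: "f \<in> Pol d" "a \<in> A" "x = f \<oplus> a \<otimes> z [^] d" by auto
    have "f \<in> K" "a \<otimes> z [^] d \<in> K" using f Suc K(2) \<open>\<And>k. z [^] k \<in> K\<close> subringE(6)[OF K(1)] by auto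
    then show "x \<in> K" unfolding f(3) by (rule subringE(7)[OF K(1)])
  qed
qed (use subringE(2)[OF K(1)] in simp)

text \<open>Hilbert's argument. The leading coefficients \<open>L I d\<close> form ideals of
  \<open>A\<close> that increase with \<open>d\<close>, by multiplication with \<open>z\<close>, and
  become stationary at some \<open>N\<close>. Finitely many generators of \<open>L I d\<close> for
  \<open>d \<le> N\<close> are lifted to elements \<open>H\<close> of \<open>I\<close>. An ideal
  containing \<open>H\<close> has the same leading coefficients in every degree, and subtracting
  leading terms recovers all of \<open>I\<close>.\<close>

lemma adjoin_noeth:
  assumes "noeth_subring R A" shows "noeth_subring R (\<Union>d. Pol d)"
proof -
  \<comment> \<open>A leading coefficient is one that occurs in some expression of an element of
    \<open>I\<close> with degree at most \<open>d\<close>; this makes sense although expressions in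
    \<open>z\<close> are not unique.\<close>
  define L where "L I d = {a \<in> A. \<exists>f\<in>Pol d. f \<oplus> a \<otimes> z [^] d \<in> I}" for I d
  define C where "C = (\<Union>d. Pol d)"
  have C: "subring C R" unfolding C_def by (rule adjoin_subring)
  have L: "subideal R A (L I d)" if I: "subideal R C I" for I d
    unfolding subideal_def
  proof (intro conjI ballI)
    show "\<zero> \<in> L I d" using subringE(2)[OF A] polys_zero[of d] I z unfolding L_def subideal_def by auto
    fix a b assume "a \<in> L I d" "b \<in> L I d"
    then obtain f g where f: "a \<in> A" "f \<in> Pol d" "f \<oplus> a \<otimes> z [^] d \<in> I"
      and g: "b \<in> A" "g \<in> Pol d" "g \<oplus> b \<otimes> z [^] d \<in> I" unfolding L_def by blast
    have c: "f \<in> carrier R" "g \<in> carrier R" "a \<in> carrier R" "b \<in> carrier R" "z [^] d \<in> carrier R"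
      using f g polys_carr subring_carr z by auto
    have "(f \<oplus> a \<otimes> z [^] d) \<oplus> (g \<oplus> b \<otimes> z [^] d) \<in> I" using f g I unfolding subideal_def by blast
    moreover have "(f \<oplus> a \<otimes> z [^] d) \<oplus> (g \<oplus> b \<otimes> z [^] d) = (f \<oplus> g) \<oplus> (a \<oplus> b) \<otimes> z [^] d"
      using c by algebra
    ultimately show "a \<oplus> b \<in> L I d" using subringE(7)[OF A f(1) g(1)] polys_add[OF f(2) g(2)] unfolding L_def by auto
  next
    fix b a assume b: "b \<in> A" and "a \<in> L I d"
    then obtain f where f: "a \<in> A" "f \<in> Pol d" "f \<oplus> a \<otimes> z [^] d \<in> I" unfolding L_def by blast
    have c: "f \<in> carrier R" "a \<in> carrier R" "b \<in> carrier R" "z [^] d \<in> carrier R"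
      using f b polys_carr subring_carr z by auto
    have "b \<in> C" using b adjoin_A unfolding C_def by blast
    then have "b \<otimes> (f \<oplus> a \<otimes> z [^] d) \<in> I" using f I unfolding subideal_def by blast
    moreover have "b \<otimes> (f \<oplus> a \<otimes> z [^] d) = b \<otimes> f \<oplus> (b \<otimes> a) \<otimes> z [^] d" using c by algebra
    ultimately show "b \<otimes> a \<in> L I d" using subringE(6)[OF A b f(1)] polys_smult[OF f(2) b] unfolding L_def by auto
  qed (auto simp: L_def)
  have Linc: "L I d \<subseteq> L I (Suc d)" if I: "subideal R C I" for I d
  proof
    fix a assume "a \<in> L I d"
    then obtain f where f: "a \<in> A" "f \<in> Pol d" "f \<oplus> a \<otimes> z [^] d \<in> I" unfolding L_def by blast
    have c: "f \<in> carrier R" "a \<in> carrier R" "z [^] d \<in> carrier R" using f polys_carr subring_carr z by auto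
    have "z \<in> C" using adjoin_z unfolding C_def by blast
    then have "z \<otimes> (f \<oplus> a \<otimes> z [^] d) \<in> I" using f I unfolding subideal_def by blast
    moreover have "z \<otimes> (f \<oplus> a \<otimes> z [^] d) = f \<otimes> z \<oplus> a \<otimes> (z [^] d \<otimes> z)" using c z by algebra
    ultimately show "a \<in> L I (Suc d)" using f(1) polys_shift[OF f(2)] unfolding L_def by auto
  qed
  have "\<exists>G. finite G \<and> G \<subseteq> I \<and> (\<forall>J. subideal R C J \<longrightarrow> G \<subseteq> J \<longrightarrow> I \<subseteq> J)" if I: "subideal R C I" for I
  proof -
    obtain N where N: "\<forall>d\<ge>N. L I d = L I N"
      using subideal_chain_stable[OF assms, of "L I", OF L[OF I] Linc[OF I]] by blast
    have "\<forall>d. \<exists>G. finite G \<and> G \<subseteq> L I d \<and> (\<forall>J. subideal R A J \<longrightarrow> G \<subseteq> J \<longrightarrow> L I d \<subseteq> J)"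
      using assms L[OF I] unfolding noeth_subring_def by blast
    then obtain G where G: "\<And>d. finite (G d)" "\<And>d. G d \<subseteq> L I d"
      "\<And>d J. \<lbrakk>subideal R A J; G d \<subseteq> J\<rbrakk> \<Longrightarrow> L I d \<subseteq> J" by metis
    have "\<forall>d a. \<exists>f. a \<in> G d \<longrightarrow> f \<in> Pol d \<and> f \<oplus> a \<otimes> z [^] d \<in> I" using G(2) unfolding L_def by blast
    then obtain h where h: "\<And>d a. a \<in> G d \<Longrightarrow> h d a \<in> Pol d \<and> h d a \<oplus> a \<otimes> z [^] d \<in> I" by metis
    define H where "H = (\<Union>d\<le>N. (\<lambda>a. h d a \<oplus> a \<otimes> z [^] d) ` G d)"
    have H: "finite H" "H \<subseteq> I" using G(1) h unfolding H_def by auto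
    have "I \<subseteq> J" if J: "subideal R C J" and HJ: "H \<subseteq> J" for J
    proof -
      \<comment> \<open>Intersecting with \<open>I\<close> lets an element with the right leading
        coefficient be found in \<open>I\<close> and \<open>J\<close> together. The difference
        formed below then stays in \<open>I\<close>, as the induction on the degree
        requires.\<close>
      define K where "K = J \<inter> I"
      have K: "subideal R C K" unfolding K_def by (rule subideal_Int[OF J I])
      have le: "L I d \<subseteq> L K d" if d: "d \<le> N" for d
      proof (rule G(3)[OF L[OF K]])
        show "G d \<subseteq> L K d"
        proof
          fix a assume a: "a \<in> G d"
          then have "h d a \<oplus> a \<otimes> z [^] d \<in> K" using H(2) HJ d unfolding K_def H_def by blast
          moreover have "a \<in> A" using a G(2) unfolding L_def by blast
          ultimately show "a \<in> L K d" using h[OF a] unfolding L_def by blast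
        qed
      qed
      have LK: "L I d \<subseteq> L K d" for d
      proof (cases "d \<le> N")
        case False
        then have "N \<le> d" by simp
        then have "L I d = L I N" "L K N \<subseteq> L K d"
          using N lift_Suc_mono_le[of "L K" N d, OF Linc[OF K]] by blast+
        then show ?thesis using le[of N] by blast
      qed (rule le)
      have "I \<inter> Pol d \<subseteq> K" for d
      proof (induct d)
        case 0
        then show ?case using K unfolding subideal_def by auto
      next
        case (Suc d)
        show ?case
        proof
          fix x assume x: "x \<in> I \<inter> Pol (Suc d)"
          then obtain f a where f: "f \<in> Pol d" "a \<in> A" "x = f \<oplus> a \<otimes> z [^] d" by auto
          then have "a \<in> L K d" using x LK[of d] unfolding L_def by blast
          then obtain g where g: "g \<in> Pol d" "g \<oplus> a \<otimes> z [^] d \<in> K" unfolding L_def by blast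
          have c: "f \<in> carrier R" "g \<in> carrier R" "a \<in> carrier R" "z [^] d \<in> carrier R"
            using f g polys_carr subring_carr z by auto
          have "x \<ominus> (g \<oplus> a \<otimes> z [^] d) \<in> I" using subideal_diff[OF C I] x g(2) unfolding K_def by blast
          moreover have "x \<ominus> (g \<oplus> a \<otimes> z [^] d) = f \<ominus> g" unfolding f(3) using c by algebra
          ultimately have "f \<ominus> g \<in> K" using Suc polys_diff[OF f(1) g(1)] by auto
          then have "(f \<ominus> g) \<oplus> (g \<oplus> a \<otimes> z [^] d) \<in> K" using g(2) K unfolding subideal_def by blast
          moreover have "(f \<ominus> g) \<oplus> (g \<oplus> a \<otimes> z [^] d) = x" unfolding f(3) using c by algebra
          ultimately show "x \<in> K" by simp
        qed
      qed
      moreover have "I \<subseteq> (\<Union>d. Pol d)" using I unfolding subideal_def C_def by blast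
      ultimately show ?thesis unfolding K_def by blast
    qed
    then show ?thesis using H by blast
  qed
  then show ?thesis using C unfolding noeth_subring_def C_def by blast
qed

end

lemma finitely_generated_noeth:
  assumes A: "noeth_subring R A" and "finite Z" "Z \<subseteq> carrier R"
  shows "noeth_subring R (generate_ring R (A \<union> Z))"
  using assms(2,3)
proof (induct Z)
  case empty
  have sA: "subring A R" using A unfolding noeth_subring_def by blast
  have "A = generate_ring R A" by (rule generate_ringI[OF subringE(1)[OF sA] sA]) auto
  then show ?case using A by simp
next
  case (insert z Z)
  have sA: "subring A R" using A unfolding noeth_subring_def by blast
  have AZ: "A \<union> Z \<subseteq> carrier R" "A \<union> insert z Z \<subseteq> carrier R" using subringE(1)[OF sA] insert.prems by auto
  have z: "z \<in> carrier R" using insert.prems by blast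
  let ?B = "generate_ring R (A \<union> Z)"
  have B: "subring ?B R" using generate_ring_is_subring[OF AZ(1)] .
  have "(\<Union>d. polys_below R ?B z d) = generate_ring R (A \<union> insert z Z)"
  proof (rule generate_ringI[OF AZ(2) adjoin_subring[OF B z]])
    have "A \<union> Z \<subseteq> ?B" using generate_ring.incl by (rule subsetI)
    then have "A \<union> Z \<subseteq> (\<Union>d. polys_below R ?B z d)"
      using adjoin_A[OF B z] by (meson UN_upper UNIV_I order_trans)
    moreover have "z \<in> (\<Union>d. polys_below R ?B z d)" using adjoin_z[OF B z] by (rule UN_I[OF UNIV_I])
    ultimately show "A \<union> insert z Z \<subseteq> (\<Union>d. polys_below R ?B z d)" by simp
    fix K assume K: "subring K R" "A \<union> insert z Z \<subseteq> K"
    have "?B \<subseteq> K" by (rule generate_ring_min_subring1[OF AZ(1) K(1)]) (use K in blast)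
    then show "(\<Union>d. polys_below R ?B z d) \<subseteq> K"
      using adjoin_least[OF B z K(1)] K(2) by (intro UN_least) simp
  qed
  then show ?case using adjoin_noeth[OF B z] insert by simp
qed

end

section \<open>Homogeneous ideals of the Rees algebra\<close>

context noetherian_local
begin

text \<open>The sequence \<open>I\<close> stands for the homogeneous ideal \<open>\<Oplus>n. I n * t^n\<close> of the
  Rees algebra \<open>R[\<mm>t]\<close>.\<close>

definition family :: "(nat \<Rightarrow> 'a set) \<Rightarrow> bool" where
  "family I \<longleftrightarrow> (\<forall>n. ideal (I n) R \<and> I n \<subseteq> \<pp> n \<and> \<mm> \<cdot> I n \<subseteq> I (Suc n))"

lemma family_ideal: "family I \<Longrightarrow> ideal (I n) R"
  unfolding family_def by blast

lemma family_sub: "family I \<Longrightarrow> I n \<subseteq> \<pp> n"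
  unfolding family_def by blast

lemma family_step: "family I \<Longrightarrow> \<mm> \<cdot> I n \<subseteq> I (Suc n)"
  unfolding family_def by blast

lemma pow_Suc_prod: "ideal I R \<Longrightarrow> \<pp> (Suc k) \<cdot> I = \<mm> \<cdot> (\<pp> k \<cdot> I)"
  using ideal_prod_assoc[OF mm_ideal pp_ideal] by simp

lemma family_pow: "family I \<Longrightarrow> \<pp> k \<cdot> I n \<subseteq> I (n + k)"
proof (induct k)
  case 0
  then show ?case using carrier_prod[OF family_ideal] by simp
next
  case (Suc k)
  have "\<mm> \<cdot> (\<pp> k \<cdot> I n) \<subseteq> \<mm> \<cdot> I (n + k)" using Suc by (intro prod_mono) auto
  then show ?case using family_step[OF Suc.prems, of "n + k"] pow_Suc_prod[OF family_ideal[OF Suc.prems]] by auto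
qed

lemma family_mult: "\<lbrakk>family I; a \<in> \<pp> k; b \<in> I n\<rbrakk> \<Longrightarrow> a \<otimes> b \<in> I (n + k)"
  using family_pow[of I k n] ideal_prod.prod[of a "\<pp> k" b "I n" R] by blast

lemma mm_generators:
  obtains ys where "\<And>i. i < min_num_gens R \<mm> \<Longrightarrow> ys i \<in> carrier R"
    "Idl (ys ` {..<min_num_gens R \<mm>}) = \<mm>"
proof -
  obtain A where A: "A \<subseteq> carrier R" "finite A" "\<mm> = Idl A" using finetely_gen[OF mm_ideal] by blast
  have "\<exists>n A. A \<subseteq> carrier R \<and> finite A \<and> card A = n \<and> Idl A = \<mm>" using A by auto
  then have "\<exists>A. A \<subseteq> carrier R \<and> finite A \<and> card A = min_num_gens R \<mm> \<and> Idl A = \<mm>"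
    unfolding min_num_gens_def by (rule LeastI_ex)
  then obtain B where B: "B \<subseteq> carrier R" "finite B" "card B = min_num_gens R \<mm>" "Idl B = \<mm>" by blast
  then obtain ys where "bij_betw ys {..<min_num_gens R \<mm>} B"
    using ex_bij_betw_nat_finite[OF B(2)] by (auto simp: atLeast0LessThan)
  then have "ys ` {..<min_num_gens R \<mm>} = B" by (simp add: bij_betw_def)
  then show thesis using that[of ys] B by auto
qed

lemma finsum_mem:
  assumes "ideal J R" "finite I" "\<And>i. i \<in> I \<Longrightarrow> f i \<in> J" shows "finsum R f I \<in> J"
  using assms(2,3)
proof (induct I)
  case (insert i I)
  have "finsum R f (insert i I) = f i \<oplus> finsum R f I"
    by (rule finsum_insert) (use insert ideal_carr[OF assms(1)] in auto)
  then show ?case using insert ideal_add_mem[OF assms(1)] by simp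
qed (use ideal_zero_mem[OF assms(1)] in simp)

text \<open>The Rees algebra is realized in the one-variable polynomial ring as the subring
  \<open>T\<close> generated by the constants and the elements \<open>y_i t\<close>; it is
  Noetherian by the basis theorem. The family is an ideal \<open>S\<close> of \<open>T\<close>, and
  \<open>c\<close> bounds the degrees of finitely many generators of \<open>S\<close>. Beyond degree
  \<open>c\<close> nothing new can appear, which is shown with the ideal \<open>J\<close>.\<close>

lemma family_finitely_generated:
  assumes I: "family I"
  shows "\<exists>c. \<forall>n\<ge>c. I (Suc n) \<subseteq> \<mm> \<cdot> I n"
proof -
  interpret UP: UP_cring R "UP R" by unfold_locales simp
  let ?P = "UP R"
  let ?n = "min_num_gens R \<mm>"
  obtain ys where ys: "\<And>i. i < ?n \<Longrightarrow> ys i \<in> carrier R" "Idl (ys ` {..<?n}) = \<mm>"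
    using mm_generators by blast
  have ysm: "ys i \<in> \<mm>" if "i < ?n" for i
    using genideal_self[of "ys ` {..<?n}"] ys that by auto
  define A where "A = (\<lambda>a. up_ring.monom ?P a 0) ` carrier R"
  define Z where "Z = (\<lambda>i. up_ring.monom ?P (ys i) 1) ` {..<?n}"
  have "(\<lambda>a. up_ring.monom ?P a 0) \<in> ring_hom R ?P" by (rule UP.const_ring_hom)
  then have A: "noeth_subring ?P A"
    unfolding A_def by (rule UP.P.noeth_subring_image[OF noetherian_ring_axioms])
  have Z: "finite Z" "Z \<subseteq> carrier ?P" using ys unfolding Z_def by auto
  have AZ: "A \<union> Z \<subseteq> carrier ?P" using Z unfolding A_def by auto
  define T where "T = generate_ring ?P (A \<union> Z)"
  have T: "noeth_subring ?P T" unfolding T_def by (rule UP.P.finitely_generated_noeth[OF A Z])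
  have Ts: "subring T ?P" using T unfolding noeth_subring_def by blast
  have ATZ: "A \<union> Z \<subseteq> T" unfolding T_def by (auto intro: generate_ring.incl)
  have mon1: "up_ring.monom ?P a 1 \<in> T" if "a \<in> \<mm>" for a
  proof -
    have "ideal {a \<in> carrier R. up_ring.monom ?P a 1 \<in> T} R"
    proof (rule cidealI)
      show "\<zero> \<in> {a \<in> carrier R. up_ring.monom ?P a 1 \<in> T}" using subringE(2)[OF Ts] by simp
      fix a b assume "a \<in> {a \<in> carrier R. up_ring.monom ?P a 1 \<in> T}" "b \<in> {a \<in> carrier R. up_ring.monom ?P a 1 \<in> T}"
      then show "a \<oplus> b \<in> {a \<in> carrier R. up_ring.monom ?P a 1 \<in> T}" using subringE(7)[OF Ts] by simp
    next
      fix a x assume a: "a \<in> {a \<in> carrier R. up_ring.monom ?P a 1 \<in> T}" and x: "x \<in> carrier R"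
      have "up_ring.monom ?P (x \<otimes> a) (0 + 1) = up_ring.monom ?P x 0 \<otimes>\<^bsub>?P\<^esub> up_ring.monom ?P a 1"
        using a x by (intro UP.monom_mult) auto
      moreover have "up_ring.monom ?P x 0 \<in> T" using x ATZ unfolding A_def by blast
      ultimately show "x \<otimes> a \<in> {a \<in> carrier R. up_ring.monom ?P a 1 \<in> T}"
        using a x subringE(6)[OF Ts] by simp
    qed auto
    moreover have "ys ` {..<?n} \<subseteq> {a \<in> carrier R. up_ring.monom ?P a 1 \<in> T}"
      using ys ATZ unfolding Z_def by auto
    ultimately have "\<mm> \<subseteq> {a \<in> carrier R. up_ring.monom ?P a 1 \<in> T}" using genideal_minimal ys(2) by metis
    then show ?thesis using that by blast
  qed
  have mon: "up_ring.monom ?P a n \<in> T" if "a \<in> \<pp> n" for a n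
    using that
  proof (induct n arbitrary: a)
    case 0
    then show ?case using ATZ unfolding A_def by auto
  next
    case (Suc n)
    have "a \<in> \<mm> \<cdot> \<pp> n" using Suc.prems by simp
    then show ?case
    proof (induct a rule: ideal_prod.induct)
      case (prod i j)
      have "up_ring.monom ?P (i \<otimes> j) (1 + n) = up_ring.monom ?P i 1 \<otimes>\<^bsub>?P\<^esub> up_ring.monom ?P j n"
        using prod mm_carr ideal_carr[OF pp_ideal] by (intro UP.monom_mult) auto
      then show ?case using subringE(6)[OF Ts mon1[OF prod(1)] Suc.hyps[OF prod(2)]] by simp
    next
      case (sum a b)
      have "a \<in> carrier R" "b \<in> carrier R"
        using sum ideal_carr[OF ideal_prod_is_ideal[OF mm_ideal pp_ideal]] by auto
      then show ?case using sum subringE(7)[OF Ts] by simp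
    qed
  qed
  \<comment> \<open>Polynomials whose coefficient in degree \<open>n\<close> lies in
    \<open>\<mm>^n\<close> form a subring containing the generators of \<open>T\<close>, which
    bounds \<open>T\<close> from above. With \<open>mon\<close> as the opposite bound,
    \<open>T\<close> is the Rees algebra.\<close>
  define Q where "Q = {f \<in> carrier ?P. \<forall>n. up_ring.coeff ?P f n \<in> \<pp> n}"
  have Q: "subring Q ?P"
  proof (rule UP.P.subringI)
    show "\<one>\<^bsub>?P\<^esub> \<in> Q" using ideal_zero_mem[OF pp_ideal] by (auto simp: Q_def)
    fix f assume f: "f \<in> Q"
    then show "\<ominus>\<^bsub>?P\<^esub> f \<in> Q" using ideal_neg_mem[OF pp_ideal] by (auto simp: Q_def)
    fix g assume g: "g \<in> Q"
    show "f \<oplus>\<^bsub>?P\<^esub> g \<in> Q" using f g ideal_add_mem[OF pp_ideal] by (auto simp: Q_def)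
    have "up_ring.coeff ?P (f \<otimes>\<^bsub>?P\<^esub> g) n \<in> \<pp> n" for n
    proof -
      have "(\<Oplus>i\<in>{..n}. up_ring.coeff ?P f i \<otimes> up_ring.coeff ?P g (n - i)) \<in> \<pp> n"
      proof (rule finsum_mem[OF pp_ideal])
        fix i assume "i \<in> {..n}"
        then show "up_ring.coeff ?P f i \<otimes> up_ring.coeff ?P g (n - i) \<in> \<pp> n"
          using f g pow_mult_mem[OF mm_ideal, of "up_ring.coeff ?P f i" i "up_ring.coeff ?P g (n - i)" "n - i"]
          by (simp add: Q_def)
      qed simp
      then show ?thesis using f g by (simp add: Q_def)
    qed
    then show "f \<otimes>\<^bsub>?P\<^esub> g \<in> Q" using f g by (simp add: Q_def)
  qed (auto simp: Q_def)
  have "A \<union> Z \<subseteq> Q"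
  proof
    fix f assume "f \<in> A \<union> Z"
    then consider a where "a \<in> carrier R" "f = up_ring.monom ?P a 0" | i where "i < ?n" "f = up_ring.monom ?P (ys i) 1"
      unfolding A_def Z_def by blast
    then show "f \<in> Q"
    proof cases
      case 1
      then show ?thesis using ideal_zero_mem[OF pp_ideal] by (auto simp: Q_def)
    next
      case 2
      have "ys i \<in> \<pp> 1" using ysm[OF 2(1)] pow_one[OF mm_ideal] by simp
      then show ?thesis using 2 ys(1) ideal_zero_mem[OF pp_ideal] by (auto simp: Q_def)
    qed
  qed
  then have TQ: "T \<subseteq> Q" unfolding T_def by (rule UP.P.generate_ring_min_subring1[OF AZ Q])
  have Tc: "f \<in> carrier ?P" "up_ring.coeff ?P f n \<in> \<pp> n" if "f \<in> T" for f n
    using that TQ unfolding Q_def by auto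
  define S where "S = {f \<in> T. \<forall>n. up_ring.coeff ?P f n \<in> I n}"
  have S: "subideal ?P T S" unfolding subideal_def
  proof (intro conjI ballI)
    show "\<zero>\<^bsub>?P\<^esub> \<in> S" using subringE(2)[OF Ts] ideal_zero_mem[OF family_ideal[OF I]] by (simp add: S_def)
    fix f g assume "f \<in> S" "g \<in> S"
    then show "f \<oplus>\<^bsub>?P\<^esub> g \<in> S"
      using subringE(7)[OF Ts] Tc ideal_add_mem[OF family_ideal[OF I]] by (simp add: S_def)
  next
    fix g f assume g: "g \<in> T" and f: "f \<in> S"
    have "up_ring.coeff ?P (g \<otimes>\<^bsub>?P\<^esub> f) n \<in> I n" for n
    proof -
      have "(\<Oplus>i\<in>{..n}. up_ring.coeff ?P g i \<otimes> up_ring.coeff ?P f (n - i)) \<in> I n"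
      proof (rule finsum_mem[OF family_ideal[OF I]])
        fix i assume "i \<in> {..n}"
        then show "up_ring.coeff ?P g i \<otimes> up_ring.coeff ?P f (n - i) \<in> I n"
          using f Tc(2)[OF g, of i] family_mult[OF I, of "up_ring.coeff ?P g i" i "up_ring.coeff ?P f (n - i)" "n - i"]
          by (simp add: S_def)
      qed simp
      then show ?thesis using f g Tc by (simp add: S_def)
    qed
    then show "g \<otimes>\<^bsub>?P\<^esub> f \<in> S" using f g subringE(6)[OF Ts] by (simp add: S_def)
  qed (simp add: S_def)
  obtain G where G: "finite G" "G \<subseteq> S" "\<And>J. \<lbrakk>subideal ?P T J; G \<subseteq> J\<rbrakk> \<Longrightarrow> S \<subseteq> J"
    using T S unfolding noeth_subring_def by blast
  have "\<exists>c. \<forall>f\<in>G. \<forall>n>c. up_ring.coeff ?P f n = \<zero>" using G(1,2)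
  proof (induct G)
    case (insert f G)
    then obtain c where c: "\<forall>f\<in>G. \<forall>n>c. up_ring.coeff ?P f n = \<zero>" by auto
    have "f \<in> carrier ?P" using insert.prems Tc(1) by (simp add: S_def)
    then have "\<forall>n>deg R f. up_ring.coeff ?P f n = \<zero>" using UP.deg_aboveD by blast
    then show ?case using c by (intro exI[of _ "max c (deg R f)"]) auto
  qed simp
  then obtain c where c: "\<And>f n. \<lbrakk>f \<in> G; n > c\<rbrakk> \<Longrightarrow> up_ring.coeff ?P f n = \<zero>" by blast
  have mI: "ideal (\<mm> \<cdot> I n) R" for n using ideal_prod_is_ideal[OF mm_ideal family_ideal[OF I]] .
  \<comment> \<open>These are the members of \<open>S\<close> that have the desired property in all
    degrees above \<open>c\<close>. The generators of \<open>S\<close> belong to \<open>J\<close>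
    because their coefficients vanish there, so \<open>S \<subseteq> J\<close>.\<close>
  define J where "J = {f \<in> S. \<forall>n\<ge>c. up_ring.coeff ?P f (Suc n) \<in> \<mm> \<cdot> I n}"
  have J: "subideal ?P T J" unfolding subideal_def
  proof (intro conjI ballI)
    show "J \<subseteq> T" by (auto simp: J_def S_def)
    show "\<zero>\<^bsub>?P\<^esub> \<in> J" using S ideal_zero_mem[OF mI] by (simp add: J_def subideal_def)
    fix f g assume f: "f \<in> J" "g \<in> J"
    then have "f \<in> carrier ?P" "g \<in> carrier ?P" using Tc by (auto simp: J_def S_def)
    then show "f \<oplus>\<^bsub>?P\<^esub> g \<in> J" using f S ideal_add_mem[OF mI] by (simp add: J_def subideal_def)
  next
    fix g f assume g: "g \<in> T" and f: "f \<in> J"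
    have fS: "f \<in> S" and fc: "f \<in> carrier ?P" using f Tc by (auto simp: J_def S_def)
    have "up_ring.coeff ?P (g \<otimes>\<^bsub>?P\<^esub> f) (Suc n) \<in> \<mm> \<cdot> I n" if n: "n \<ge> c" for n
    proof -
      have "(\<Oplus>i\<in>{..Suc n}. up_ring.coeff ?P g i \<otimes> up_ring.coeff ?P f (Suc n - i)) \<in> \<mm> \<cdot> I n"
      proof (rule finsum_mem[OF mI])
        fix i assume i: "i \<in> {..Suc n}"
        show "up_ring.coeff ?P g i \<otimes> up_ring.coeff ?P f (Suc n - i) \<in> \<mm> \<cdot> I n"
        proof (cases i)
          case 0
          then show ?thesis using f n Tc[OF g] by (auto simp: J_def intro: ideal_lmult_mem[OF mI])
        next
          case (Suc k)
          \<comment> \<open>A multiplier of positive degree \<open>k + 1\<close> provides one factor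
            from \<open>\<mm>\<close>, while the remaining \<open>\<mm>^k I (n - k)\<close> lies in
            \<open>I n\<close>. Only the multiplier of degree 0 relies on the defining property of
            \<open>J\<close>.\<close>
          have "up_ring.coeff ?P g i \<otimes> up_ring.coeff ?P f (Suc n - i) \<in> \<pp> (Suc k) \<cdot> I (n - k)"
            using Tc(2)[OF g, of i] fS Suc by (intro ideal_prod.prod) (auto simp: S_def)
          also have "\<dots> \<subseteq> \<mm> \<cdot> I n"
            using i Suc family_pow[OF I, of k "n - k"]
            unfolding pow_Suc_prod[OF family_ideal[OF I]] by (intro prod_mono) auto
          finally show ?thesis .
        qed
      qed simp
      then show ?thesis using g fc Tc by simp
    qed
    then show "g \<otimes>\<^bsub>?P\<^esub> f \<in> J" using fS g S by (simp add: J_def subideal_def)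
  qed
  have "G \<subseteq> J" using G(2) c ideal_zero_mem[OF mI] by (auto simp: J_def)
  then have SJ: "S \<subseteq> J" using G(3) J by blast
  have "I (Suc n) \<subseteq> \<mm> \<cdot> I n" if "n \<ge> c" for n
  proof
    fix a assume a: "a \<in> I (Suc n)"
    have ac: "a \<in> carrier R" using a family_ideal[OF I] ideal_carr by blast
    have "up_ring.monom ?P a (Suc n) \<in> T" using mon a family_sub[OF I] by blast
    then have "up_ring.monom ?P a (Suc n) \<in> S" using a ac ideal_zero_mem[OF family_ideal[OF I]] by (auto simp: S_def)
    then have "up_ring.coeff ?P (up_ring.monom ?P a (Suc n)) (Suc n) \<in> \<mm> \<cdot> I n" using SJ that unfolding J_def by blast
    then show "a \<in> \<mm> \<cdot> I n" using ac by simp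
  qed
  then show ?thesis by blast
qed

lemma family_eventually_pow:
  assumes I: "family I"
  shows "\<exists>c. \<forall>j. I (c + j) \<subseteq> \<pp> j \<cdot> I c"
proof -
  obtain c where c: "\<And>n. n \<ge> c \<Longrightarrow> I (Suc n) \<subseteq> \<mm> \<cdot> I n" using family_finitely_generated[OF I] by blast
  have "I (c + j) \<subseteq> \<pp> j \<cdot> I c" for j
  proof (induct j)
    case 0
    then show ?case using carrier_prod[OF family_ideal[OF I]] by simp
  next
    case (Suc j)
    have "I (c + Suc j) \<subseteq> \<mm> \<cdot> I (c + j)" using c by simp
    also have "\<dots> \<subseteq> \<mm> \<cdot> (\<pp> j \<cdot> I c)" using Suc by (intro prod_mono) auto
    finally show ?case using pow_Suc_prod[OF family_ideal[OF I]] by simp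
  qed
  then show ?thesis by blast
qed

section \<open>Ascending chains of families and Noetherian induction\<close>

lemma ideal_chain_stable:
  assumes "\<And>j. ideal (L j) R" "\<And>j. L j \<subseteq> L (Suc j)"
  shows "\<exists>N. \<forall>j\<ge>N. L j = L N"
proof -
  have mono: "L d \<subseteq> L e" if "d \<le> e" for d e using lift_Suc_mono_le[of L, OF assms(2) that] .
  have "subset.chain {I. ideal I R} (range L)"
    unfolding subset_chain_def using assms(1) mono by (auto, metis nat_le_linear subsetD)
  then have "\<Union>(range L) \<in> range L" using ideal_chain_is_trivial by blast
  then obtain N where "\<Union>(range L) = L N" by blast
  then have "\<forall>j\<ge>N. L j = L N" using mono by blast
  then show ?thesis by blast
qed

text \<open>Each degree becomes stationary separately; uniformity comes from the union
  \<open>U\<close>, which is again a family and hence generated in degrees up to some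
  \<open>c\<close>. Once the finitely many degrees up to \<open>c\<close> are stationary, the higher
  ones follow, since \<open>U (n + 1) \<subseteq> \<mm> U n\<close>.\<close>

lemma family_chain_stable:
  assumes F: "\<And>j. family (F j)" and inc: "\<And>j n. F j n \<subseteq> F (Suc j) n"
  shows "\<exists>N. F (Suc N) = F N"
proof -
  define U where "U n = (\<Union>j. F j n)" for n
  have "\<forall>n. \<exists>N. \<forall>j\<ge>N. F j n = F N n"
    using ideal_chain_stable[of "\<lambda>j. F j n" for n, OF family_ideal[OF F] inc] by blast
  then obtain N where N: "\<And>n j. j \<ge> N n \<Longrightarrow> F j n = F (N n) n" by metis
  have mono: "F d n \<subseteq> F e n" if "d \<le> e" for d e n
    using lift_Suc_mono_le[of "\<lambda>j. F j n", OF inc that] .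
  have UN: "U n = F j n" if "j \<ge> N n" for n j
  proof -
    have "F i n \<subseteq> F j n" for i
      using mono[of i "max i j" n] N[of n "max i j"] N[of n j] that by auto
    then show ?thesis unfolding U_def by blast
  qed
  have U: "family U" unfolding family_def
  proof (intro allI conjI)
    fix n
    show "ideal (U n) R" "U n \<subseteq> \<pp> n" using UN[OF order_refl, of n] F family_ideal family_sub by simp_all
    have "U n = F (max (N n) (N (Suc n))) n" "U (Suc n) = F (max (N n) (N (Suc n))) (Suc n)"
      using UN by simp_all
    then show "\<mm> \<cdot> U n \<subseteq> U (Suc n)" using family_step[OF F] by simp
  qed
  obtain c where c: "\<And>n. n \<ge> c \<Longrightarrow> U (Suc n) \<subseteq> \<mm> \<cdot> U n" using family_finitely_generated[OF U] by blast
  define M where "M = Max (N ` {..c})"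
  have "F j n = U n" if j: "j \<ge> M" for j n
  proof (induct n)
    case 0
    have "N 0 \<le> M" unfolding M_def by (intro Max_ge) auto
    then show ?case using UN[of 0 j] j by simp
  next
    case (Suc n)
    show ?case
    proof (cases "Suc n \<le> c")
      case True
      then have "N (Suc n) \<le> M" unfolding M_def by (intro Max_ge) auto
      then show ?thesis using UN[of "Suc n" j] j by simp
    next
      case False
      then have "U (Suc n) \<subseteq> \<mm> \<cdot> F j n" using c[of n] Suc by simp
      also have "\<dots> \<subseteq> F j (Suc n)" using family_step[OF F] .
      finally show ?thesis unfolding U_def by blast
    qed
  qed
  then have "F (Suc M) n = F M n" for n by (metis le_SucI order_refl)
  then show ?thesis by blast
qed

text \<open>Noetherian induction: a property holds for a family as soon as it holds for all strictly
  larger ones. Strict enlargement is well-founded because chains of families become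
  stationary.\<close>

lemma family_induct [consumes 1, case_names step]:
  assumes "family F"
    and step: "\<And>F. \<lbrakk>family F; \<And>F'. \<lbrakk>family F'; \<And>n. F n \<subseteq> F' n; F' \<noteq> F\<rbrakk> \<Longrightarrow> Q F'\<rbrakk> \<Longrightarrow> Q F"
  shows "Q F"
proof -
  define r where "r = {(F', F). family F \<and> family F' \<and> (\<forall>n. F n \<subseteq> F' n) \<and> F' \<noteq> F}"
  have "wf r"
    unfolding wf_iff_no_infinite_down_chain
  proof
    assume "\<exists>f. \<forall>i. (f (Suc i), f i) \<in> r"
    then obtain f where f: "\<And>i. (f (Suc i), f i) \<in> r" by blast
    have "\<exists>N. f (Suc N) = f N"
      by (rule family_chain_stable) (use f in \<open>auto simp: r_def\<close>)
    then show False using f unfolding r_def by blast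
  qed
  then show ?thesis using assms(1)
  proof (induct F)
    case (less F)
    show ?case by (rule step[OF less(2)]) (use less in \<open>auto simp: r_def\<close>)
  qed
qed

text \<open>The components \<open>A \<inter> \<mm>^n\<close> form a homogeneous ideal of the Rees
  algebra, generated in degrees up to some \<open>c\<close>. Beyond that,
  \<open>A \<inter> \<mm>^(c+j) \<subseteq> \<mm>^j A\<close>, so \<open>q0 = c + p\<close>
  works.\<close>

lemma artin_rees:
  assumes A: "ideal A R"
  shows "\<exists>q0. \<forall>q\<ge>q0. A \<inter> \<pp> q \<subseteq> \<pp> p \<cdot> A"
proof -
  have "family (\<lambda>n. A \<inter> \<pp> n)" unfolding family_def
  proof (intro allI conjI)
    fix n show "ideal (A \<inter> \<pp> n) R" using A pp_ideal i_intersect by blast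
    have "\<mm> \<cdot> (A \<inter> \<pp> n) \<subseteq> \<mm> \<cdot> A" "\<mm> \<cdot> (A \<inter> \<pp> n) \<subseteq> \<mm> \<cdot> \<pp> n" by (intro prod_mono; blast)+
    then show "\<mm> \<cdot> (A \<inter> \<pp> n) \<subseteq> A \<inter> \<pp> (Suc n)"
      using ideal_prod_inter[OF mm_ideal A] by auto
  qed blast
  then obtain c where c: "\<And>j. A \<inter> \<pp> (c + j) \<subseteq> \<pp> j \<cdot> (A \<inter> \<pp> c)" using family_eventually_pow by blast
  have "A \<inter> \<pp> q \<subseteq> \<pp> p \<cdot> A" if q: "q \<ge> c + p" for q
  proof -
    have "A \<inter> \<pp> q \<subseteq> A \<inter> \<pp> (c + p)" using pow_antimono[OF mm_ideal q] by blast
    also have "\<dots> \<subseteq> \<pp> p \<cdot> (A \<inter> \<pp> c)" by (rule c)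
    also have "\<dots> \<subseteq> \<pp> p \<cdot> A" by (rule prod_mono) auto
    finally show ?thesis .
  qed
  then show ?thesis by blast
qed

text \<open>Lets an exponent \<open>t\<close> that annihilates \<open>v\<close> be enlarged, so that
  exponents found for different filtrations can be replaced by their maximum.\<close>

lemma colon_pow_up:
  assumes H: "\<And>n. ideal (H n) R" "\<And>i n a h. \<lbrakk>a \<in> \<pp> i; h \<in> H n\<rbrakk> \<Longrightarrow> a \<otimes> h \<in> H (n + i)"
    and v: "v \<in> carrier R" "\<forall>w\<in>\<pp> t. w \<otimes> v \<in> H (k + t)" and t: "t \<le> t'" and w: "w \<in> \<pp> t'"
  shows "w \<otimes> v \<in> H (k + t')"
proof -
  have "\<pp> t' = \<pp> (t' - t) \<cdot> \<pp> t" using t pow_add[OF mm_ideal, of "t' - t" t] by simp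
  moreover have "\<pp> (t' - t) \<cdot> \<pp> t \<subseteq> colon R (H (k + t')) {v}"
  proof (rule prod_least[OF colon_ideal[OF H(1)]])
    fix a b assume a: "a \<in> \<pp> (t' - t)" and b: "b \<in> \<pp> t"
    have c: "a \<in> carrier R" "b \<in> carrier R" using a b ideal_carr[OF pp_ideal] by auto
    have "a \<otimes> (b \<otimes> v) \<in> H (k + t + (t' - t))" using H(2)[OF a] v(2) b by blast
    then show "a \<otimes> b \<in> colon R (H (k + t')) {v}" using c v t by (auto simp: colon_def m_assoc)
  qed (use v in auto)
  ultimately show ?thesis using w by (auto simp: colon_def)
qed

subsection \<open>General elements avoid the relevant associated primes\<close>

text \<open>For \<open>A \<subseteq> \<mm>\<close>, placed in degree one of the Rees algebra, this
  is nilpotency modulo the homogeneous ideal \<open>F\<close>: the power \<open>A^t\<close> is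
  compared with the component of degree \<open>t\<close>.\<close>

definition nil_ideal :: "(nat \<Rightarrow> 'a set) \<Rightarrow> 'a set \<Rightarrow> bool" where
  "nil_ideal F A \<longleftrightarrow> (\<exists>t. ideal_pow R A t \<subseteq> F t)"

lemma ideal_pow_mono: "A \<subseteq> B \<Longrightarrow> ideal_pow R A t \<subseteq> ideal_pow R B t"
  by (induct t) (auto intro: prod_mono[THEN subsetD])

lemma nil_ideal_sub: "\<lbrakk>nil_ideal F B; A \<subseteq> B\<rbrakk> \<Longrightarrow> nil_ideal F A"
  unfolding nil_ideal_def using ideal_pow_mono by (meson order_trans)

text \<open>In a product of \<open>N + M\<close> factors from \<open>A + B\<close>, each term has at
  least \<open>N\<close> factors from \<open>A\<close> or at least \<open>M\<close> from
  \<open>B\<close>.\<close>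

lemma nil_ideal_add:
  assumes F: "family F" and A: "ideal A R" "A \<subseteq> \<mm>" and B: "ideal B R" "B \<subseteq> \<mm>"
    and nA: "nil_ideal F A" and nB: "nil_ideal F B"
  shows "nil_ideal F (A <+>\<^bsub>R\<^esub> B)"
proof -
  obtain N M where N: "ideal_pow R A N \<subseteq> F N" and M: "ideal_pow R B M \<subseteq> F M"
    using nA nB unfolding nil_ideal_def by blast
  let ?C = "A <+>\<^bsub>R\<^esub> B"
  have C: "ideal ?C R" using add_ideals A B by blast
  have pA: "ideal_pow R A i \<subseteq> \<pp> i" and pB: "ideal_pow R B i \<subseteq> \<pp> i" for i
    using ideal_pow_mono A B by auto
  note i = pow_ideal[OF A(1)] pow_ideal[OF B(1)] pow_ideal[OF C]
  \<comment> \<open>The elements \<open>x\<close> and \<open>y\<close> collect the factors already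
    assigned to \<open>A\<close> and \<open>B\<close>, and \<open>k\<close> factors from the sum are
    still to be expanded.\<close>
  have "x \<otimes> y \<otimes> z \<in> F (a + b + k)"
    if "a + b + k \<ge> N + M" "x \<in> ideal_pow R A a" "y \<in> ideal_pow R B b" "z \<in> ideal_pow R ?C k" for a b k x y z
    using that
  proof (induct k arbitrary: a b x y z)
    case 0
    have c: "x \<in> carrier R" "y \<in> carrier R" "z \<in> carrier R"
      using ideal_carr[OF i(1) 0(2)] ideal_carr[OF i(2) 0(3)] ideal_carr[OF i(3) 0(4)] by auto
    have "x \<otimes> y \<in> F (a + b)"
    proof (cases "N \<le> a")
      case True
      have "x \<in> ideal_pow R A N \<cdot> ideal_pow R A (a - N)"
        using 0(2) True pow_add[OF A(1), of N "a - N"] by simp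
      also have "\<dots> \<subseteq> F N \<cdot> \<pp> (a - N)" using N pA by (rule prod_mono)
      also have "\<dots> = \<pp> (a - N) \<cdot> F N" using ideal_prod_commute[OF family_ideal[OF F] pp_ideal] .
      also have "\<dots> \<subseteq> F a" using family_pow[OF F, of "a - N" N] True by simp
      finally have "y \<otimes> x \<in> F (a + b)" using family_mult[OF F, of y b x a] pB 0(3) by blast
      then show ?thesis using c m_comm by simp
    next
      case False
      then have "M \<le> b" using 0 by simp
      have "y \<in> ideal_pow R B M \<cdot> ideal_pow R B (b - M)"
        using 0(3) \<open>M \<le> b\<close> pow_add[OF B(1), of M "b - M"] by simp
      also have "\<dots> \<subseteq> F M \<cdot> \<pp> (b - M)" using M pB by (rule prod_mono)
      also have "\<dots> = \<pp> (b - M) \<cdot> F M" using ideal_prod_commute[OF family_ideal[OF F] pp_ideal] .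
      also have "\<dots> \<subseteq> F b" using family_pow[OF F, of "b - M" M] \<open>M \<le> b\<close> by simp
      finally have "x \<otimes> y \<in> F (b + a)" using family_mult[OF F, of x a y b] pA 0(2) by blast
      then show ?thesis by (simp add: add.commute)
    qed
    then show ?case using c ideal_rmult_mem[OF family_ideal[OF F]] by simp
  next
    case (Suc k)
    have c: "x \<in> carrier R" "y \<in> carrier R"
      using ideal_carr[OF i(1) Suc.prems(2)] ideal_carr[OF i(2) Suc.prems(3)] by auto
    have "z \<in> ?C \<cdot> ideal_pow R ?C k" using Suc.prems by simp
    moreover have "?C \<cdot> ideal_pow R ?C k \<subseteq> colon R (F (a + b + Suc k)) {x \<otimes> y}"
    proof (rule prod_least[OF colon_ideal[OF family_ideal[OF F]]])
      fix s w assume "s \<in> ?C" and w: "w \<in> ideal_pow R ?C k"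
      then obtain p q where p: "p \<in> A" "q \<in> B" "s = p \<oplus> q" by (auto elim: set_addE)
      have pq: "p \<in> carrier R" "q \<in> carrier R" "w \<in> carrier R"
        using ideal_carr[OF A(1) p(1)] ideal_carr[OF B(1) p(2)] ideal_carr[OF i(3) w] by auto
      have "p \<otimes> x \<in> ideal_pow R A (Suc a)" "q \<otimes> y \<in> ideal_pow R B (Suc b)"
        using p Suc.prems by (auto intro: ideal_prod.prod)
      then have "(p \<otimes> x) \<otimes> y \<otimes> w \<in> F (Suc a + b + k)" "x \<otimes> (q \<otimes> y) \<otimes> w \<in> F (a + Suc b + k)"
        using Suc.hyps[of "Suc a" b "p \<otimes> x" y w] Suc.hyps[of a "Suc b" x "q \<otimes> y" w] Suc.prems w by auto
      then have "(p \<otimes> x) \<otimes> y \<otimes> w \<oplus> x \<otimes> (q \<otimes> y) \<otimes> w \<in> F (a + b + Suc k)"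
        using ideal_add_mem[OF family_ideal[OF F]] by simp
      moreover have "(p \<otimes> x) \<otimes> y \<otimes> w \<oplus> x \<otimes> (q \<otimes> y) \<otimes> w = s \<otimes> w \<otimes> (x \<otimes> y)"
        unfolding p(3) using pq c by algebra
      ultimately show "s \<otimes> w \<in> colon R (F (a + b + Suc k)) {x \<otimes> y}"
        using pq p(3) by (auto simp: colon_def)
    qed (use c in auto)
    ultimately have "z \<in> carrier R" "z \<otimes> (x \<otimes> y) \<in> F (a + b + Suc k)" by (auto simp: colon_def)
    then show ?case using c m_comm by simp
  qed
  from this[of 0 0 "N + M" \<one> \<one>] have "z \<in> F (N + M)" if "z \<in> ideal_pow R ?C (N + M)" for z
    using that ideal_carr[OF pow_ideal[OF C]] by force
  then show ?thesis unfolding nil_ideal_def by blast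
qed

lemma nil_ideal_principal:
  assumes F: "family F" and y: "y \<in> carrier R" "y [^] N \<in> F N"
  shows "nil_ideal F (PIdl y)"
proof -
  have "ideal_pow R (PIdl y) k \<subseteq> PIdl (y [^] k)" for k :: nat
  proof (induct k)
    case 0
    show ?case by (auto simp: cgenideal_def intro!: exI)
  next
    case (Suc k)
    have "(PIdl y) \<cdot> ideal_pow R (PIdl y) k \<subseteq> PIdl (y [^] Suc k)"
    proof (rule prod_least[OF cgenideal_ideal])
      fix a b assume "a \<in> PIdl y" "b \<in> ideal_pow R (PIdl y) k"
      then obtain r s where r: "r \<in> carrier R" "s \<in> carrier R" "a = r \<otimes> y" "b = s \<otimes> y [^] k"
        using Suc unfolding cgenideal_def by blast
      then have "a \<otimes> b = (r \<otimes> s) \<otimes> y [^] Suc k" using y(1) by (simp add: m_ac)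
      then show "a \<otimes> b \<in> PIdl (y [^] Suc k)" using r unfolding cgenideal_def by blast
    qed (use y in simp)
    then show ?case by simp
  qed
  then show ?thesis
    unfolding nil_ideal_def using cgenideal_minimal[OF family_ideal[OF F] y(2)] by (meson order_trans)
qed

text \<open>The argument that irreducible ideals are primary, for the degree-one element
  \<open>y t\<close> of the Rees algebra. The colon ideals by its powers become stationary at some
  \<open>N\<close>. Then \<open>F\<close> is the intersection of the colon by \<open>(y t)^N\<close>
  and the sum of \<open>F\<close> with the ideal of \<open>(y t)^N\<close>. Irreducibility makes one
  of the two equal to \<open>F\<close>: the first makes multiplication by \<open>y\<close> injective
  modulo \<open>F\<close>, the second puts \<open>y^N\<close> into \<open>F N\<close>.\<close>

lemma family_irreducible:
  assumes F: "family F" and y: "y \<in> \<mm>"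
    and irr: "\<And>F1 F2. \<lbrakk>family F1; family F2; \<And>n. F n \<subseteq> F1 n; \<And>n. F n \<subseteq> F2 n;
      \<And>n. F1 n \<inter> F2 n \<subseteq> F n\<rbrakk> \<Longrightarrow> F1 = F \<or> F2 = F"
  shows "(\<forall>k. \<forall>v\<in>\<pp> k. y \<otimes> v \<in> F (Suc k) \<longrightarrow> v \<in> F k) \<or> (\<exists>N. y [^] (N::nat) \<in> F N)"
proof -
  have yc: "y \<in> carrier R" using y mm_carr by blast
  have yp: "y [^] i \<in> \<pp> i" for i :: nat
    by (induct i) (use y pow_mult_mem[OF mm_ideal, of _ _ y "Suc 0"] pow_one[OF mm_ideal] in auto)
  have Fi: "ideal (F n) R" for n using family_ideal[OF F] .
  have Fm: "v \<otimes> y [^] i \<in> F (n + i)" if "v \<in> F n" for v n and i :: nat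
    using family_mult[OF F yp that] m_comm[of v "y [^] i"] ideal_carr[OF Fi that] yc by simp
  \<comment> \<open>In degree \<open>k\<close> this is the colon of \<open>F\<close> by
    \<open>(y t)^N\<close>; multiplication by \<open>(y t)^N\<close> raises the degree by
    \<open>N\<close>.\<close>
  define C where "C N k = {v \<in> \<pp> k. v \<otimes> y [^] N \<in> F (k + N)}" for N :: nat and k
  have ppc: "v \<in> carrier R" if "v \<in> \<pp> k" for v k using ideal_carr[OF pp_ideal that] .
  have C: "family (C N)" for N unfolding family_def
  proof (intro allI conjI)
    fix n
    have *: "C N n = \<pp> n \<inter> colon R (F (n + N)) {y [^] N}" unfolding C_def colon_def using ppc by (auto simp del: ideal_pow.simps)
    show i: "ideal (C N n) R" unfolding * using yc by (intro i_intersect pp_ideal colon_ideal Fi) auto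
    show "C N n \<subseteq> \<pp> n" unfolding C_def by blast
    show "\<mm> \<cdot> C N n \<subseteq> C N (Suc n)"
    proof (rule prod_least)
      have *: "C N (Suc n) = \<pp> (Suc n) \<inter> colon R (F (Suc n + N)) {y [^] N}"
        unfolding C_def colon_def using ppc by (auto simp del: ideal_pow.simps)
      show "ideal (C N (Suc n)) R" unfolding * using yc by (intro i_intersect pp_ideal colon_ideal Fi) auto
      fix a v assume a: "a \<in> \<mm>" and v: "v \<in> C N n"
      have "a \<otimes> v \<in> \<pp> (Suc n)" using a v by (auto simp: C_def intro: ideal_prod.prod)
      moreover have "a \<otimes> (v \<otimes> y [^] N) \<in> F (Suc (n + N))"
        using family_step[OF F] a v ideal_prod.prod[of a \<mm> "v \<otimes> y [^] N" "F (n + N)" R] by (auto simp: C_def)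
      ultimately show "a \<otimes> v \<in> C N (Suc n)"
        using a v ppc mm_carr yc by (auto simp: C_def m_assoc)
    qed
  qed
  have inc: "C N k \<subseteq> C (Suc N) k" for N k
  proof
    fix v assume v: "v \<in> C N k"
    then have "v \<otimes> y [^] N \<otimes> y [^] (1::nat) \<in> F (k + N + 1)" by (intro Fm[of _ "k + N" 1]) (simp add: C_def)
    then show "v \<in> C (Suc N) k" using v ppc yc by (auto simp: C_def m_assoc)
  qed
  obtain N where N: "C (Suc N) = C N" using family_chain_stable[of C, OF C inc] by blast
  have stab: "C (Suc (Suc M)) = C (Suc M)" if M: "C (Suc M) = C M" for M
  proof (intro ext subset_antisym inc)
    fix k
    show "C (Suc (Suc M)) k \<subseteq> C (Suc M) k"
    proof
      fix v assume v: "v \<in> C (Suc (Suc M)) k"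
      then have vp: "v \<in> \<pp> k" by (simp add: C_def)
      have vy: "y \<otimes> v \<in> \<pp> (Suc k)" using y vp by (auto intro: ideal_prod.prod)
      have "(y \<otimes> v) \<otimes> y [^] Suc M = v \<otimes> y [^] Suc (Suc M)" using ppc[OF vp] yc by (simp add: m_ac)
      then have "y \<otimes> v \<in> C (Suc M) (Suc k)" using v vy by (simp add: C_def)
      then have "(y \<otimes> v) \<otimes> y [^] M \<in> F (Suc k + M)" unfolding M by (simp add: C_def)
      moreover have "(y \<otimes> v) \<otimes> y [^] M = v \<otimes> y [^] Suc M" using ppc[OF vp] yc by (simp add: m_ac)
      ultimately show "v \<in> C (Suc M) k" using vp by (simp add: C_def)
    qed
  qed
  have "C (Suc (N + j)) = C (N + j)" for j
    by (induct j) (use N stab in simp_all)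
  then have CN: "C (N + j) = C N" for j
    by (induct j) simp_all
  \<comment> \<open>The homogeneous ideal generated by \<open>(y t)^N\<close>, which is zero in
    degrees below \<open>N\<close>.\<close>
  define E where "E k = (if N \<le> k then (\<lambda>r. r \<otimes> y [^] N) ` \<pp> (k - N) else {\<zero>})" for k
  have E: "ideal (E k) R" for k
  proof (cases "N \<le> k")
    case True
    have "ideal ((\<lambda>r. r \<otimes> y [^] N) ` \<pp> (k - N)) R"
    proof (rule cidealI)
      have "\<zero> = \<zero> \<otimes> y [^] N" using yc by simp
      then show "\<zero> \<in> (\<lambda>r. r \<otimes> y [^] N) ` \<pp> (k - N)" using ideal_zero_mem[OF pp_ideal] by blast
      fix a b assume "a \<in> (\<lambda>r. r \<otimes> y [^] N) ` \<pp> (k - N)" "b \<in> (\<lambda>r. r \<otimes> y [^] N) ` \<pp> (k - N)"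
      then obtain r s where r: "r \<in> \<pp> (k - N)" "s \<in> \<pp> (k - N)" "a = r \<otimes> y [^] N" "b = s \<otimes> y [^] N" by blast
      then have "a \<oplus> b = (r \<oplus> s) \<otimes> y [^] N" using ppc yc by (simp add: l_distr)
      then show "a \<oplus> b \<in> (\<lambda>r. r \<otimes> y [^] N) ` \<pp> (k - N)" using r ideal_add_mem[OF pp_ideal] by blast
    next
      fix a x assume "a \<in> (\<lambda>r. r \<otimes> y [^] N) ` \<pp> (k - N)" and x: "x \<in> carrier R"
      then obtain r where r: "r \<in> \<pp> (k - N)" "a = r \<otimes> y [^] N" by blast
      then have "x \<otimes> a = (x \<otimes> r) \<otimes> y [^] N" using ppc yc x by (simp add: m_assoc)
      then show "x \<otimes> a \<in> (\<lambda>r. r \<otimes> y [^] N) ` \<pp> (k - N)" using r x ideal_lmult_mem[OF pp_ideal] by blast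
    qed (use ppc yc in auto)
    then show ?thesis using True by (simp add: E_def)
  qed (use zeroideal in \<open>simp add: E_def\<close>)
  have Esub: "E k \<subseteq> \<pp> k" for k
    using pow_mult_mem[OF mm_ideal _ yp, of _ "k - N" N] ideal_zero_mem[OF pp_ideal] by (auto simp: E_def)
  have Estep: "a \<otimes> e \<in> E (Suc k)" if a: "a \<in> \<mm>" and e: "e \<in> E k" for a e k
  proof (cases "N \<le> k")
    case True
    then obtain r where r: "r \<in> \<pp> (k - N)" "e = r \<otimes> y [^] N" using e by (auto simp: E_def)
    have "a \<otimes> e = (a \<otimes> r) \<otimes> y [^] N" using r ppc yc mm_carr[OF a] by (simp add: m_assoc)
    moreover have "a \<otimes> r \<in> \<pp> (Suc k - N)" using a r True by (auto simp: Suc_diff_le intro: ideal_prod.prod)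
    ultimately show ?thesis using True by (auto simp: E_def)
  next
    case False
    then have "a \<otimes> e = \<zero>" using e mm_carr[OF a] by (simp add: E_def)
    then show ?thesis using ideal_zero_mem[OF E] by simp
  qed
  have FE: "family (\<lambda>k. F k <+>\<^bsub>R\<^esub> E k)" unfolding family_def
  proof (intro allI conjI)
    fix k
    show "ideal (F k <+>\<^bsub>R\<^esub> E k) R" using Fi E add_ideals by blast
    show "F k <+>\<^bsub>R\<^esub> E k \<subseteq> \<pp> k" using set_add_least[OF pp_ideal family_sub[OF F] Esub] .
    show "\<mm> \<cdot> (F k <+>\<^bsub>R\<^esub> E k) \<subseteq> F (Suc k) <+>\<^bsub>R\<^esub> E (Suc k)"
    proof (rule prod_least)
      show "ideal (F (Suc k) <+>\<^bsub>R\<^esub> E (Suc k)) R" using Fi E add_ideals by blast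
      fix a b assume a: "a \<in> \<mm>" and "b \<in> F k <+>\<^bsub>R\<^esub> E k"
      then obtain f e where f: "f \<in> F k" "e \<in> E k" "b = f \<oplus> e" by (auto elim: set_addE)
      have "a \<otimes> b = a \<otimes> f \<oplus> a \<otimes> e"
        using f(3) ideal_carr[OF Fi f(1)] ideal_carr[OF E f(2)] mm_carr[OF a] by (simp add: r_distr)
      moreover have "a \<otimes> f \<in> F (Suc k)"
        using family_step[OF F] a f(1) ideal_prod.prod[of a \<mm> f "F k" R] by blast
      ultimately show "a \<otimes> b \<in> F (Suc k) <+>\<^bsub>R\<^esub> E (Suc k)" using Estep[OF a f(2)] set_addI by simp
    qed
  qed
  have "C N = F \<or> (\<lambda>k. F k <+>\<^bsub>R\<^esub> E k) = F"
  proof (rule irr[OF C FE])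
    show "F n \<subseteq> C N n" for n using Fm family_sub[OF F, of n] by (auto simp: C_def)
    show "F n \<subseteq> F n <+>\<^bsub>R\<^esub> E n" for n using set_add_left[OF Fi E] .
    show "C N n \<inter> (F n <+>\<^bsub>R\<^esub> E n) \<subseteq> F n" for n
    proof
      fix w assume w: "w \<in> C N n \<inter> (F n <+>\<^bsub>R\<^esub> E n)"
      then obtain f e where f: "f \<in> F n" "e \<in> E n" "w = f \<oplus> e" by (auto elim: set_addE)
      have fc: "f \<in> carrier R" "e \<in> carrier R" using ideal_carr[OF Fi f(1)] ideal_carr[OF E f(2)] by auto
      have "e \<in> F n"
      proof (cases "N \<le> n")
        case True
        then obtain r where r: "r \<in> \<pp> (n - N)" "e = r \<otimes> y [^] N" using f(2) by (auto simp: E_def)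
        have "w \<otimes> y [^] N \<in> F (n + N)" using w by (simp add: C_def)
        moreover have "w \<otimes> y [^] N = f \<otimes> y [^] N \<oplus> e \<otimes> y [^] N" using f(3) fc yc by (simp add: l_distr)
        ultimately have "e \<otimes> y [^] N \<in> F (n + N)"
          using ideal_cancel_left[OF Fi, of "f \<otimes> y [^] N" "e \<otimes> y [^] N"] Fm[OF f(1)] fc yc by simp
        moreover have "e \<otimes> y [^] N = r \<otimes> y [^] (N + N)"
          using r ppc yc by (simp add: m_assoc nat_pow_mult)
        \<comment> \<open>Here stationarity is used from \<open>N\<close> to \<open>2N\<close>:
          \<open>e = r y^N\<close> and \<open>r y^(2N)\<close> lies in \<open>F\<close>, so
          \<open>r y^N\<close> already does.\<close>
        ultimately have "r \<in> C (N + N) (n - N)" using r(1) True by (simp add: C_def)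
        then have "r \<in> C N (n - N)" using CN by simp
        then show ?thesis using r(2) True by (simp add: C_def)
      qed (use f(2) ideal_zero_mem[OF Fi] in \<open>simp add: E_def\<close>)
      then show "w \<in> F n" using f(1,3) ideal_add_mem[OF Fi] by simp
    qed
  qed
  then show ?thesis
  proof
    assume CF: "C N = F"
    have "v \<in> F k" if v: "v \<in> \<pp> k" "y \<otimes> v \<in> F (Suc k)" for k v
    proof -
      have "v \<in> C (Suc 0) k" using v ppc yc m_comm by (simp add: C_def)
      also have "C (Suc 0) k \<subseteq> C (Suc N) k"
        using lift_Suc_mono_le[of "\<lambda>N. C N k" "Suc 0" "Suc N", OF inc] by simp
      finally show ?thesis using N CF by simp
    qed
    then show ?thesis by blast
  next
    assume FEF: "(\<lambda>k. F k <+>\<^bsub>R\<^esub> E k) = F"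
    have "y [^] N = \<one> \<otimes> y [^] N" using yc by simp
    then have "y [^] N \<in> E N" by (auto simp: E_def)
    then have "y [^] N \<in> F N" using FEF set_add_right[OF Fi E] by (metis subsetD)
    then show ?thesis by blast
  qed
qed

lemma lin_comb_mem_mm:
  assumes "\<And>i. i < n \<Longrightarrow> ys i \<in> \<mm>" "a \<in> coords R n" shows "lin_comb R n a ys \<in> \<mm>"
  unfolding lin_comb_lincomb using assms mm_carr mm_ideal
  by (intro lincomb_mem) (auto simp: coords_def intro: ideal_lmult_mem)

lemma mm_lin_comb:
  assumes "\<And>i. i < n \<Longrightarrow> ys i \<in> \<mm>" "Idl (ys ` {..<n}) = \<mm>" "x \<in> \<mm>"
  shows "\<exists>a\<in>coords R n. x = lin_comb R n a ys"
  using assms genideal_lincomb[of "{..<n}" ys] mm_carr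
  unfolding lin_comb_lincomb coords_def by auto

lemma generic_True: "generic R n (\<lambda>a. True)"
  unfolding generic_def
  by (intro exI[of _ "\<lambda>a. \<one>"])
    (auto simp: polyfun_const one_notin_mm coords_def intro!: exI[of _ "\<lambda>i. \<one>"])

text \<open>A general degree-one element is injective modulo \<open>F\<close> up to torsion for the
  irrelevant ideal, by Noetherian induction on \<open>F\<close>. If \<open>F\<close> is the
  intersection of two larger families, the two open sets and the two exponents are combined.
  Otherwise every degree-one element is either injective or nilpotent modulo \<open>F\<close>, and
  the nilpotent ones form an ideal \<open>P\<close>. If \<open>P\<close> is all of
  \<open>\<mm>\<close>, some \<open>\<mm>^t\<close> lies in \<open>F t\<close> and everything is
  torsion. If not, a general element lies outside \<open>P\<close>.\<close>

lemma generic_avoid: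
  assumes inf: "residue_field_infinite R"
    and ys: "\<And>i. i < n \<Longrightarrow> ys i \<in> \<mm>" "Idl (ys ` {..<n}) = \<mm>" and F: "family F"
  shows "generic R n (\<lambda>a. \<forall>k. \<forall>v\<in>\<pp> k. lin_comb R n a ys \<otimes> v \<in> F (Suc k) \<longrightarrow>
    (\<exists>t. \<forall>w\<in>\<pp> t. w \<otimes> v \<in> F (k + t)))"
  using F
proof (induct rule: family_induct)
  case (step F)
  note F = step(1)
  have Fm: "\<And>i n a h. \<lbrakk>a \<in> \<pp> i; h \<in> F n\<rbrakk> \<Longrightarrow> a \<otimes> h \<in> F (n + i)" if "family F" for F
    using family_mult[OF that] .
  have ppc: "v \<in> carrier R" if "v \<in> \<pp> k" for v k using ideal_carr[OF pp_ideal that] .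
  show ?case
  proof (cases "\<exists>F1 F2. family F1 \<and> family F2 \<and> (\<forall>n. F n \<subseteq> F1 n) \<and> (\<forall>n. F n \<subseteq> F2 n)
      \<and> (\<forall>n. F1 n \<inter> F2 n \<subseteq> F n) \<and> F1 \<noteq> F \<and> F2 \<noteq> F")
    case True
    then obtain F1 F2 where F12: "family F1" "family F2" "\<And>n. F n \<subseteq> F1 n" "\<And>n. F n \<subseteq> F2 n"
      "\<And>n. F1 n \<inter> F2 n \<subseteq> F n" "F1 \<noteq> F" "F2 \<noteq> F" by blast
    show ?thesis
    proof (rule generic_mono[OF generic_conj[OF inf step(2)[OF F12(1,3,6)] step(2)[OF F12(2,4,7)]]], intro allI ballI impI)
      fix a k v
      assume H: "(\<forall>k. \<forall>v\<in>\<pp> k. lin_comb R n a ys \<otimes> v \<in> F1 (Suc k) \<longrightarrow> (\<exists>t. \<forall>w\<in>\<pp> t. w \<otimes> v \<in> F1 (k + t))) \<and>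
        (\<forall>k. \<forall>v\<in>\<pp> k. lin_comb R n a ys \<otimes> v \<in> F2 (Suc k) \<longrightarrow> (\<exists>t. \<forall>w\<in>\<pp> t. w \<otimes> v \<in> F2 (k + t)))"
        and v: "v \<in> \<pp> k" and xv: "lin_comb R n a ys \<otimes> v \<in> F (Suc k)"
      obtain t1 where t1: "\<forall>w\<in>\<pp> t1. w \<otimes> v \<in> F1 (k + t1)" using H v xv F12(3) by blast
      obtain t2 where t2: "\<forall>w\<in>\<pp> t2. w \<otimes> v \<in> F2 (k + t2)" using H v xv F12(4) by blast
      have "w \<otimes> v \<in> F (k + max t1 t2)" if w: "w \<in> \<pp> (max t1 t2)" for w
        using colon_pow_up[of F1, OF family_ideal[OF F12(1)] Fm[OF F12(1)] ppc[OF v] t1 _ w]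
          colon_pow_up[of F2, OF family_ideal[OF F12(2)] Fm[OF F12(2)] ppc[OF v] t2 _ w] F12(5) by auto
      then show "\<exists>t. \<forall>w\<in>\<pp> t. w \<otimes> v \<in> F (k + t)" by blast
    qed
  next
    case False
    have alt: "(\<forall>k. \<forall>v\<in>\<pp> k. y \<otimes> v \<in> F (Suc k) \<longrightarrow> v \<in> F k) \<or> (\<exists>N. y [^] (N::nat) \<in> F N)"
      if "y \<in> \<mm>" for y
      by (rule family_irreducible[OF F that]) (use False in blast)
    define P where "P = {y \<in> \<mm>. nil_ideal F (PIdl y)}"
    have nilm: "PIdl y \<subseteq> \<mm>" "ideal (PIdl y) R" if "y \<in> \<mm>" for y
      using that cgenideal_minimal[OF mm_ideal that] cgenideal_ideal mm_carr by auto
    have P: "ideal P R"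
    proof (rule cidealI)
      show "P \<subseteq> carrier R" unfolding P_def using mm_carr by blast
      have "\<zero> [^] (Suc 0) \<in> F (Suc 0)" using ideal_zero_mem[OF family_ideal[OF F]] by simp
      then show "\<zero> \<in> P" using nil_ideal_principal[OF F zero_closed, of "Suc 0"] ideal_zero_mem[OF mm_ideal] by (simp add: P_def)
      fix y z assume y: "y \<in> P" and z: "z \<in> P"
      then have yz: "y \<in> \<mm>" "z \<in> \<mm>" by (auto simp: P_def)
      have S: "nil_ideal F (PIdl y <+>\<^bsub>R\<^esub> PIdl z)"
        using nil_ideal_add[OF F nilm(2,1)[OF yz(1)] nilm(2,1)[OF yz(2)]] y z by (simp add: P_def)
      have "y \<oplus> z \<in> PIdl y <+>\<^bsub>R\<^esub> PIdl z" using set_addI cgenideal_self yz mm_carr by blast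
      then have "PIdl (y \<oplus> z) \<subseteq> PIdl y <+>\<^bsub>R\<^esub> PIdl z"
        using cgenideal_minimal add_ideals nilm(2) yz by blast
      then show "y \<oplus> z \<in> P" using nil_ideal_sub[OF S] yz ideal_add_mem[OF mm_ideal] by (simp add: P_def)
    next
      fix y x assume y: "y \<in> P" and x: "x \<in> carrier R"
      then have ym: "y \<in> \<mm>" by (simp add: P_def)
      have "x \<otimes> y \<in> PIdl y" using x unfolding cgenideal_def by blast
      then have "PIdl (x \<otimes> y) \<subseteq> PIdl y" using cgenideal_minimal nilm(2)[OF ym] by blast
      then show "x \<otimes> y \<in> P"
        using nil_ideal_sub[of F "PIdl y"] y ideal_lmult_mem[OF mm_ideal ym x] by (simp add: P_def)
    qed
    \<comment> \<open>Adding \<open>\<mm>^2\<close> turns avoidance of \<open>P\<close> into a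
      condition on classes in \<open>\<mm> / \<mm>^2\<close>. No case is lost, since
      \<open>\<mm> \<subseteq> P + \<mm>^2\<close> forces \<open>\<mm> \<subseteq> P\<close> by
      Nakayama.\<close>
    define W where "W = P <+>\<^bsub>R\<^esub> \<mm> \<cdot> \<mm>"
    have mm2: "ideal (\<mm> \<cdot> \<mm>) R" using mm_ideal ideal_prod_is_ideal by blast
    have W: "ideal W R" unfolding W_def using add_ideals P mm2 by blast
    show ?thesis
    proof (cases "\<mm> \<subseteq> W")
      case True
      then have mP: "\<mm> \<subseteq> P" using nakayama[OF mm_ideal P] unfolding W_def by blast
      have "nil_ideal F (Idl S) \<and> Idl S \<subseteq> \<mm>" if "finite S" "S \<subseteq> P" for S
        using that
      proof (induct S)
        case empty
        have z: "Idl {} \<subseteq> {\<zero>}" by (rule genideal_minimal[OF zeroideal]) simp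
        have "PIdl \<zero> = {\<zero>}" unfolding cgenideal_def using zero_closed by force
        moreover have "nil_ideal F (PIdl \<zero>)" using ideal_zero_mem[OF P] by (simp add: P_def)
        ultimately show ?case using nil_ideal_sub[OF _ z] z ideal_zero_mem[OF mm_ideal] by auto
      next
        case (insert y S)
        then have IH: "nil_ideal F (Idl S)" "Idl S \<subseteq> \<mm>" by auto
        have ym: "y \<in> \<mm>" "nil_ideal F (PIdl y)" using insert by (auto simp: P_def)
        have Sc: "S \<subseteq> carrier R" using insert ideal_sub[OF P] by blast
        note iS = genideal_ideal[OF Sc]
        have 1: "nil_ideal F (PIdl y <+>\<^bsub>R\<^esub> Idl S)"
          by (rule nil_ideal_add[OF F nilm(2,1)[OF ym(1)] iS IH(2) ym(2) IH(1)])
        have 2: "Idl (insert y S) \<subseteq> PIdl y <+>\<^bsub>R\<^esub> Idl S"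
        proof (rule genideal_minimal[OF add_ideals[OF nilm(2)[OF ym(1)] iS]])
          show "insert y S \<subseteq> PIdl y <+>\<^bsub>R\<^esub> Idl S"
            using set_add_left[OF nilm(2)[OF ym(1)] iS] set_add_right[OF nilm(2)[OF ym(1)] iS]
              genideal_self[OF Sc] cgenideal_self[OF mm_carr[OF ym(1)]] by auto
        qed
        have 3: "PIdl y <+>\<^bsub>R\<^esub> Idl S \<subseteq> \<mm>" using set_add_least[OF mm_ideal nilm(1)[OF ym(1)] IH(2)] .
        show ?case using nil_ideal_sub[OF 1 2] 2 3 by auto
      qed
      from this[of "ys ` {..<n}"] have "nil_ideal F \<mm>" using ys mP by auto
      then obtain t where t: "\<pp> t \<subseteq> F t" unfolding nil_ideal_def by blast
      have "w \<otimes> v \<in> F (k + t)" if "v \<in> \<pp> k" "w \<in> \<pp> t" for v w k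
        using family_mult[OF F that(1), of w t] t that ppc m_comm[of v w] by (auto simp: add.commute)
      then show ?thesis by (intro generic_mono[OF generic_True]) blast
    next
      case False
      then obtain x where x: "x \<in> \<mm>" "x \<notin> W" by blast
      then obtain b where b: "b \<in> coords R n" "x = lin_comb R n b ys" using mm_lin_comb[OF ys] by blast
      have mW: "\<mm> \<cdot> \<mm> \<subseteq> W" unfolding W_def using set_add_right[OF P mm2] .
      \<comment> \<open>An element of \<open>\<mm>\<close> lies outside \<open>W\<close> exactly
        when multiplication by it sends no unit into \<open>W\<close>. Avoidance of \<open>W\<close>
        is thus generic injectivity on the one-dimensional space \<open>R / \<mm>\<close>.\<close>
      have "generic R n (\<lambda>a. \<forall>v\<in>carrier R. lin_comb R n a ys \<otimes> v \<in> W \<longrightarrow> v \<in> \<mm>)"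
      proof (rule generic_linear[OF oneideal mm_ideal W _ _ mW ys(1) b(1)])
        show "\<mm> \<cdot> carrier R \<subseteq> \<mm>" "\<mm> \<cdot> (\<mm> \<cdot> carrier R) \<subseteq> W" using ideal_prod_one[OF mm_ideal] mW by auto
        fix v assume v: "v \<in> carrier R" "lin_comb R n b ys \<otimes> v \<in> W"
        then have "v \<otimes> x \<in> W" using b(2) m_comm[OF v(1) mm_carr[OF x(1)]] by simp
        then show "v \<in> \<mm>" using unit_cancel_mem[OF W v(1) _ mm_carr[OF x(1)]] x(2) by blast
      qed
      then show ?thesis
      proof (rule generic_mono, intro allI ballI impI)
        fix a k v
        assume a: "a \<in> coords R n" and H: "\<forall>v\<in>carrier R. lin_comb R n a ys \<otimes> v \<in> W \<longrightarrow> v \<in> \<mm>"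
          and v: "v \<in> \<pp> k" "lin_comb R n a ys \<otimes> v \<in> F (Suc k)"
        define z where "z = lin_comb R n a ys"
        have z: "z \<in> \<mm>" unfolding z_def using lin_comb_mem_mm[OF ys(1) a] .
        have "z \<notin> W" using bspec[OF H one_closed] one_notin_mm mm_carr[OF z] unfolding z_def by auto
        then have "\<not> nil_ideal F (PIdl z)" using z set_add_left[OF P mm2] unfolding W_def P_def by blast
        then have "v \<in> F k" using alt[OF z] nil_ideal_principal[OF F mm_carr[OF z]] v unfolding z_def by blast
        then have "\<forall>w\<in>\<pp> 0. w \<otimes> v \<in> F (k + 0)" using ideal_lmult_mem[OF family_ideal[OF F]] by simp
        then show "\<exists>t. \<forall>w\<in>\<pp> t. w \<otimes> v \<in> F (k + t)" by blast
      qed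
    qed
  qed
qed

section \<open>Asymptotic colon formulas\<close>

declare ideal_pow.simps(2) [simp del]

abbreviation J_seq where "J_seq B K n \<equiv> B <+>\<^bsub>R\<^esub> K \<cdot> \<pp> n"

lemma J_seq_ideal: "\<lbrakk>ideal B R; ideal K R\<rbrakk> \<Longrightarrow> ideal (J_seq B K n) R"
  using add_ideals ideal_prod_is_ideal pp_ideal by blast

lemma Kp_ideal: "ideal K R \<Longrightarrow> ideal (K \<cdot> \<pp> n) R"
  using ideal_prod_is_ideal pp_ideal by blast

lemma Kp_sub: "ideal K R \<Longrightarrow> K \<cdot> \<pp> n \<subseteq> \<pp> n" "ideal K R \<Longrightarrow> K \<cdot> \<pp> n \<subseteq> K"
  using ideal_prod_inter[of K "\<pp> n"] pp_ideal by blast+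

lemma Kp_in_J: "\<lbrakk>ideal B R; ideal K R\<rbrakk> \<Longrightarrow> K \<cdot> \<pp> n \<subseteq> J_seq B K n"
  using set_add_right Kp_ideal by blast

lemma B_in_J: "\<lbrakk>ideal B R; ideal K R\<rbrakk> \<Longrightarrow> B \<subseteq> J_seq B K n"
  using set_add_left Kp_ideal by blast

lemma J_seq_antimono: "i \<le> j \<Longrightarrow> J_seq B K j \<subseteq> J_seq B K i"
  by (rule set_add_mono[OF subset_refl pow_prod_antimono[OF mm_ideal]])

lemma J_seq_mult:
  assumes "ideal B R" "ideal K R" "a \<in> \<pp> i" "h \<in> J_seq B K n"
  shows "a \<otimes> h \<in> J_seq B K (n + i)"
proof -
  obtain b k where b: "b \<in> B" "k \<in> K \<cdot> \<pp> n" "h = b \<oplus> k" using assms(4) by (auto elim: set_addE)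
  have c: "b \<in> carrier R" "k \<in> carrier R" "a \<in> carrier R"
    using ideal_carr[OF assms(1) b(1)] ideal_carr[OF Kp_ideal[OF assms(2)] b(2)] ideal_carr[OF pp_ideal assms(3)] by auto
  have "a \<otimes> k \<in> K \<cdot> \<pp> (n + i)"
    using pow_prod_mult[OF mm_ideal assms(2,3) b(2)] by (simp add: add.commute)
  moreover have "a \<otimes> b \<in> B" using ideal_lmult_mem[OF assms(1) b(1) c(3)] .
  ultimately have "a \<otimes> b \<oplus> a \<otimes> k \<in> J_seq B K (n + i)" by (intro set_addI)
  then show ?thesis using b(3) c by (simp add: r_distr)
qed

lemma mm_pp_one: "y \<in> \<mm> \<longleftrightarrow> y \<in> \<pp> 1"
  using pow_one[OF mm_ideal] by simp

text \<open>Concerns torsion in the graded module with components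
  \<open>(B + K\<mm>^n) / (B + K\<mm>^(n+1))\<close>: an element of \<open>K\<mm>^n\<close> whose
  multiples by \<open>\<mm>^t\<close> all drop one step deeper than expected. Such elements form a
  family \<open>G\<close>, generated in degrees up to some \<open>c\<close>. One exponent
  annihilates the whole of \<open>G c\<close>, so the torsion vanishes in all sufficiently high
  degrees.\<close>

lemma stable_superficial:
  assumes B: "ideal B R" and K: "ideal K R"
  shows "\<exists>n1. \<forall>n\<ge>n1. \<forall>v\<in>K \<cdot> \<pp> n. \<forall>t. (\<forall>w\<in>\<pp> t. w \<otimes> v \<in> J_seq B K (n + t + 1)) \<longrightarrow> v \<in> J_seq B K (n + 1)"
proof -
  define H where "H = J_seq B K"
  have Hi: "ideal (H n) R" for n unfolding H_def using J_seq_ideal[OF B K] .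
  have Hm: "a \<otimes> h \<in> H (n + i)" if "a \<in> \<pp> i" "h \<in> H n" for a h i n
    using J_seq_mult[OF B K that(1)] that(2) unfolding H_def by blast
  define U where "U n t = {v \<in> K \<cdot> \<pp> n. \<forall>w\<in>\<pp> t. w \<otimes> v \<in> H (n + 1 + t)}" for n t
  have Kc: "v \<in> carrier R" if "v \<in> K \<cdot> \<pp> n" for v n using ideal_carr[OF Kp_ideal[OF K] that] .
  have ppc: "v \<in> carrier R" if "v \<in> \<pp> n" for v n using ideal_carr[OF pp_ideal that] .
  have U: "ideal (U n t) R" for n t
  proof -
    have "U n t = K \<cdot> \<pp> n \<inter> colon R (H (n + 1 + t)) (\<pp> t)"
    proof (rule Set.set_eqI)
      fix v
      show "v \<in> U n t \<longleftrightarrow> v \<in> K \<cdot> \<pp> n \<inter> colon R (H (n + 1 + t)) (\<pp> t)"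
      proof (cases "v \<in> K \<cdot> \<pp> n")
        case True
        have "w \<otimes> v = v \<otimes> w" if "w \<in> \<pp> t" for w using m_comm[OF ppc[OF that] Kc[OF True]] .
        then show ?thesis using True Kc[OF True] by (simp add: U_def colon_def)
      qed (simp add: U_def)
    qed
    then show ?thesis using i_intersect[OF Kp_ideal[OF K] colon_ideal[OF Hi ideal_sub[OF pp_ideal]]] by simp
  qed
  have Umono: "U n t \<subseteq> U n t'" if tt: "t \<le> t'" for n t t'
  proof
    fix v assume "v \<in> U n t"
    then have vK: "v \<in> K \<cdot> \<pp> n" and vt: "\<forall>w\<in>\<pp> t. w \<otimes> v \<in> H (n + 1 + t)" unfolding U_def by blast+
    have "w \<otimes> v \<in> H (n + 1 + t')" if "w \<in> \<pp> t'" for w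
      by (rule colon_pow_up[of H, OF Hi Hm Kc[OF vK] vt tt that])
    then show "v \<in> U n t'" using vK unfolding U_def by blast
  qed
  define G where "G n = (\<Union>t. U n t)" for n
  have "\<exists>T. G n = U n T" for n
  proof -
    obtain T where T: "\<forall>t\<ge>T. U n t = U n T"
      using ideal_chain_stable[of "U n", OF U Umono[OF le_SucI[OF order_refl]]] by blast
    have "U n t \<subseteq> U n T" for t
      using Umono[of t "max t T" n] T by (metis max.cobounded1 max.cobounded2)
    then show ?thesis unfolding G_def by blast
  qed
  then obtain T where T: "\<And>n. G n = U n (T n)" by metis
  have G: "family G" unfolding family_def
  proof (intro allI conjI)
    fix n
    show i: "ideal (G n) R" for n using T U by simp
    show "G n \<subseteq> \<pp> n" using Kp_sub[OF K] unfolding G_def U_def by blast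
    show "\<mm> \<cdot> G n \<subseteq> G (Suc n)"
    proof (rule prod_least[OF i])
      fix a v assume a: "a \<in> \<mm>" and v: "v \<in> G n"
      have vK: "v \<in> K \<cdot> \<pp> n" and vt: "\<forall>w\<in>\<pp> (T n). w \<otimes> v \<in> H (n + 1 + T n)" using v T[of n] unfolding U_def by auto
      have "a \<otimes> v \<in> K \<cdot> \<pp> (Suc n)" using pow_prod_mult[OF mm_ideal K, of a 1 v n] a vK mm_pp_one by simp
      moreover have "w \<otimes> (a \<otimes> v) \<in> H (Suc n + 1 + T n)" if w: "w \<in> \<pp> (T n)" for w
      proof -
        have "a \<otimes> (w \<otimes> v) \<in> H (n + 1 + T n + 1)" using Hm[of a 1] a mm_pp_one vt w by blast
        moreover have "a \<otimes> (w \<otimes> v) = w \<otimes> (a \<otimes> v)" using mm_carr[OF a] Kc[OF vK] ppc[OF w] by (simp add: m_lcomm)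
        ultimately show ?thesis by simp
      qed
      ultimately show "a \<otimes> v \<in> G (Suc n)" unfolding G_def U_def by blast
    qed
  qed
  obtain c where c: "\<And>j. G (c + j) \<subseteq> \<pp> j \<cdot> G c" using family_eventually_pow[OF G] by blast
  \<comment> \<open>The exponent \<open>T c\<close> annihilates all torsion of degree
    \<open>c\<close>. From degree \<open>c + T c\<close> on, torsion elements lie in
    \<open>\<mm>^j G c\<close> with \<open>j \<ge> T c\<close>, so the factor from
    \<open>\<mm>^j\<close> already performs the annihilation.\<close>
  have "v \<in> H (n + 1)" if n: "n \<ge> c + T c" and v: "v \<in> K \<cdot> \<pp> n" and vt: "\<forall>w\<in>\<pp> t. w \<otimes> v \<in> H (n + t + 1)" for n v t
  proof -
    define j where "j = n - c"
    have nj: "n = c + j" "T c \<le> j" using n by (auto simp: j_def)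
    have "v \<in> G n" using v vt unfolding G_def U_def by auto
    then have "v \<in> \<pp> j \<cdot> G c" using c nj by blast
    moreover have "\<pp> j \<cdot> G c \<subseteq> H (c + 1 + j)"
    proof (rule prod_least[OF Hi])
      fix a g assume "a \<in> \<pp> j" "g \<in> G c"
      then show "a \<otimes> g \<in> H (c + 1 + j)" using T[of c] Umono[OF nj(2), of c] unfolding U_def by blast
    qed
    ultimately show ?thesis using nj by auto
  qed
  then show ?thesis unfolding H_def by blast
qed

text \<open>If \<open>a + s = b + t\<close> with \<open>s\<close> and \<open>t\<close> in a high
  power of \<open>\<mm>\<close>, then \<open>a - b\<close> is deep in \<open>A + B\<close>, and
  Artin-Rees writes it as \<open>x + y\<close> with \<open>x \<in> \<mm>^q A\<close> and
  \<open>y \<in> \<mm>^q B\<close>. The corrected element \<open>a - x = b + y\<close> lies in the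
  intersection.\<close>

lemma approx_intersection:
  assumes A: "ideal A R" and B: "ideal B R"
  shows "\<exists>q'. (A <+>\<^bsub>R\<^esub> \<pp> q') \<inter> (B <+>\<^bsub>R\<^esub> \<pp> q') \<subseteq> (A \<inter> B) <+>\<^bsub>R\<^esub> \<pp> q"
proof -
  have AB: "ideal (A <+>\<^bsub>R\<^esub> B) R" using add_ideals[OF A B] .
  obtain q0 where q0: "\<And>q'. q' \<ge> q0 \<Longrightarrow> (A <+>\<^bsub>R\<^esub> B) \<inter> \<pp> q' \<subseteq> \<pp> q \<cdot> (A <+>\<^bsub>R\<^esub> B)"
    using artin_rees[OF AB] by blast
  define q' where "q' = max q0 q"
  have "r \<in> (A \<inter> B) <+>\<^bsub>R\<^esub> \<pp> q" if rA: "r \<in> A <+>\<^bsub>R\<^esub> \<pp> q'" and rB: "r \<in> B <+>\<^bsub>R\<^esub> \<pp> q'" for r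
  proof -
    obtain a s where a: "a \<in> A" "s \<in> \<pp> q'" "r = a \<oplus> s" using rA by (auto elim: set_addE)
    obtain b t where b: "b \<in> B" "t \<in> \<pp> q'" "r = b \<oplus> t" using rB by (auto elim: set_addE)
    have c: "a \<in> carrier R" "s \<in> carrier R" "b \<in> carrier R" "t \<in> carrier R"
      using ideal_carr[OF A a(1)] ideal_carr[OF pp_ideal a(2)] ideal_carr[OF B b(1)] ideal_carr[OF pp_ideal b(2)] by auto
    have ab: "a \<oplus> s = b \<oplus> t" using a b by simp
    have "a \<ominus> b = (a \<oplus> s) \<ominus> b \<ominus> s" using c by algebra
    also have "\<dots> = t \<ominus> s" unfolding ab using c by algebra
    finally have "a \<ominus> b \<in> \<pp> q'" using ideal_diff_mem[OF pp_ideal b(2) a(2)] by simp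
    moreover have "a \<oplus> (\<ominus> b) \<in> A <+>\<^bsub>R\<^esub> B" using a b ideal_neg_mem[OF B] by (intro set_addI) auto
    ultimately have "a \<ominus> b \<in> \<pp> q \<cdot> (A <+>\<^bsub>R\<^esub> B)" using q0[of q'] by (auto simp: q'_def a_minus_def)
    also have "\<dots> = \<pp> q \<cdot> A <+>\<^bsub>R\<^esub> \<pp> q \<cdot> B" using ideal_prod_r_distr[OF pp_ideal A B] .
    finally obtain x y where x: "x \<in> \<pp> q \<cdot> A" "y \<in> \<pp> q \<cdot> B" "a \<ominus> b = x \<oplus> y" by (auto elim: set_addE)
    have xA: "x \<in> A" "x \<in> \<pp> q" using x(1) ideal_prod_inter[OF pp_ideal A] by auto
    have yB: "y \<in> B" using x(2) ideal_prod_inter[OF pp_ideal B] by auto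
    have cx: "x \<in> carrier R" "y \<in> carrier R" using ideal_carr[OF A xA(1)] ideal_carr[OF B yB] by auto
    have "a \<ominus> x = (a \<ominus> b) \<oplus> b \<ominus> x" using c cx by algebra
    also have "\<dots> = b \<oplus> y" unfolding x(3) using c cx by algebra
    finally have "a \<ominus> x \<in> A \<inter> B"
      using ideal_diff_mem[OF A a(1) xA(1)] ideal_add_mem[OF B b(1) yB] by simp
    moreover have "x \<oplus> s \<in> \<pp> q"
      using ideal_add_mem[OF pp_ideal xA(2)] a(2) pow_antimono[OF mm_ideal, of q q'] by (auto simp: q'_def)
    moreover have "r = (a \<ominus> x) \<oplus> (x \<oplus> s)" unfolding a(3) using c cx by algebra
    ultimately show ?thesis using set_addI by blast
  qed
  then show ?thesis by blast
qed

text \<open>The error \<open>s\<close> in \<open>r y = b + s\<close> lies in \<open>(y) + B\<close>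
  and in \<open>\<mm>^n\<close>, so Artin-Rees gives \<open>s = p y + z\<close> with
  \<open>p \<in> \<mm>^q\<close> and \<open>z \<in> B\<close>. Then \<open>r - p\<close> multiplies
  \<open>y\<close> into \<open>B\<close>.\<close>

lemma approx_colon_elt:
  assumes B: "ideal B R" and y: "y \<in> carrier R"
  shows "\<exists>n0. \<forall>n\<ge>n0. \<forall>r\<in>carrier R. r \<otimes> y \<in> B <+>\<^bsub>R\<^esub> \<pp> n \<longrightarrow> r \<in> colon R B {y} <+>\<^bsub>R\<^esub> \<pp> q"
proof -
  have P: "ideal (PIdl y) R" using cgenideal_ideal[OF y] .
  have L: "ideal (PIdl y <+>\<^bsub>R\<^esub> B) R" using add_ideals[OF P B] .
  obtain n0 where n0: "\<And>n. n \<ge> n0 \<Longrightarrow> (PIdl y <+>\<^bsub>R\<^esub> B) \<inter> \<pp> n \<subseteq> \<pp> q \<cdot> (PIdl y <+>\<^bsub>R\<^esub> B)"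
    using artin_rees[OF L] by blast
  have "r \<in> colon R B {y} <+>\<^bsub>R\<^esub> \<pp> q" if n: "n \<ge> n0" and r: "r \<in> carrier R" "r \<otimes> y \<in> B <+>\<^bsub>R\<^esub> \<pp> n" for n r
  proof -
    obtain b s where b: "b \<in> B" "s \<in> \<pp> n" "r \<otimes> y = b \<oplus> s" using r(2) by (auto elim: set_addE)
    have c: "b \<in> carrier R" "s \<in> carrier R" using ideal_carr[OF B b(1)] ideal_carr[OF pp_ideal b(2)] by auto
    have "s = (b \<oplus> s) \<oplus> (\<ominus> b)" using c by algebra
    then have "s = r \<otimes> y \<oplus> (\<ominus> b)" using b(3) by simp
    moreover have "r \<otimes> y \<in> PIdl y" using r unfolding cgenideal_def by blast
    ultimately have "s \<in> PIdl y <+>\<^bsub>R\<^esub> B" using set_addI[OF _ ideal_neg_mem[OF B b(1)]] by metis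
    then have "s \<in> \<pp> q \<cdot> (PIdl y <+>\<^bsub>R\<^esub> B)" using n0[OF n] b(2) by blast
    also have "\<dots> = \<pp> q \<cdot> (PIdl y) <+>\<^bsub>R\<^esub> \<pp> q \<cdot> B" using ideal_prod_r_distr[OF pp_ideal P B] .
    finally obtain x z where x: "x \<in> \<pp> q \<cdot> (PIdl y)" "z \<in> \<pp> q \<cdot> B" "s = x \<oplus> z" by (auto elim: set_addE)
    have zB: "z \<in> B" using x(2) ideal_prod_inter[OF pp_ideal B] by auto
    have "\<exists>p\<in>\<pp> q. x = p \<otimes> y" using x(1)
    proof (induct x rule: ideal_prod.induct)
      case (prod i j)
      then obtain t where t: "t \<in> carrier R" "j = t \<otimes> y" unfolding cgenideal_def by blast
      then have "i \<otimes> j = (i \<otimes> t) \<otimes> y" using prod(1) y ideal_carr[OF pp_ideal] by (simp add: m_assoc)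
      then show ?case using ideal_rmult_mem[OF pp_ideal prod(1) t(1)] by blast
    next
      case (sum s1 s2)
      then obtain p1 p2 where p: "p1 \<in> \<pp> q" "p2 \<in> \<pp> q" "s1 = p1 \<otimes> y" "s2 = p2 \<otimes> y" by blast
      then have "s1 \<oplus> s2 = (p1 \<oplus> p2) \<otimes> y" using y ideal_carr[OF pp_ideal] by (simp add: l_distr)
      then show ?case using ideal_add_mem[OF pp_ideal p(1,2)] by blast
    qed
    then obtain p where p: "p \<in> \<pp> q" "x = p \<otimes> y" by blast
    have pc: "p \<in> carrier R" "z \<in> carrier R" using ideal_carr[OF pp_ideal p(1)] ideal_carr[OF B zB] by auto
    have "(r \<ominus> p) \<otimes> y = r \<otimes> y \<ominus> p \<otimes> y" using r pc y by algebra
    also have "\<dots> = b \<oplus> (p \<otimes> y \<oplus> z) \<ominus> p \<otimes> y" using b(3) x(3) p(2) by simp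
    also have "\<dots> = b \<oplus> z" using c pc y by algebra
    finally have "(r \<ominus> p) \<otimes> y \<in> B" using ideal_add_mem[OF B b(1) zB] by simp
    then have "r \<ominus> p \<in> colon R B {y}" using r pc by (simp add: colon_def)
    moreover have "r = (r \<ominus> p) \<oplus> p" using r pc by algebra
    ultimately show ?thesis using set_addI p(1) by metis
  qed
  then show ?thesis by blast
qed

text \<open>The colon by a finite set is the intersection of the colons by its elements. The
  precision \<open>q'\<close> demanded of each of them comes from
  \<open>approx_intersection\<close>, hence the generalization over \<open>q\<close> in the
  induction.\<close>

lemma approx_colon:
  assumes B: "ideal B R" and Y: "finite Y" "Y \<subseteq> carrier R"
  shows "\<exists>n0. \<forall>n\<ge>n0. \<forall>r\<in>carrier R. (\<forall>y\<in>Y. r \<otimes> y \<in> B <+>\<^bsub>R\<^esub> \<pp> n) \<longrightarrow> r \<in> colon R B Y <+>\<^bsub>R\<^esub> \<pp> q"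
  using Y
proof (induct Y arbitrary: q)
  case empty
  have "colon R B {} = carrier R" by (auto simp: colon_def)
  then show ?case using set_add_left[OF oneideal pp_ideal] by auto
next
  case (insert y Y)
  have c: "ideal (colon R B {y}) R" "ideal (colon R B Y) R" using insert.prems by (auto intro!: colon_ideal B)
  obtain q' where q': "(colon R B {y} <+>\<^bsub>R\<^esub> \<pp> q') \<inter> (colon R B Y <+>\<^bsub>R\<^esub> \<pp> q') \<subseteq> (colon R B {y} \<inter> colon R B Y) <+>\<^bsub>R\<^esub> \<pp> q"
    using approx_intersection[OF c] by blast
  have eq: "colon R B {y} \<inter> colon R B Y = colon R B (insert y Y)" by (auto simp: colon_def)
  obtain n1 where n1: "\<And>n r. \<lbrakk>n \<ge> n1; r \<in> carrier R; r \<otimes> y \<in> B <+>\<^bsub>R\<^esub> \<pp> n\<rbrakk> \<Longrightarrow> r \<in> colon R B {y} <+>\<^bsub>R\<^esub> \<pp> q'"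
    using approx_colon_elt[OF B, of y q'] insert.prems by blast
  obtain n2 where n2: "\<And>n r. \<lbrakk>n \<ge> n2; r \<in> carrier R; \<forall>y\<in>Y. r \<otimes> y \<in> B <+>\<^bsub>R\<^esub> \<pp> n\<rbrakk> \<Longrightarrow> r \<in> colon R B Y <+>\<^bsub>R\<^esub> \<pp> q'"
    using insert.hyps(3)[of q'] insert.prems by blast
  have "r \<in> colon R B (insert y Y) <+>\<^bsub>R\<^esub> \<pp> q"
    if "n \<ge> max n1 n2" "r \<in> carrier R" "\<forall>y\<in>insert y Y. r \<otimes> y \<in> B <+>\<^bsub>R\<^esub> \<pp> n" for n r
  proof -
    have "r \<in> colon R B {y} <+>\<^bsub>R\<^esub> \<pp> q'" by (rule n1[of n]) (use that in auto)
    moreover have "r \<in> colon R B Y <+>\<^bsub>R\<^esub> \<pp> q'" by (rule n2[of n]) (use that in auto)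
    ultimately show ?thesis using q' eq by auto
  qed
  then show ?case by blast
qed

section \<open>Colon ideals by the maximal ideal\<close>

lemma colon_mm_generators:
  assumes "ideal B R" "Y \<subseteq> carrier R" "Idl Y = \<mm>"
  shows "colon R B Y = colon R B \<mm>"
proof
  show "colon R B \<mm> \<subseteq> colon R B Y" using genideal_self[OF assms(2)] assms(3) by (auto simp: colon_def)
  show "colon R B Y \<subseteq> colon R B \<mm>"
  proof
    fix r assume r: "r \<in> colon R B Y"
    then have rc: "r \<in> carrier R" by (simp add: colon_def)
    have "Y \<subseteq> colon R B {r}" using r assms(2) m_comm[OF _ rc] by (auto simp: colon_def)
    with colon_ideal[OF assms(1), of "{r}"] rc have "Idl Y \<subseteq> colon R B {r}"
      by (intro genideal_minimal) auto
    then have "\<mm> \<subseteq> colon R B {r}" unfolding assms(3) .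
    then show "r \<in> colon R B \<mm>" using rc m_comm[OF rc] mm_carr by (auto simp: colon_def)
  qed
qed

lemma colon_mm_ideal: "ideal B R \<Longrightarrow> ideal (colon R B \<mm>) R"
  using colon_ideal mm_sub by blast

lemma mm_colon: "ideal B R \<Longrightarrow> \<mm> \<cdot> colon R B \<mm> \<subseteq> B"
  using m_comm mm_carr by (intro prod_least) (auto simp: colon_def)

lemma sub_colon_mm: "ideal B R \<Longrightarrow> B \<subseteq> colon R B \<mm>"
  using ideal_carr ideal_rmult_mem mm_carr by (auto simp: colon_def)

lemma pow_Suc_colon:
  assumes "ideal B R" shows "\<pp> (Suc p) \<cdot> colon R B \<mm> \<subseteq> \<pp> p \<cdot> B"
proof -
  have "\<pp> (Suc p) = \<pp> p \<cdot> \<mm>"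
    using ideal_prod_commute[OF mm_ideal pp_ideal] by (simp add: ideal_pow.simps)
  then have "\<pp> (Suc p) \<cdot> colon R B \<mm> = \<pp> p \<cdot> (\<mm> \<cdot> colon R B \<mm>)"
    using ideal_prod_assoc[OF pp_ideal mm_ideal colon_mm_ideal[OF assms]] by simp
  also have "\<dots> \<subseteq> \<pp> p \<cdot> B" using mm_colon[OF assms] by (intro prod_mono) auto
  finally show ?thesis .
qed

text \<open>By Artin-Rees the deep elements of \<open>B : \<mm>\<close> lie in
  \<open>\<mm>(B : \<mm>) \<subseteq> B\<close>; in other words, the socle of \<open>R / B\<close>
  meets high powers of the maximal ideal trivially.\<close>

lemma colon_inter_pow:
  assumes B: "ideal B R"
  shows "\<exists>n0. \<forall>n\<ge>n0. colon R B \<mm> \<inter> \<pp> n \<subseteq> B"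
proof -
  obtain n0 where n0: "\<And>n. n \<ge> n0 \<Longrightarrow> colon R B \<mm> \<inter> \<pp> n \<subseteq> \<pp> 1 \<cdot> colon R B \<mm>"
    using artin_rees[OF colon_mm_ideal[OF B]] by blast
  have "\<pp> 1 \<cdot> colon R B \<mm> \<subseteq> B" using mm_colon[OF B] pow_one[OF mm_ideal] by simp
  then show ?thesis using n0 by blast
qed

text \<open>For \<open>r\<close> in the colon ideal, the Artin-Rees property first gives \<open>r \<in> (B : \<mm>) + K\<mm>^p\<close> for a fixed \<open>p\<close>;
  the exponent \<open>p\<close> is then raised step by step to \<open>n\<close> with \<open>stable_superficial\<close>.\<close>

theorem colon_asymptotic:
  assumes B: "ideal B R" and K: "ideal K R"
  shows "\<exists>n0. \<forall>n\<ge>n0. colon R (J_seq B K (Suc n)) \<mm> \<subseteq> J_seq (colon R B \<mm>) K n"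
proof -
  obtain n1 where n1: "\<And>n v t. \<lbrakk>n \<ge> n1; v \<in> K \<cdot> \<pp> n; \<forall>w\<in>\<pp> t. w \<otimes> v \<in> J_seq B K (n + t + 1)\<rbrakk> \<Longrightarrow> v \<in> J_seq B K (n + 1)"
    using stable_superficial[OF B K] by blast
  define L where "L = colon R (B <+>\<^bsub>R\<^esub> K) \<mm>"
  have BK: "ideal (B <+>\<^bsub>R\<^esub> K) R" using add_ideals[OF B K] .
  have L: "ideal L R" unfolding L_def using colon_mm_ideal[OF BK] .
  \<comment> \<open>The depth \<open>q\<close> is chosen so that elements of \<open>L\<close> in
    \<open>\<mm>^q\<close> lie in \<open>\<mm>^(n1+1) L \<subseteq> \<mm>^n1 (B + K)\<close>. This
    starts the induction at exponent \<open>n1\<close>, from which \<open>stable_superficial\<close>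
    applies.\<close>
  obtain q where q: "L \<inter> \<pp> q \<subseteq> \<pp> (Suc n1) \<cdot> L" using artin_rees[OF L] by blast
  obtain Y where Y: "Y \<subseteq> carrier R" "finite Y" "\<mm> = Idl Y" using finetely_gen[OF mm_ideal] by blast
  obtain n2 where n2: "\<And>n r. \<lbrakk>n \<ge> n2; r \<in> carrier R; \<forall>y\<in>Y. r \<otimes> y \<in> B <+>\<^bsub>R\<^esub> \<pp> n\<rbrakk> \<Longrightarrow> r \<in> colon R B Y <+>\<^bsub>R\<^esub> \<pp> q"
    using approx_colon[OF B Y(2,1), of q] by blast
  have colY: "colon R B Y = colon R B \<mm>" using colon_mm_generators[OF B Y(1)] Y(3) by simp
  have Ym: "Y \<subseteq> \<mm>" using genideal_self[OF Y(1)] Y(3) by simp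
  define C where "C = colon R B \<mm>"
  have C: "ideal C R" unfolding C_def by (rule colon_mm_ideal[OF B])
  have BC: "B \<subseteq> C" unfolding C_def by (rule sub_colon_mm[OF B])
  have Cm: "u \<otimes> y \<in> B" if "u \<in> C" "y \<in> \<mm>" for u y using that by (simp add: C_def colon_def)
  have Hi: "ideal (J_seq B K n) R" for n using J_seq_ideal[OF B K] .
  have "r \<in> J_seq C K n" if n: "n \<ge> max n1 n2" and r: "r \<in> colon R (J_seq B K (Suc n)) \<mm>" for n r
  proof -
    have rc: "r \<in> carrier R" and ry: "\<And>y. y \<in> \<mm> \<Longrightarrow> r \<otimes> y \<in> J_seq B K (Suc n)" using r by (auto simp: colon_def)
    have main: "r \<in> J_seq C K (n1 + j)" if "n1 + j \<le> n" for j
      using that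
    proof (induct j)
      case 0
      have "J_seq B K (Suc n) \<subseteq> B <+>\<^bsub>R\<^esub> \<pp> n"
        using Kp_sub(1)[OF K, of "Suc n"] pow_antimono[OF mm_ideal, of n "Suc n"]
        by (intro set_add_mono) auto
      then have "r \<in> colon R B Y <+>\<^bsub>R\<^esub> \<pp> q" using n2[of n r] n rc ry Ym by auto
      then obtain u s where u: "u \<in> C" "s \<in> \<pp> q" "r = u \<oplus> s" unfolding colY C_def by (auto elim: set_addE)
      have c: "u \<in> carrier R" "s \<in> carrier R" using ideal_carr[OF C u(1)] ideal_carr[OF pp_ideal u(2)] by auto
      have "s \<otimes> y \<in> B <+>\<^bsub>R\<^esub> K" if y: "y \<in> \<mm>" for y
      proof -
        have yc: "y \<in> carrier R" using y mm_carr by blast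
        have "r \<otimes> y \<in> B <+>\<^bsub>R\<^esub> K"
          using ry[OF y] Kp_sub(2)[OF K, of "Suc n"] set_add_mono[OF subset_refl] by blast
        moreover have "r \<otimes> y = u \<otimes> y \<oplus> s \<otimes> y" unfolding u(3) using c yc by (simp add: l_distr)
        moreover have "u \<otimes> y \<in> B <+>\<^bsub>R\<^esub> K" using Cm[OF u(1) y] set_add_left[OF B K] by blast
        ultimately show ?thesis using ideal_cancel_left[OF BK, of "u \<otimes> y" "s \<otimes> y"] c yc by simp
      qed
      then have "s \<in> L" unfolding L_def using c by (auto simp: colon_def)
      then have "s \<in> \<pp> n1 \<cdot> (B <+>\<^bsub>R\<^esub> K)" using q u(2) pow_Suc_colon[OF BK, of n1] unfolding L_def by blast
      also have "\<dots> = \<pp> n1 \<cdot> B <+>\<^bsub>R\<^esub> \<pp> n1 \<cdot> K" using ideal_prod_r_distr[OF pp_ideal B K] .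
      also have "\<dots> \<subseteq> J_seq C K n1"
        using ideal_prod_inter[OF pp_ideal B, of n1] BC ideal_prod_commute[OF pp_ideal K, of n1]
        by (intro set_add_mono) auto
      finally have "s \<in> J_seq C K n1" .
      moreover have "u \<in> J_seq C K n1" using u(1) B_in_J[OF C K] by blast
      ultimately show ?case using u(3) ideal_add_mem[OF J_seq_ideal[OF C K]] by simp
    next
      case (Suc j)
      then obtain u v where u: "u \<in> C" "v \<in> K \<cdot> \<pp> (n1 + j)" "r = u \<oplus> v" by (auto elim: set_addE)
      have c: "u \<in> carrier R" "v \<in> carrier R" using ideal_carr[OF C u(1)] ideal_carr[OF Kp_ideal[OF K] u(2)] by auto
      \<comment> \<open>Both \<open>r w\<close> and \<open>u w\<close> are known to lie in the
        deeper ideal, so \<open>v\<close> is moved one step deeper than expected by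
        \<open>\<mm>\<close>. It is therefore torsion with exponent \<open>t = 1\<close>.\<close>
      have "w \<otimes> v \<in> J_seq B K (n1 + j + 1 + 1)" if w: "w \<in> \<pp> 1" for w
      proof -
        have wm: "w \<in> \<mm>" using w mm_pp_one by simp
        have wc: "w \<in> carrier R" using mm_carr[OF wm] .
        have "r \<otimes> w \<in> J_seq B K (n1 + j + 1 + 1)"
          using ry[OF wm] J_seq_antimono[of "n1 + j + 1 + 1" "Suc n" B K] Suc.prems by auto
        moreover have "r \<otimes> w = u \<otimes> w \<oplus> v \<otimes> w" unfolding u(3) using c wc by (simp add: l_distr)
        moreover have "u \<otimes> w \<in> J_seq B K (n1 + j + 1 + 1)" using Cm[OF u(1) wm] B_in_J[OF B K] by blast
        ultimately have "v \<otimes> w \<in> J_seq B K (n1 + j + 1 + 1)"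
          using ideal_cancel_left[OF Hi, of "u \<otimes> w" "v \<otimes> w"] c wc by simp
        then show ?thesis using m_comm c wc by simp
      qed
      then have "v \<in> J_seq B K (n1 + j + 1)" using n1[OF _ u(2), of 1] by auto
      then have "v \<in> J_seq C K (n1 + Suc j)" using set_add_mono[OF BC subset_refl] by auto
      moreover have "u \<in> J_seq C K (n1 + Suc j)" using u(1) B_in_J[OF C K] by blast
      ultimately show ?case using u(3) ideal_add_mem[OF J_seq_ideal[OF C K]] by simp
    qed
    show ?thesis using main[of "n - n1"] n by simp
  qed
  then show ?thesis unfolding C_def by blast
qed

corollary colon_asymptotic_eq:
  assumes B: "ideal B R" and K: "ideal K R"
  shows "\<exists>n0. \<forall>n\<ge>n0. colon R (J_seq B K (Suc n)) \<mm> = J_seq (colon R B \<mm>) K n"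
proof -
  have "J_seq (colon R B \<mm>) K n \<subseteq> colon R (J_seq B K (Suc n)) \<mm>" for n
  proof (rule set_add_least[OF colon_mm_ideal[OF J_seq_ideal[OF B K]]])
    show "colon R B \<mm> \<subseteq> colon R (J_seq B K (Suc n)) \<mm>" using B_in_J[OF B K] by (auto simp: colon_def)
    show "K \<cdot> \<pp> n \<subseteq> colon R (J_seq B K (Suc n)) \<mm>"
    proof
      fix v assume v: "v \<in> K \<cdot> \<pp> n"
      have vc: "v \<in> carrier R" using ideal_carr[OF Kp_ideal[OF K] v] .
      have "v \<otimes> y \<in> J_seq B K (Suc n)" if y: "y \<in> \<mm>" for y
        using pow_prod_mult[OF mm_ideal K, of y 1 v n] v y mm_pp_one Kp_in_J[OF B K] m_comm[OF vc mm_carr[OF y]] by auto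
      then show "v \<in> colon R (J_seq B K (Suc n)) \<mm>" using vc by (auto simp: colon_def)
    qed
  qed
  then show ?thesis using colon_asymptotic[OF B K] by (meson subset_antisym)
qed

section \<open>The socle criterion\<close>

text \<open>With \<open>(A, B) = (\<mm>J, J)\<close> the existence of a good \<open>x \<in> \<mm>\<close> characterizes \<open>\<mm>\<close>-full ideals,
  with \<open>(A, B) = (J, J : \<mm>)\<close> full ideals.\<close>

definition good :: "'a set \<Rightarrow> 'a set \<Rightarrow> 'a \<Rightarrow> bool" where
  "good A B x \<longleftrightarrow> (\<forall>r\<in>colon R B \<mm>. x \<otimes> r \<in> A \<longrightarrow> r \<in> B)"

text \<open>\<open>generic_linear\<close> for \<open>V = B : \<mm>\<close>, \<open>W = B\<close> and
  \<open>Z = A\<close>.\<close>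

lemma generic_good:
  assumes A: "ideal A R" and B: "ideal B R" and BA: "\<mm> \<cdot> B \<subseteq> A"
    and ys: "\<And>i. i < n \<Longrightarrow> ys i \<in> \<mm>" "Idl (ys ` {..<n}) = \<mm>" and x: "x \<in> \<mm>" "good A B x"
  shows "generic R n (\<lambda>a. good A B (lin_comb R n a ys))"
proof -
  obtain b where b: "b \<in> coords R n" "x = lin_comb R n b ys" using mm_lin_comb[OF ys x(1)] by blast
  have 1: "\<mm> \<cdot> (\<mm> \<cdot> colon R B \<mm>) \<subseteq> A"
    using mm_colon[OF B] prod_mono[of \<mm> \<mm> "\<mm> \<cdot> colon R B \<mm>" B] BA by blast
  show ?thesis unfolding good_def
    by (rule generic_linear[OF colon_mm_ideal[OF B] B A mm_colon[OF B] 1 BA ys(1) b(1)])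
      (use x(2) b(2) in \<open>auto simp: good_def\<close>)
qed

text \<open>Turns a filtration into a homogeneous ideal of the Rees algebra. The shift
  \<open>j\<close> is 0 for a constant ideal, and 1 where a product has to be one step deeper than
  its degree suggests.\<close>

lemma family_inter_pow:
  assumes "\<And>n. ideal (H n) R" "\<And>i n a h. \<lbrakk>a \<in> \<pp> i; h \<in> H n\<rbrakk> \<Longrightarrow> a \<otimes> h \<in> H (n + i)"
  shows "family (\<lambda>n. H (n + j) \<inter> \<pp> n)"
  unfolding family_def
proof (intro allI conjI)
  fix n show "ideal (H (n + j) \<inter> \<pp> n) R" using assms(1) pp_ideal i_intersect by blast
  show "\<mm> \<cdot> (H (n + j) \<inter> \<pp> n) \<subseteq> H (Suc n + j) \<inter> \<pp> (Suc n)"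
  proof (rule prod_least)
    show "ideal (H (Suc n + j) \<inter> \<pp> (Suc n)) R" using assms(1) pp_ideal i_intersect by blast
    fix a b assume a: "a \<in> \<mm>" and b: "b \<in> H (n + j) \<inter> \<pp> n"
    have "a \<in> \<pp> 1" using a mm_pp_one by simp
    then have "a \<otimes> b \<in> H (n + j + 1)" "a \<otimes> b \<in> \<pp> (1 + n)"
      using assms(2)[of a 1 b "n + j"] pow_mult_mem[OF mm_ideal, of a 1 b n] b by blast+
    then show "a \<otimes> b \<in> H (Suc n + j) \<inter> \<pp> (Suc n)" by simp
  qed
qed blast

text \<open>From left to right any point of the open set gives a good element. Conversely, goodness
  is generic and is combined with avoidance for the family \<open>A \<inter> \<mm>^n\<close>. If
  \<open>x r \<in> A\<close>, avoidance yields a \<open>t\<close> with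
  \<open>\<mm>^t r \<subseteq> A\<close>, and goodness lowers the exponent step by step until
  \<open>r \<in> B\<close>. The other inclusion is
  \<open>x B \<subseteq> \<mm>B \<subseteq> A\<close>.\<close>

theorem general_elt_good:
  assumes inf: "residue_field_infinite R"
    and A: "ideal A R" and B: "ideal B R" and BA: "\<mm> \<cdot> B \<subseteq> A" and AB: "A \<subseteq> B"
  shows "general_elt R (\<lambda>x. colon R A {x} = B) \<longleftrightarrow> (\<exists>x\<in>\<mm>. good A B x)"
proof
  let ?n = "min_num_gens R \<mm>"
  assume "general_elt R (\<lambda>x. colon R A {x} = B)"
  then obtain ys where ys: "\<forall>i<?n. ys i \<in> carrier R" "Idl (ys ` {..<?n}) = \<mm>"
    and g: "generic R ?n (\<lambda>a. colon R A {lin_comb R ?n a ys} = B)" unfolding general_elt_iff by blast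
  have ysm: "ys i \<in> \<mm>" if "i < ?n" for i using genideal_self[of "ys ` {..<?n}"] ys that by auto
  obtain a where a: "a \<in> coords R ?n" "colon R A {lin_comb R ?n a ys} = B" using generic_ex[OF g] by blast
  define x where "x = lin_comb R ?n a ys"
  have x: "x \<in> \<mm>" unfolding x_def using lin_comb_mem_mm[OF ysm a(1)] .
  have "good A B x" unfolding good_def
  proof (intro ballI impI)
    fix r assume r: "r \<in> colon R B \<mm>" "x \<otimes> r \<in> A"
    have rc: "r \<in> carrier R" using r(1) by (simp add: colon_def)
    then have "r \<in> colon R A {x}" using r(2) m_comm[OF mm_carr[OF x] rc] by (simp add: colon_def)
    then show "r \<in> B" using a(2) by (simp add: x_def)
  qed
  then show "\<exists>x\<in>\<mm>. good A B x" using x by blast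
next
  let ?n = "min_num_gens R \<mm>"
  assume "\<exists>x\<in>\<mm>. good A B x"
  then obtain x0 where x0: "x0 \<in> \<mm>" "good A B x0" by blast
  obtain ys where ys: "\<And>i. i < ?n \<Longrightarrow> ys i \<in> carrier R" "Idl (ys ` {..<?n}) = \<mm>" using mm_generators by blast
  have ysm: "ys i \<in> \<mm>" if "i < ?n" for i using genideal_self[of "ys ` {..<?n}"] ys that by auto
  have F: "family (\<lambda>n. A \<inter> \<pp> n)"
    using family_inter_pow[of "\<lambda>n. A" 0] A ideal_lmult_mem[OF A] ideal_carr[OF pp_ideal] by auto
  have "generic R ?n (\<lambda>a. colon R A {lin_comb R ?n a ys} = B)"
  proof (rule generic_mono[OF generic_conj[OF inf generic_good[OF A B BA ysm ys(2) x0]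
      generic_avoid[OF inf ysm ys(2) F]]])
    fix a assume a: "a \<in> coords R ?n" and *: "good A B (lin_comb R ?n a ys) \<and>
      (\<forall>k. \<forall>v\<in>\<pp> k. lin_comb R ?n a ys \<otimes> v \<in> A \<inter> \<pp> (Suc k) \<longrightarrow> (\<exists>t. \<forall>w\<in>\<pp> t. w \<otimes> v \<in> A \<inter> \<pp> (k + t)))"
    define x where "x = lin_comb R ?n a ys"
    have x: "x \<in> \<mm>" unfolding x_def using lin_comb_mem_mm[OF ysm a] .
    have xc: "x \<in> carrier R" using mm_carr[OF x] .
    have g: "good A B x" using * by (simp add: x_def)
    \<comment> \<open>Avoidance is applied in degree \<open>k = 0\<close>, where
      \<open>x v \<in> \<mm>\<close> holds for every \<open>v\<close>.\<close>
    have av: "\<exists>t. \<forall>w\<in>\<pp> t. w \<otimes> v \<in> A" if "v \<in> carrier R" "x \<otimes> v \<in> A" for v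
    proof -
      have "x \<otimes> v \<in> \<pp> (Suc 0)" using ideal_rmult_mem[OF mm_ideal x that(1)] pow_one[OF mm_ideal] by simp
      then have "\<exists>t. \<forall>w\<in>\<pp> t. w \<otimes> v \<in> A \<inter> \<pp> (0 + t)" using * that unfolding x_def by (metis IntI ideal_pow.simps(1))
      then show ?thesis by blast
    qed
    have "colon R A {x} = B"
    proof
      show "B \<subseteq> colon R A {x}"
      proof
        fix b assume b: "b \<in> B"
        have "x \<otimes> b \<in> A" using BA ideal_prod.prod[OF x b, of R] by blast
        then show "b \<in> colon R A {x}" using ideal_carr[OF B b] m_comm[OF xc] by (simp add: colon_def)
      qed
      show "colon R A {x} \<subseteq> B"
      proof
        fix r assume "r \<in> colon R A {x}"
        then have r: "r \<in> carrier R" "x \<otimes> r \<in> A" using m_comm[OF _ xc] by (auto simp: colon_def)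
        obtain t where t: "\<forall>w\<in>\<pp> t. w \<otimes> r \<in> A" using av[OF r] by blast
        \<comment> \<open>Descending induction from \<open>t\<close> to 0. If
          \<open>\<mm>^(j+1) r \<subseteq> B\<close>, each \<open>w r\<close> with
          \<open>w \<in> \<mm>^j\<close> represents a socle element of \<open>R / B\<close>, and
          \<open>x w r \<in> A\<close>, so goodness places \<open>w r\<close> in
          \<open>B\<close>.\<close>
        have "\<forall>w\<in>\<pp> j. w \<otimes> r \<in> B" if "j \<le> t" for j
          using that
        proof (induct j rule: inc_induct)
          case base
          show ?case using t AB by blast
        next
          case (step j)
          show ?case
          proof
            fix w assume w: "w \<in> \<pp> j"
            have wc: "w \<in> carrier R" using ideal_carr[OF pp_ideal w] .
            have "w \<otimes> r \<in> colon R B \<mm>"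
            proof (rule colonI)
              fix y assume y: "y \<in> \<mm>"
              have "y \<otimes> w \<in> \<pp> (Suc j)" using ideal_prod.prod[OF y w, of R] by (simp add: ideal_pow.simps)
              then have "y \<otimes> w \<otimes> r \<in> B" using step by blast
              then show "w \<otimes> r \<otimes> y \<in> B" using m_ac wc r(1) mm_carr[OF y] by (simp add: m_ac)
            qed (use wc r in simp)
            moreover have "x \<otimes> (w \<otimes> r) \<in> A"
              using ideal_lmult_mem[OF A r(2) wc] m_lcomm[OF xc wc r(1)] by simp
            ultimately show "w \<otimes> r \<in> B" using g unfolding good_def by blast
          qed
        qed
        from this[of 0] have "\<forall>w\<in>carrier R. w \<otimes> r \<in> B" by simp
        then have "\<one> \<otimes> r \<in> B" by (rule bspec) simp
        then show "r \<in> B" using r(1) by simp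
      qed
    qed
    then show "colon R A {lin_comb R ?n a ys} = B" unfolding x_def .
  qed
  then show "general_elt R (\<lambda>x. colon R A {x} = B)" unfolding general_elt_iff using ys by blast
qed

text \<open>From the perturbed pair to \<open>(A, B)\<close>: a socle element \<open>r\<close>
  becomes \<open>b + k\<close> with \<open>k\<close> in the socle and in \<open>\<mm>^n\<close>,
  hence in \<open>B\<close>. In the other direction a socle element of the perturbed quotient is
  \<open>u + v\<close> with \<open>u \<in> B : \<mm>\<close> and \<open>v \<in> K\<mm>^p\<close>.
  The part \<open>u\<close> is settled by goodness of \<open>x\<close> for \<open>(A, B)\<close>.
  The part \<open>v\<close> is torsion, because \<open>x\<close> also avoids the associated primes
  of the graded module, and torsion vanishes in high degree.\<close>

theorem good_asymptotic:
  assumes inf: "residue_field_infinite R"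
    and A: "ideal A R" and B: "ideal B R" and K: "ideal K R" and BA: "\<mm> \<cdot> B \<subseteq> A" and AB: "A \<subseteq> B"
  shows "(\<exists>x\<in>\<mm>. good A B x) \<longleftrightarrow>
    (\<exists>n0. \<forall>n\<ge>n0. \<exists>x\<in>\<mm>. good (J_seq A K (Suc n)) (J_seq B K n) x)"
proof
  assume "\<exists>n0. \<forall>n\<ge>n0. \<exists>x\<in>\<mm>. good (J_seq A K (Suc n)) (J_seq B K n) x"
  then obtain n0 where n0: "\<And>n. n \<ge> n0 \<Longrightarrow> \<exists>x\<in>\<mm>. good (J_seq A K (Suc n)) (J_seq B K n) x" by blast
  obtain n1 where n1: "\<And>n. n \<ge> n1 \<Longrightarrow> colon R B \<mm> \<inter> \<pp> n \<subseteq> B" using colon_inter_pow[OF B] by blast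
  \<comment> \<open>One large index is enough in this direction: \<open>n0\<close> provides a good
    \<open>x\<close>, and \<open>n1\<close> forces elements of \<open>B : \<mm>\<close> that lie in
    \<open>\<mm>^n\<close> into \<open>B\<close>.\<close>
  define n where "n = max n0 n1"
  obtain x where x: "x \<in> \<mm>" "good (J_seq A K (Suc n)) (J_seq B K n) x" using n0[of n] by (auto simp: n_def)
  have "good A B x" unfolding good_def
  proof (intro ballI impI)
    fix r assume r: "r \<in> colon R B \<mm>" "x \<otimes> r \<in> A"
    have "r \<in> colon R (J_seq B K n) \<mm>" using r(1) B_in_J[OF B K, of n] by (auto simp: colon_def)
    then have "r \<in> J_seq B K n" using x(2) r(2) B_in_J[OF A K] unfolding good_def by blast
    then obtain b k where b: "b \<in> B" "k \<in> K \<cdot> \<pp> n" "r = b \<oplus> k" by (auto elim: set_addE)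
    have c: "b \<in> carrier R" "k \<in> carrier R" using ideal_carr[OF B b(1)] ideal_carr[OF Kp_ideal[OF K] b(2)] by auto
    have "k \<in> colon R B \<mm>"
      using ideal_cancel_left[OF colon_mm_ideal[OF B], of b k] r(1) b sub_colon_mm[OF B] c by auto
    then have "k \<in> B" using n1[of n] Kp_sub(1)[OF K, of n] b(2) by (auto simp: n_def)
    then show "r \<in> B" using b ideal_add_mem[OF B] by simp
  qed
  then show "\<exists>x\<in>\<mm>. good A B x" using x(1) by blast
next
  let ?n = "min_num_gens R \<mm>"
  assume "\<exists>x\<in>\<mm>. good A B x"
  then obtain x0 where x0: "x0 \<in> \<mm>" "good A B x0" by blast
  obtain ys where ys: "\<And>i. i < ?n \<Longrightarrow> ys i \<in> carrier R" "Idl (ys ` {..<?n}) = \<mm>" using mm_generators by blast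
  have ysm: "ys i \<in> \<mm>" if "i < ?n" for i using genideal_self[of "ys ` {..<?n}"] ys that by auto
  note Hi = J_seq_ideal[OF B K]
  \<comment> \<open>With the shift by 1, avoidance speaks about products one step deeper than
    expected, which is what \<open>stable_superficial\<close> consumes.\<close>
  have F: "family (\<lambda>n. J_seq B K (n + 1) \<inter> \<pp> n)"
    by (rule family_inter_pow[of "J_seq B K" 1]) (use Hi J_seq_mult[OF B K] in auto)
  obtain a where a: "a \<in> coords R ?n" and *: "good A B (lin_comb R ?n a ys) \<and>
    (\<forall>k. \<forall>v\<in>\<pp> k. lin_comb R ?n a ys \<otimes> v \<in> J_seq B K (Suc k + 1) \<inter> \<pp> (Suc k) \<longrightarrow>
      (\<exists>t. \<forall>w\<in>\<pp> t. w \<otimes> v \<in> J_seq B K (k + t + 1) \<inter> \<pp> (k + t)))"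
    using generic_ex[OF generic_conj[OF inf generic_good[OF A B BA ysm ys(2) x0]
      generic_avoid[OF inf ysm ys(2) F]]] by blast
  define x where "x = lin_comb R ?n a ys"
  have x: "x \<in> \<mm>" unfolding x_def using lin_comb_mem_mm[OF ysm a] .
  have xc: "x \<in> carrier R" using mm_carr[OF x] .
  have g: "good A B x" using * by (simp add: x_def)
  have av: "\<exists>t. \<forall>w\<in>\<pp> t. w \<otimes> v \<in> J_seq B K (k + t + 1)"
    if "v \<in> \<pp> k" "x \<otimes> v \<in> J_seq B K (Suc k + 1)" for k v
  proof -
    have "x \<otimes> v \<in> \<pp> (Suc k)" using ideal_prod.prod[OF x that(1), of R] by (simp add: ideal_pow.simps)
    then show ?thesis using * that unfolding x_def by blast
  qed
  obtain n1 where n1: "\<And>n v t. \<lbrakk>n \<ge> n1; v \<in> K \<cdot> \<pp> n; \<forall>w\<in>\<pp> t. w \<otimes> v \<in> J_seq B K (n + t + 1)\<rbrakk> \<Longrightarrow> v \<in> J_seq B K (n + 1)"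
    using stable_superficial[OF B K] by blast
  obtain n2 where n2: "\<And>n. n \<ge> n2 \<Longrightarrow> colon R (J_seq B K (Suc n)) \<mm> \<subseteq> J_seq (colon R B \<mm>) K n"
    using colon_asymptotic[OF B K] by blast
  obtain n3 where n3: "\<And>n. n \<ge> n3 \<Longrightarrow> B \<inter> \<pp> n \<subseteq> \<pp> 1 \<cdot> B" using artin_rees[OF B] by blast
  have n3': "B \<inter> \<pp> n \<subseteq> A" if "n \<ge> n3" for n using n3[OF that] BA pow_one[OF mm_ideal] by auto
  \<comment> \<open>The index is \<open>p + 1\<close> because the colon formula describes the socle
    at index \<open>p + 1\<close> through \<open>K\<mm>^p\<close>.\<close>
  have "good (J_seq A K (Suc (Suc p))) (J_seq B K (Suc p)) x" if p: "p \<ge> max n1 (max n2 n3)" for p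
    unfolding good_def
  proof (intro ballI impI)
    fix r assume r: "r \<in> colon R (J_seq B K (Suc p)) \<mm>" and xr: "x \<otimes> r \<in> J_seq A K (Suc (Suc p))"
    have "r \<in> J_seq (colon R B \<mm>) K p" using n2[of p] p r by auto
    then obtain u v where u: "u \<in> colon R B \<mm>" "v \<in> K \<cdot> \<pp> p" "r = u \<oplus> v"
      by (rule set_addE)
    have c: "u \<in> carrier R" "v \<in> carrier R"
      using u(1) ideal_carr[OF Kp_ideal[OF K] u(2)] by (auto simp: colon_def)
    have xv: "x \<otimes> v \<in> K \<cdot> \<pp> (Suc p)"
      using pow_prod_mult[OF mm_ideal K, of x 1 v p] x u(2) mm_pp_one by simp
    have xu: "x \<otimes> u \<in> B" using u(1) x m_comm[OF xc c(1)] by (simp add: colon_def)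
    have e: "x \<otimes> r = x \<otimes> u \<oplus> x \<otimes> v" unfolding u(3) using c xc by (simp add: r_distr)
    \<comment> \<open>Only precision \<open>p + 1\<close> is available, as \<open>x v\<close> is
      merely in \<open>K\<mm>^(p+1)\<close>. This suffices: the error \<open>k\<close> lies in
      \<open>B \<inter> \<mm>^(p+1) \<subseteq> \<mm>B \<subseteq> A\<close>, so \<open>x u\<close>
      is in \<open>A\<close> exactly.\<close>
    have "x \<otimes> u \<in> J_seq A K (Suc p)"
    proof (rule ideal_cancel_right[OF J_seq_ideal[OF A K]])
      show "x \<otimes> u \<oplus> x \<otimes> v \<in> J_seq A K (Suc p)"
        using xr e J_seq_antimono[of "Suc p" "Suc (Suc p)" A K] by auto
      show "x \<otimes> v \<in> J_seq A K (Suc p)" using xv Kp_in_J[OF A K] by blast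
    qed (use xc c in simp)
    then obtain b k where b: "b \<in> A" "k \<in> K \<cdot> \<pp> (Suc p)" "x \<otimes> u = b \<oplus> k" by (auto elim: set_addE)
    have "k \<in> B" using ideal_cancel_left[OF B, of b k] b AB xu ideal_carr[OF Kp_ideal[OF K] b(2)] by auto
    then have "k \<in> A" using n3'[of "Suc p"] p b(2) Kp_sub(1)[OF K, of "Suc p"] by auto
    then have xuA: "x \<otimes> u \<in> A" using b ideal_add_mem[OF A] by simp
    then have uB: "u \<in> B" using g u(1) unfolding good_def by blast
    \<comment> \<open>With \<open>x u \<in> A\<close> known exactly, the full precision
      \<open>p + 2\<close> of \<open>x r\<close> passes to \<open>x v\<close>, one step more than
      \<open>v \<in> K\<mm>^p\<close> alone would give.\<close>
    have "x \<otimes> v \<in> J_seq A K (Suc (Suc p))"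
      using ideal_cancel_left[OF J_seq_ideal[OF A K], of "x \<otimes> u" "x \<otimes> v"] xr e xuA B_in_J[OF A K] xc c by auto
    then have "x \<otimes> v \<in> J_seq B K (Suc p + 1)" using set_add_mono[OF AB subset_refl] by auto
    then obtain t where "\<forall>w\<in>\<pp> t. w \<otimes> v \<in> J_seq B K (p + t + 1)"
      using av[of v p] u(2) Kp_sub(1)[OF K, of p] by blast
    then have "v \<in> J_seq B K (p + 1)" using n1[OF _ u(2)] p by simp
    then show "r \<in> J_seq B K (Suc p)"
      using u(3) uB B_in_J[OF B K, of "Suc p"] ideal_add_mem[OF Hi] by auto
  qed
  then have "\<exists>x\<in>\<mm>. good (J_seq A K (Suc n)) (J_seq B K n) x" if "n \<ge> Suc (max n1 (max n2 n3))" for n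
    using x that by (cases n) auto
  then show "\<exists>n0. \<forall>n\<ge>n0. \<exists>x\<in>\<mm>. good (J_seq A K (Suc n)) (J_seq B K n) x" by blast
qed

section \<open>Transfer to the three fullness properties\<close>

lemma mm_J_seq:
  assumes "ideal J R" "ideal K R" shows "\<mm> \<cdot> J_seq J K n = J_seq (\<mm> \<cdot> J) K (Suc n)"
proof -
  have "\<mm> \<cdot> (K \<cdot> \<pp> n) = K \<cdot> \<pp> (Suc n)"
    using ideal_prod_assoc[OF mm_ideal assms(2) pp_ideal] ideal_prod_assoc[OF assms(2) mm_ideal pp_ideal]
      ideal_prod_commute[OF mm_ideal assms(2)] by (simp add: ideal_pow.simps)
  then show ?thesis using ideal_prod_r_distr[OF mm_ideal assms(1) Kp_ideal[OF assms(2)]] by simp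
qed

theorem m_full_inf_asymptotic:
  assumes inf: "residue_field_infinite R" and J: "ideal J R" and K: "ideal K R"
  shows "m_full_inf R J \<longleftrightarrow> (\<exists>n0. \<forall>n\<ge>n0. m_full_inf R (J_seq J K n))"
proof -
  have iff: "m_full_inf R I \<longleftrightarrow> (\<exists>x\<in>\<mm>. good (\<mm> \<cdot> I) I x)" if I: "ideal I R" for I
    unfolding m_full_inf_def
    using general_elt_good[OF inf ideal_prod_is_ideal[OF mm_ideal I] I] ideal_prod_inter[OF mm_ideal I] by blast
  show ?thesis
    unfolding iff[OF J] iff[OF J_seq_ideal[OF J K]] mm_J_seq[OF J K]
    using good_asymptotic[OF inf ideal_prod_is_ideal[OF mm_ideal J] J K subset_refl]
      ideal_prod_inter[OF mm_ideal J] by blast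
qed

text \<open>For large \<open>n\<close> the pair attached to \<open>J + K\<mm>^(n+1)\<close> is
  \<open>(J + K\<mm>^(n+1), (J : \<mm>) + K\<mm>^n)\<close>, by the asymptotic colon formula. Hence
  \<open>Q n\<close> describes fullness at index \<open>n + 1\<close>, and the final equivalence
  only translates this shift.\<close>

theorem full_inf_asymptotic:
  assumes inf: "residue_field_infinite R" and J: "ideal J R" and K: "ideal K R"
  shows "full_inf R J \<longleftrightarrow> (\<exists>n0. \<forall>n\<ge>n0. full_inf R (J_seq J K n))"
proof -
  have iff: "full_inf R I \<longleftrightarrow> (\<exists>x\<in>\<mm>. good I (colon R I \<mm>) x)" if I: "ideal I R" for I
    unfolding full_inf_def
    using general_elt_good[OF inf I colon_mm_ideal[OF I] mm_colon[OF I] sub_colon_mm[OF I]] .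
  obtain n1 where n1: "\<And>n. n \<ge> n1 \<Longrightarrow> colon R (J_seq J K (Suc n)) \<mm> = J_seq (colon R J \<mm>) K n"
    using colon_asymptotic_eq[OF J K] by blast
  define Q where "Q n \<longleftrightarrow> (\<exists>x\<in>\<mm>. good (J_seq J K (Suc n)) (J_seq (colon R J \<mm>) K n) x)" for n
  have Q: "full_inf R (J_seq J K (Suc n)) \<longleftrightarrow> Q n" if "n \<ge> n1" for n
    unfolding iff[OF J_seq_ideal[OF J K]] Q_def n1[OF that] ..
  have "full_inf R J \<longleftrightarrow> (\<exists>n0. \<forall>n\<ge>n0. Q n)"
    unfolding iff[OF J] Q_def
    by (rule good_asymptotic[OF inf J colon_mm_ideal[OF J] K mm_colon[OF J] sub_colon_mm[OF J]])
  also have "\<dots> \<longleftrightarrow> (\<exists>n0. \<forall>n\<ge>n0. full_inf R (J_seq J K n))"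
  proof
    assume "\<exists>n0. \<forall>n\<ge>n0. Q n"
    then obtain n0 where n0: "\<And>n. n \<ge> n0 \<Longrightarrow> Q n" by blast
    have "full_inf R (J_seq J K n)" if "n \<ge> Suc (max n0 n1)" for n
      using that n0[of "n - 1"] Q[of "n - 1"] by (cases n) auto
    then show "\<exists>n0. \<forall>n\<ge>n0. full_inf R (J_seq J K n)" by blast
  next
    assume "\<exists>n0. \<forall>n\<ge>n0. full_inf R (J_seq J K n)"
    then obtain n0 where n0: "\<And>n. n \<ge> n0 \<Longrightarrow> full_inf R (J_seq J K n)" by blast
    have "Q n" if "n \<ge> max n0 n1" for n using n0[of "Suc n"] Q[of n] that by simp
    then show "\<exists>n0. \<forall>n\<ge>n0. Q n" by blast
  qed
  finally show ?thesis .
qed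

text \<open>Forward: an element of the colon is \<open>u + v\<close> with
  \<open>u \<in> J : \<mm>\<close> and \<open>v \<in> K\<mm>^n\<close>; for
  \<open>y \<in> \<mm>\<close> the product \<open>u y\<close> lies in \<open>J\<close> and in
  \<open>\<mm>J + K\<mm>^(n+1)\<close>, and Artin-Rees absorbs the error into \<open>\<mm>J\<close>.
  Backward: \<open>r = b + k\<close>, where \<open>k\<close> lies in
  \<open>(J : \<mm>) \<inter> \<mm>^n \<subseteq> J\<close>.\<close>

theorem weakly_m_full_asymptotic:
  assumes J: "ideal J R" and K: "ideal K R"
  shows "weakly_m_full R J \<longleftrightarrow> (\<exists>n0. \<forall>n\<ge>n0. weakly_m_full R (J_seq J K n))"
proof
  have mJ: "ideal (\<mm> \<cdot> J) R" "\<mm> \<cdot> J \<subseteq> J"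
    using ideal_prod_is_ideal[OF mm_ideal J] ideal_prod_inter[OF mm_ideal J] by auto
  have triv: "I \<subseteq> colon R (\<mm> \<cdot> I) \<mm>" if I: "ideal I R" for I
  proof
    fix r assume r: "r \<in> I"
    have "r \<otimes> y \<in> \<mm> \<cdot> I" if "y \<in> \<mm>" for y
      using ideal_prod.prod[OF that r, of R] m_comm[OF ideal_carr[OF I r] mm_carr[OF that]] by simp
    then show "r \<in> colon R (\<mm> \<cdot> I) \<mm>" using ideal_carr[OF I r] by (simp add: colon_def)
  qed
  {
    assume w: "weakly_m_full R J"
    obtain n1 where n1: "\<And>n. n \<ge> n1 \<Longrightarrow> colon R (J_seq J K (Suc n)) \<mm> = J_seq (colon R J \<mm>) K n"
      using colon_asymptotic_eq[OF J K] by blast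
    obtain n2 where n2: "\<And>n. n \<ge> n2 \<Longrightarrow> J \<inter> \<pp> n \<subseteq> \<pp> 1 \<cdot> J" using artin_rees[OF J] by blast
    have "colon R (\<mm> \<cdot> J_seq J K n) \<mm> \<subseteq> J_seq J K n" if n: "n \<ge> max n1 n2" for n
    proof
      fix r assume "r \<in> colon R (\<mm> \<cdot> J_seq J K n) \<mm>"
      then have rc: "r \<in> carrier R" and ry: "\<And>y. y \<in> \<mm> \<Longrightarrow> r \<otimes> y \<in> J_seq (\<mm> \<cdot> J) K (Suc n)"
        unfolding mm_J_seq[OF J K] by (auto simp: colon_def)
      have "r \<in> colon R (J_seq J K (Suc n)) \<mm>"
        using rc ry set_add_mono[OF mJ(2) subset_refl] by (auto simp: colon_def)
      then obtain u v where u: "u \<in> colon R J \<mm>" "v \<in> K \<cdot> \<pp> n" "r = u \<oplus> v"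
        using n1[of n] n by (auto elim: set_addE)
      have c: "u \<in> carrier R" "v \<in> carrier R"
        using u(1) ideal_carr[OF Kp_ideal[OF K] u(2)] by (auto simp: colon_def)
      have "u \<otimes> y \<in> \<mm> \<cdot> J" if y: "y \<in> \<mm>" for y
      proof -
        have yc: "y \<in> carrier R" using mm_carr[OF y] .
        have "y \<otimes> v \<in> K \<cdot> \<pp> (Suc n)" using pow_prod_mult[OF mm_ideal K, of y 1 v n] y u(2) mm_pp_one by simp
        then have vy: "v \<otimes> y \<in> J_seq (\<mm> \<cdot> J) K (Suc n)" using Kp_in_J[OF mJ(1) K] m_comm[OF c(2) yc] by auto
        have "r \<otimes> y = u \<otimes> y \<oplus> v \<otimes> y" unfolding u(3) using c yc by (simp add: l_distr)
        then have "u \<otimes> y \<in> J_seq (\<mm> \<cdot> J) K (Suc n)"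
          using ideal_cancel_right[OF J_seq_ideal[OF mJ(1) K], of "u \<otimes> y" "v \<otimes> y"] ry[OF y] vy c yc by simp
        then obtain b k where b: "b \<in> \<mm> \<cdot> J" "k \<in> K \<cdot> \<pp> (Suc n)" "u \<otimes> y = b \<oplus> k" by (auto elim: set_addE)
        have "u \<otimes> y \<in> J" using u(1) y by (simp add: colon_def)
        then have "k \<in> J"
          using ideal_cancel_left[OF J, of b k] b mJ(2) ideal_carr[OF Kp_ideal[OF K] b(2)] by auto
        then have "k \<in> \<mm> \<cdot> J" using n2[of "Suc n"] n b(2) Kp_sub(1)[OF K, of "Suc n"] pow_one[OF mm_ideal] by auto
        then show ?thesis using b ideal_add_mem[OF mJ(1)] by simp
      qed
      then have "u \<in> J" using w c(1) unfolding weakly_m_full_def by (auto simp: colon_def)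
      then show "r \<in> J_seq J K n" using u by (simp add: set_addI)
    qed
    then show "\<exists>n0. \<forall>n\<ge>n0. weakly_m_full R (J_seq J K n)"
      unfolding weakly_m_full_def using triv[OF J_seq_ideal[OF J K]] by (meson subset_antisym)
  }
  {
    assume "\<exists>n0. \<forall>n\<ge>n0. weakly_m_full R (J_seq J K n)"
    then obtain n0 where n0: "\<And>n. n \<ge> n0 \<Longrightarrow> colon R (\<mm> \<cdot> J_seq J K n) \<mm> = J_seq J K n"
      unfolding weakly_m_full_def by blast
    obtain n1 where n1: "\<And>n. n \<ge> n1 \<Longrightarrow> colon R J \<mm> \<inter> \<pp> n \<subseteq> J" using colon_inter_pow[OF J] by blast
    define n where "n = max n0 n1"
    have "colon R (\<mm> \<cdot> J) \<mm> \<subseteq> J"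
    proof
      fix r assume r: "r \<in> colon R (\<mm> \<cdot> J) \<mm>"
      have "\<mm> \<cdot> J \<subseteq> \<mm> \<cdot> J_seq J K n" using B_in_J[OF J K] by (intro prod_mono) auto
      then have "r \<in> J_seq J K n" using n0[of n] r by (auto simp: colon_def n_def)
      then obtain b k where b: "b \<in> J" "k \<in> K \<cdot> \<pp> n" "r = b \<oplus> k" by (auto elim: set_addE)
      have "r \<in> colon R J \<mm>" using r mJ(2) by (auto simp: colon_def)
      then have "k \<in> colon R J \<mm>"
        using ideal_cancel_left[OF colon_mm_ideal[OF J], of b k] b sub_colon_mm[OF J]
          ideal_carr[OF Kp_ideal[OF K] b(2)] by auto
      then have "k \<in> J" using n1[of n] b(2) Kp_sub(1)[OF K, of n] by (auto simp: n_def)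
      then show "r \<in> J" using b ideal_add_mem[OF J] by simp
    qed
    then show "weakly_m_full R J" unfolding weakly_m_full_def using triv[OF J] by blast
  }
qed

end

section \<open>Polynomial rings in several variables\<close>

definition mpoly_mon :: "('a, 'b) ring_scheme \<Rightarrow> 'a \<Rightarrow> (nat \<Rightarrow> nat) \<Rightarrow> ((nat \<Rightarrow> nat) \<Rightarrow> 'a)" where
  "mpoly_mon R c d = (\<lambda>e. if e = d then c else \<zero>\<^bsub>R\<^esub>)"

text \<open>The pair consists of the lexicographically largest exponents. The induction restricts
  both sets to the members with maximal last free coordinate; a pair with the same sum must attain
  both maxima. With no free coordinate left, both sets are singletons.\<close>

lemma exists_unique_sum:
  fixes A B :: "(nat \<Rightarrow> nat) set"
  assumes "finite A" "A \<noteq> {}" "finite B" "B \<noteq> {}"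
    "\<And>a a' i. \<lbrakk>a \<in> A; a' \<in> A; i \<ge> n\<rbrakk> \<Longrightarrow> a i = a' i"
    "\<And>b b' i. \<lbrakk>b \<in> B; b' \<in> B; i \<ge> n\<rbrakk> \<Longrightarrow> b i = b' i"
  shows "\<exists>a\<in>A. \<exists>b\<in>B. \<forall>a'\<in>A. \<forall>b'\<in>B. (\<forall>i. a' i + b' i = a i + b i) \<longrightarrow> a' = a \<and> b' = b"
  using assms
proof (induct n arbitrary: A B)
  case 0
  then obtain a b where ab: "a \<in> A" "b \<in> B" by blast
  have "a' = a" if "a' \<in> A" for a' using 0(5)[OF that ab(1)] by (auto intro: ext)
  moreover have "b' = b" if "b' \<in> B" for b' using 0(6)[OF that ab(2)] by (auto intro: ext)
  ultimately show ?case using ab by blast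
next
  case (Suc n)
  define A' where "A' = {a \<in> A. a n = Max ((\<lambda>a. a n) ` A)}"
  define B' where "B' = {b \<in> B. b n = Max ((\<lambda>b. b n) ` B)}"
  have mA: "a n \<le> Max ((\<lambda>a. a n) ` A)" if "a \<in> A" for a using that Suc.prems(1) by (intro Max_ge) auto
  have mB: "b n \<le> Max ((\<lambda>b. b n) ` B)" if "b \<in> B" for b using that Suc.prems(3) by (intro Max_ge) auto
  have "Max ((\<lambda>a. a n) ` A) \<in> (\<lambda>a. a n) ` A" using Suc.prems(1,2) by (intro Max_in) auto
  then have A'n: "A' \<noteq> {}" unfolding A'_def by force
  have "Max ((\<lambda>b. b n) ` B) \<in> (\<lambda>b. b n) ` B" using Suc.prems(3,4) by (intro Max_in) auto
  then have B'n: "B' \<noteq> {}" unfolding B'_def by force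
  have "\<exists>a\<in>A'. \<exists>b\<in>B'. \<forall>a'\<in>A'. \<forall>b'\<in>B'. (\<forall>i. a' i + b' i = a i + b i) \<longrightarrow> a' = a \<and> b' = b"
  proof (rule Suc.hyps)
    show "finite A'" "finite B'" using Suc.prems(1,3) unfolding A'_def B'_def by auto
    fix i assume i: "i \<ge> n"
    show "a i = a' i" if "a \<in> A'" "a' \<in> A'" for a a'
      using Suc.prems(5)[of a a' i] that i unfolding A'_def by (cases "i = n") auto
    show "b i = b' i" if "b \<in> B'" "b' \<in> B'" for b b'
      using Suc.prems(6)[of b b' i] that i unfolding B'_def by (cases "i = n") auto
  qed (use A'n B'n in auto)
  then obtain a b where ab: "a \<in> A'" "b \<in> B'"
    "\<And>a' b'. \<lbrakk>a' \<in> A'; b' \<in> B'; \<forall>i. a' i + b' i = a i + b i\<rbrakk> \<Longrightarrow> a' = a \<and> b' = b" by blast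
  have "a' = a \<and> b' = b" if "a' \<in> A" "b' \<in> B" "\<forall>i. a' i + b' i = a i + b i" for a' b'
  proof (rule ab(3)[OF _ _ that(3)])
    have "a' n \<le> a n" "b' n \<le> b n" using mA[OF that(1)] mB[OF that(2)] ab(1,2) unfolding A'_def B'_def by auto
    moreover have "a' n + b' n = a n + b n" using that(3) by blast
    ultimately have "a' n = a n" "b' n = b n" by linarith+
    then show "a' \<in> A'" "b' \<in> B'" using that ab(1,2) unfolding A'_def B'_def by auto
  qed
  then show ?case using ab(1,2) unfolding A'_def B'_def by blast
qed

locale mpoly = cring R for R (structure) + fixes n :: nat
begin

abbreviation S where "S \<equiv> mpoly_ring R n"
abbreviation mon where "mon \<equiv> mpoly_mon R"

definition pairs :: "(nat \<Rightarrow> nat) set \<Rightarrow> (nat \<Rightarrow> nat) set \<Rightarrow> (nat \<Rightarrow> nat) \<Rightarrow> ((nat \<Rightarrow> nat) \<times> (nat \<Rightarrow> nat)) set" where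
  "pairs A B e = {(e1, e2). e1 \<in> A \<and> e2 \<in> B \<and> (\<forall>i. e1 i + e2 i = e i)}"

lemma S_carrier: "p \<in> carrier S \<longleftrightarrow> (\<forall>e. p e \<in> carrier R) \<and> finite {e. p e \<noteq> \<zero>} \<and> (\<forall>e. p e \<noteq> \<zero> \<longrightarrow> (\<forall>i\<ge>n. e i = 0))"
  by (simp add: mpoly_ring_def)

lemma S_coeff [simp]: "p \<in> carrier S \<Longrightarrow> p e \<in> carrier R"
  by (simp add: S_carrier)

lemma S_supp: "p \<in> carrier S \<Longrightarrow> finite {e. p e \<noteq> \<zero>}"
  by (simp add: S_carrier)

lemma S_mult: "p \<otimes>\<^bsub>S\<^esub> q = mpoly_mult R p q" by (simp only: mpoly_ring_def monoid.simps ring.simps partial_object.simps)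
lemma S_add: "p \<oplus>\<^bsub>S\<^esub> q = (\<lambda>e. p e \<oplus> q e)" by (simp only: mpoly_ring_def monoid.simps ring.simps partial_object.simps)
lemma S_zero: "\<zero>\<^bsub>S\<^esub> = (\<lambda>e. \<zero>)" by (simp only: mpoly_ring_def monoid.simps ring.simps partial_object.simps)
lemma S_one: "\<one>\<^bsub>S\<^esub> = mon \<one> (\<lambda>_. 0)" by (simp only: mpoly_ring_def mpoly_mon_def monoid.simps ring.simps partial_object.simps)

lemma finite_pairs: "\<lbrakk>finite A; finite B\<rbrakk> \<Longrightarrow> finite (pairs A B e)"
  by (rule finite_subset[of _ "A \<times> B"]) (auto simp: pairs_def)

text \<open>Finite sets larger than the supports are allowed, so that coefficients of several
  products can be summed over one common index set, as distributivity requires.\<close>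

lemma mult_pairs:
  assumes "p \<in> carrier S" "q \<in> carrier S" "finite A" "finite B"
    "{e. p e \<noteq> \<zero>} \<subseteq> A" "{e. q e \<noteq> \<zero>} \<subseteq> B"
  shows "mpoly_mult R p q e = (\<Oplus>z\<in>pairs A B e. (case z of (e1, e2) \<Rightarrow> p e1 \<otimes> q e2))"
  unfolding mpoly_mult_def
proof (rule add.finprod_mono_neutral_cong_left)
  show "finite (pairs A B e)" using assms finite_pairs by blast
  show "{(e1, e2). (\<forall>i. e1 i + e2 i = e i) \<and> p e1 \<noteq> \<zero> \<and> q e2 \<noteq> \<zero>} \<subseteq> pairs A B e"
    using assms unfolding pairs_def by blast
  show "\<And>i. i \<in> pairs A B e - {(e1, e2). (\<forall>i. e1 i + e2 i = e i) \<and> p e1 \<noteq> \<zero> \<and> q e2 \<noteq> \<zero>} \<Longrightarrow>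
         (case i of (e1, e2) \<Rightarrow> p e1 \<otimes> q e2) = \<zero>"
    using assms(1,2) unfolding pairs_def by auto
qed (use assms(1,2) in auto)

lemma mult_closed:
  assumes p: "p \<in> carrier S" and q: "q \<in> carrier S"
  shows "mpoly_mult R p q \<in> carrier S"
proof -
  let ?A = "{e. p e \<noteq> \<zero>}" and ?B = "{e. q e \<noteq> \<zero>}"
  have eq: "mpoly_mult R p q e = (\<Oplus>z\<in>pairs ?A ?B e. (case z of (e1, e2) \<Rightarrow> p e1 \<otimes> q e2))" for e
    by (rule mult_pairs[OF p q]) (use p q S_supp in auto)
  have "mpoly_mult R p q e \<in> carrier R" for e
    unfolding eq using p q by (intro finsum_closed) auto
  moreover have ne: "pairs ?A ?B e \<noteq> {}" if "mpoly_mult R p q e \<noteq> \<zero>" for e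
    using that unfolding eq by auto
  have "{e. mpoly_mult R p q e \<noteq> \<zero>} \<subseteq> (\<lambda>(e1, e2) i. e1 i + e2 i) ` (?A \<times> ?B)"
  proof
    fix e assume "e \<in> {e. mpoly_mult R p q e \<noteq> \<zero>}"
    then obtain e1 e2 where "e1 \<in> ?A" "e2 \<in> ?B" "\<forall>i. e1 i + e2 i = e i"
      using ne unfolding pairs_def by blast
    then show "e \<in> (\<lambda>(e1, e2) i. e1 i + e2 i) ` (?A \<times> ?B)" by (intro image_eqI[of _ _ "(e1, e2)"]) auto
  qed
  then have "finite {e. mpoly_mult R p q e \<noteq> \<zero>}"
    using S_supp[OF p] S_supp[OF q] by (meson finite_SigmaI finite_imageI finite_subset)
  moreover have "e i = 0" if e: "mpoly_mult R p q e \<noteq> \<zero>" and i: "i \<ge> n" for e i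
  proof -
    obtain e1 e2 where "p e1 \<noteq> \<zero>" "q e2 \<noteq> \<zero>" "\<forall>i. e1 i + e2 i = e i"
      using ne[OF e] unfolding pairs_def by blast
    moreover then have "e1 i = 0" "e2 i = 0" using p q i unfolding S_carrier by blast+
    ultimately show ?thesis by (metis add_0)
  qed
  ultimately show ?thesis unfolding S_carrier by blast
qed

lemma add_closed: "\<lbrakk>p \<in> carrier S; q \<in> carrier S\<rbrakk> \<Longrightarrow> (\<lambda>e. p e \<oplus> q e) \<in> carrier S"
  unfolding S_carrier
proof (intro conjI allI impI)
  assume pq: "(\<forall>e. p e \<in> carrier R) \<and> finite {e. p e \<noteq> \<zero>} \<and> (\<forall>e. p e \<noteq> \<zero> \<longrightarrow> (\<forall>i\<ge>n. e i = 0))"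
    "(\<forall>e. q e \<in> carrier R) \<and> finite {e. q e \<noteq> \<zero>} \<and> (\<forall>e. q e \<noteq> \<zero> \<longrightarrow> (\<forall>i\<ge>n. e i = 0))"
  show "p e \<oplus> q e \<in> carrier R" for e using pq by simp
  have sub: "{e. p e \<oplus> q e \<noteq> \<zero>} \<subseteq> {e. p e \<noteq> \<zero>} \<union> {e. q e \<noteq> \<zero>}" by auto
  then show "finite {e. p e \<oplus> q e \<noteq> \<zero>}" using pq by (meson finite_UnI finite_subset)
  show "p e \<oplus> q e \<noteq> \<zero> \<Longrightarrow> n \<le> i \<Longrightarrow> e i = 0" for e i using sub pq by blast
qed

lemma mon_carrier: "\<lbrakk>c \<in> carrier R; \<forall>i\<ge>n. d i = 0\<rbrakk> \<Longrightarrow> mon c d \<in> carrier S"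
  unfolding S_carrier mpoly_mon_def by (auto intro: finite_subset[of _ "{d}"])

lemma zero_carrier: "(\<lambda>e. \<zero>) \<in> carrier S"
  unfolding S_carrier by simp

lemma mult_l_distr:
  assumes p: "p \<in> carrier S" and p': "p' \<in> carrier S" and q: "q \<in> carrier S"
  shows "mpoly_mult R (\<lambda>e. p e \<oplus> p' e) q = (\<lambda>e. mpoly_mult R p q e \<oplus> mpoly_mult R p' q e)"
proof
  fix e
  let ?A = "{e. p e \<noteq> \<zero>} \<union> {e. p' e \<noteq> \<zero>}" and ?B = "{e. q e \<noteq> \<zero>}"
  have f: "finite ?A" "finite ?B" using p p' q S_supp by auto
  have "mpoly_mult R (\<lambda>e. p e \<oplus> p' e) q e = (\<Oplus>z\<in>pairs ?A ?B e. (case z of (e1, e2) \<Rightarrow> (p e1 \<oplus> p' e1) \<otimes> q e2))"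
    by (rule mult_pairs[OF add_closed[OF p p'] q f]) auto
  also have "\<dots> = (\<Oplus>x\<in>pairs ?A ?B e. (case x of (e1, e2) \<Rightarrow> p e1 \<otimes> q e2) \<oplus> (case x of (e1, e2) \<Rightarrow> p' e1 \<otimes> q e2))"
    using p p' q by (intro finsum_cong') (auto simp: l_distr)
  also have "\<dots> = (\<Oplus>z\<in>pairs ?A ?B e. (case z of (e1, e2) \<Rightarrow> p e1 \<otimes> q e2)) \<oplus> (\<Oplus>z\<in>pairs ?A ?B e. (case z of (e1, e2) \<Rightarrow> p' e1 \<otimes> q e2))"
    using p p' q by (intro finsum_addf) auto
  also have "(\<Oplus>z\<in>pairs ?A ?B e. (case z of (e1, e2) \<Rightarrow> p e1 \<otimes> q e2)) = mpoly_mult R p q e"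
    by (rule mult_pairs[OF p q f, symmetric]) auto
  also have "(\<Oplus>z\<in>pairs ?A ?B e. (case z of (e1, e2) \<Rightarrow> p' e1 \<otimes> q e2)) = mpoly_mult R p' q e"
    by (rule mult_pairs[OF p' q f, symmetric]) auto
  finally show "mpoly_mult R (\<lambda>e. p e \<oplus> p' e) q e = mpoly_mult R p q e \<oplus> mpoly_mult R p' q e" .
qed

lemma mult_comm:
  assumes p: "p \<in> carrier S" and q: "q \<in> carrier S"
  shows "mpoly_mult R p q = mpoly_mult R q p"
proof
  fix e
  let ?A = "{e. p e \<noteq> \<zero>}" and ?B = "{e. q e \<noteq> \<zero>}"
  have f: "finite ?A" "finite ?B" using p q S_supp by auto
  have sw: "pairs ?B ?A e = prod.swap ` pairs ?A ?B e"
    by (auto simp: pairs_def add.commute image_iff)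
  have "mpoly_mult R q p e = (\<Oplus>z\<in>pairs ?B ?A e. (case z of (e1, e2) \<Rightarrow> q e1 \<otimes> p e2))"
    by (rule mult_pairs[OF q p f(2,1)]) auto
  also have "\<dots> = (\<Oplus>x\<in>pairs ?A ?B e. (case prod.swap x of (e1, e2) \<Rightarrow> q e1 \<otimes> p e2))"
    unfolding sw by (rule finsum_reindex) (use p q in auto)
  also have "\<dots> = (\<Oplus>z\<in>pairs ?A ?B e. (case z of (e1, e2) \<Rightarrow> p e1 \<otimes> q e2))"
    using p q by (intro finsum_cong') (auto simp: m_comm)
  also have "\<dots> = mpoly_mult R p q e"
    by (rule mult_pairs[OF p q f, symmetric]) auto
  finally show "mpoly_mult R p q e = mpoly_mult R q p e" ..
qed

lemma mult_r_distr:
  assumes p: "p \<in> carrier S" and p': "p' \<in> carrier S" and q: "q \<in> carrier S"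
  shows "mpoly_mult R q (\<lambda>e. p e \<oplus> p' e) = (\<lambda>e. mpoly_mult R q p e \<oplus> mpoly_mult R q p' e)"
  using mult_l_distr[OF p p' q] mult_comm[OF q add_closed[OF p p']] mult_comm[OF q p] mult_comm[OF q p'] by simp

lemma mult_mon:
  assumes "a \<in> carrier R" "b \<in> carrier R" "\<forall>i\<ge>n. d i = 0" "\<forall>i\<ge>n. d' i = 0"
  shows "mpoly_mult R (mon a d) (mon b d') = mon (a \<otimes> b) (\<lambda>i. d i + d' i)"
proof
  fix e
  have "mpoly_mult R (mon a d) (mon b d') e = (\<Oplus>z\<in>pairs {d} {d'} e. (case z of (e1, e2) \<Rightarrow> mon a d e1 \<otimes> mon b d' e2))"
    by (rule mult_pairs) (use assms mon_carrier in \<open>auto simp: mpoly_mon_def\<close>)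
  also have "\<dots> = mon (a \<otimes> b) (\<lambda>i. d i + d' i) e"
  proof (cases "e = (\<lambda>i. d i + d' i)")
    case True
    then have "pairs {d} {d'} e = {(d, d')}" by (auto simp: pairs_def)
    then show ?thesis using True assms(1,2) by (simp add: mpoly_mon_def)
  next
    case False
    then have "pairs {d} {d'} e = {}" by (auto simp: pairs_def)
    then show ?thesis using False by (simp add: mpoly_mon_def)
  qed
  finally show "mpoly_mult R (mon a d) (mon b d') e = mon (a \<otimes> b) (\<lambda>i. d i + d' i) e" .
qed

lemma mult_zero: "p \<in> carrier S \<Longrightarrow> mpoly_mult R (\<lambda>e. \<zero>) p = (\<lambda>e. \<zero>)"
  by (rule ext) (simp add: mpoly_mult_def)

text \<open>Builds \<open>p\<close> from its own terms. The step refers to the actual coefficients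
  \<open>p d\<close>, so the principle also serves for ideals defined by conditions on
  coefficients.\<close>

lemma mpoly_sum_mem:
  assumes "p \<in> carrier S" and Z: "(\<lambda>e. \<zero>) \<in> I"
    and step: "\<And>q d. \<lbrakk>q \<in> carrier S; q \<in> I; p d \<noteq> \<zero>; \<forall>i\<ge>n. d i = 0\<rbrakk> \<Longrightarrow> (\<lambda>e. mon (p d) d e \<oplus> q e) \<in> I"
  shows "p \<in> I"
proof -
  have "(\<lambda>e. if e \<in> A then p e else \<zero>) \<in> I \<and> (\<lambda>e. if e \<in> A then p e else \<zero>) \<in> carrier S"
    if "finite A" "A \<subseteq> {e. p e \<noteq> \<zero>}" for A
    using that
  proof (induct A)
    case empty
    then show ?case using Z zero_carrier by simp
  next
    case (insert d A)
    have d: "p d \<noteq> \<zero>" "\<forall>i\<ge>n. d i = 0" using insert.prems assms(1) unfolding S_carrier by auto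
    have IH: "(\<lambda>e. if e \<in> A then p e else \<zero>) \<in> I" "(\<lambda>e. if e \<in> A then p e else \<zero>) \<in> carrier S"
      using insert by auto
    have "(\<lambda>e. mon (p d) d e \<oplus> (if e \<in> A then p e else \<zero>)) = (\<lambda>e. if e \<in> insert d A then p e else \<zero>)"
      using insert.hyps(2) assms(1) by (auto simp: mpoly_mon_def)
    moreover have "(\<lambda>e. mon (p d) d e \<oplus> (if e \<in> A then p e else \<zero>)) \<in> I" by (rule step[OF IH(2,1) d])
    moreover have "(\<lambda>e. mon (p d) d e \<oplus> (if e \<in> A then p e else \<zero>)) \<in> carrier S"
      by (rule add_closed[OF mon_carrier IH(2)]) (use d assms(1) in auto)
    ultimately show ?case by simp
  qed
  from this[OF S_supp[OF assms(1)]] have "(\<lambda>e. if e \<in> {e. p e \<noteq> \<zero>} then p e else \<zero>) \<in> I" by blast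
  moreover have "(\<lambda>e. if e \<in> {e. p e \<noteq> \<zero>} then p e else \<zero>) = p" by auto
  ultimately show ?thesis by simp
qed

lemma mpoly_induct [consumes 1, case_names zero step]:
  assumes "p \<in> carrier S" "Q (\<lambda>e. \<zero>)"
    and "\<And>q c d. \<lbrakk>q \<in> carrier S; Q q; c \<in> carrier R; \<forall>i\<ge>n. d i = 0\<rbrakk> \<Longrightarrow> Q (\<lambda>e. mon c d e \<oplus> q e)"
  shows "Q p"
  using mpoly_sum_mem[OF assms(1), of "Collect Q"] assms by simp

text \<open>Distributivity reduces the three factors to monomials one after the other, beginning
  with the last; for monomials the claim is associativity in \<open>R\<close> and of exponent
  addition.\<close>

lemma mult_assoc:
  assumes p: "p \<in> carrier S" and q: "q \<in> carrier S" and r: "r \<in> carrier S"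
  shows "mpoly_mult R (mpoly_mult R p q) r = mpoly_mult R p (mpoly_mult R q r)"
proof -
  have z: "mpoly_mult R x (\<lambda>e. \<zero>) = (\<lambda>e. \<zero>)" if "x \<in> carrier S" for x
    using mult_comm[OF that zero_carrier] mult_zero[OF that] by simp
  have 1: "mpoly_mult R (mpoly_mult R (mon a d) (mon b d')) r = mpoly_mult R (mon a d) (mpoly_mult R (mon b d') r)"
    if ad: "a \<in> carrier R" "\<forall>i\<ge>n. d i = 0" "b \<in> carrier R" "\<forall>i\<ge>n. d' i = 0" and "r \<in> carrier S" for a d b d' r
    using that(5)
  proof (induct r rule: mpoly_induct)
    case zero
    then show ?case using z mult_closed mon_carrier ad by simp
  next
    case (step r c e)
    have m: "mon a d \<in> carrier S" "mon b d' \<in> carrier S" "mon c e \<in> carrier S" using ad step mon_carrier by auto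
    show ?case
      using step ad m by (simp add: mult_r_distr mult_closed mult_mon mon_carrier m_assoc add.assoc)
  qed
  have 2: "mpoly_mult R (mpoly_mult R (mon a d) q) r = mpoly_mult R (mon a d) (mpoly_mult R q r)"
    if ad: "a \<in> carrier R" "\<forall>i\<ge>n. d i = 0" and "q \<in> carrier S" for a d q
    using that(3)
  proof (induct q rule: mpoly_induct)
    case zero
    then show ?case using z mult_zero mon_carrier ad r by simp
  next
    case (step q c e)
    have m: "mon a d \<in> carrier S" "mon c e \<in> carrier S" using ad step mon_carrier by auto
    show ?case
      using step ad m r by (simp add: mult_r_distr mult_l_distr mult_closed 1)
  qed
  show ?thesis using p
  proof (induct p rule: mpoly_induct)
    case zero
    then show ?case using mult_zero mult_closed q r by simp
  next
    case (step p c e)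
    have m: "mon c e \<in> carrier S" using step mon_carrier by auto
    show ?case using step m q r by (simp add: mult_l_distr mult_closed 2)
  qed
qed

lemma mult_one: "p \<in> carrier S \<Longrightarrow> mpoly_mult R (mon \<one> (\<lambda>_. 0)) p = p"
proof (induct p rule: mpoly_induct)
  case zero
  then show ?case using mult_comm[OF mon_carrier zero_carrier] mult_zero mon_carrier by simp
next
  case (step p c e)
  have m: "mon c e \<in> carrier S" "mon \<one> (\<lambda>_. 0) \<in> carrier S" using step mon_carrier by auto
  show ?case using step m by (simp add: mult_r_distr mult_mon)
qed

section \<open>Ring structure, Noetherian property and extended ideals of the polynomial
  ring\<close>

lemma S_cring: "cring S"
proof (rule cringI)
  show "abelian_group S"
  proof (rule abelian_groupI)
    fix p assume p: "p \<in> carrier S"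
    have "(\<lambda>e. \<ominus> p e) \<in> carrier S" using p unfolding S_carrier by (auto simp: a_inv_def[symmetric])
    moreover have "(\<lambda>e. \<ominus> p e \<oplus> p e) = (\<lambda>e. \<zero>)" using p by (auto simp: l_neg)
    ultimately show "\<exists>q\<in>carrier S. q \<oplus>\<^bsub>S\<^esub> p = \<zero>\<^bsub>S\<^esub>" unfolding S_add S_zero
      by (intro bexI[of _ "\<lambda>e. \<ominus> p e"])
  qed (auto simp: S_add S_zero add_closed zero_carrier a_ac)
  show "comm_monoid S"
    by (rule comm_monoidI) (auto simp: S_mult S_one mult_closed mon_carrier mult_assoc mult_one intro: mult_comm)
qed (auto simp: S_mult S_add mult_l_distr)

lemma const_mon: "mpoly_const R r = mon r (\<lambda>_. 0)"
  by (simp add: mpoly_const_def mpoly_mon_def)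

lemma const_hom: "mpoly_const R \<in> ring_hom R S"
proof (rule ring_hom_memI)
  fix x y assume "x \<in> carrier R" "y \<in> carrier R"
  then show "mpoly_const R x \<in> carrier S" "mpoly_const R (x \<otimes> y) = mpoly_const R x \<otimes>\<^bsub>S\<^esub> mpoly_const R y"
    by (simp_all add: const_mon S_mult mon_carrier mult_mon)
  show "mpoly_const R (x \<oplus> y) = mpoly_const R x \<oplus>\<^bsub>S\<^esub> mpoly_const R y"
    by (auto simp: mpoly_const_def S_add)
qed (simp add: const_mon S_one)

lemma mon_factor:
  assumes "c \<in> carrier R" "\<forall>i\<ge>n. d i = 0"
  shows "mon c d = mon \<one> d \<otimes>\<^bsub>S\<^esub> mpoly_const R c"
  unfolding const_mon S_mult using assms by (simp add: mult_mon)

text \<open>The polynomial ring is generated by the constants, a homomorphic image of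
  \<open>R\<close>, and the \<open>n\<close> variables, so the basis theorem applies. Induction on
  the total degree shows that all monomials are reached.\<close>

lemma S_noetherian:
  assumes "noetherian_ring R" shows "noetherian_ring S"
proof -
  interpret S: cring S by (rule S_cring)
  define A where "A = mpoly_const R ` carrier R"
  define \<delta> :: "nat \<Rightarrow> nat \<Rightarrow> nat" where "\<delta> i = (\<lambda>j. if j = i then 1 else 0)" for i
  define Z where "Z = (\<lambda>i. mon \<one> (\<delta> i)) ` {..<n}"
  have A: "noeth_subring S A" unfolding A_def by (rule S.noeth_subring_image[OF assms const_hom])
  have Z: "finite Z" "Z \<subseteq> carrier S" unfolding Z_def by (auto simp: \<delta>_def intro!: mon_carrier)
  have AZ: "A \<union> Z \<subseteq> carrier S" using Z const_hom unfolding A_def ring_hom_def by auto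
  define T where "T = generate_ring S (A \<union> Z)"
  have T: "subring T S" unfolding T_def by (rule S.generate_ring_is_subring[OF AZ])
  have ATZ: "A \<union> Z \<subseteq> T" unfolding T_def by (auto intro: generate_ring.incl)
  have mon1: "mon \<one> d \<in> T" if "\<forall>i\<ge>n. d i = 0" for d
    using that
  proof (induct "\<Sum>i<n. d i" arbitrary: d)
    case 0
    then have "d = (\<lambda>_. 0)" by (intro ext) (metis lessThan_iff not_le sum_eq_0_iff finite_lessThan)
    then show ?case using subringE(3)[OF T] by (simp add: S_one)
  next
    case (Suc m)
    obtain i where i: "i < n" "d i > 0"
      using Suc.hyps(2) by (metis lessThan_iff neq0_conv sum.neutral zero_less_Suc less_irrefl)
    define d' where "d' = d(i := d i - 1)"
    have d'0: "\<forall>i\<ge>n. d' i = 0" using Suc.prems i by (auto simp: d'_def)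
    have "(\<Sum>j<n. d j) = d i + (\<Sum>j\<in>{..<n} - {i}. d j)" using i by (intro sum.remove) auto
    moreover have "(\<Sum>j<n. d' j) = d' i + (\<Sum>j\<in>{..<n} - {i}. d' j)" using i by (intro sum.remove) auto
    moreover have "(\<Sum>j\<in>{..<n} - {i}. d' j) = (\<Sum>j\<in>{..<n} - {i}. d j)" by (intro sum.cong) (auto simp: d'_def)
    ultimately have "m = (\<Sum>j<n. d' j)" using Suc.hyps(2) i by (simp add: d'_def)
    then have 1: "mon \<one> d' \<in> T" using Suc.hyps(1) d'0 by blast
    have 2: "mon \<one> (\<delta> i) \<in> T" using ATZ i unfolding Z_def by blast
    have "mon \<one> (\<delta> i) \<otimes>\<^bsub>S\<^esub> mon \<one> d' = mon (\<one> \<otimes> \<one>) (\<lambda>j. \<delta> i j + d' j)"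
      unfolding S_mult by (rule mult_mon) (use d'0 i in \<open>auto simp: \<delta>_def\<close>)
    also have "(\<lambda>j. \<delta> i j + d' j) = d" using i by (auto simp: \<delta>_def d'_def)
    finally show ?case using subringE(6)[OF T 2 1] by simp
  qed
  have "p \<in> T" if p: "p \<in> carrier S" for p
  proof (rule mpoly_sum_mem[OF p])
    show "(\<lambda>e. \<zero>) \<in> T" using subringE(2)[OF T] by (simp add: S_zero)
    fix q and d :: "nat \<Rightarrow> nat" assume q: "q \<in> T" and d: "\<forall>i\<ge>n. d i = 0"
    have "mon (p d) d \<in> T" unfolding mon_factor[OF S_coeff[OF p] d]
      by (rule subringE(6)[OF T mon1[OF d]]) (use ATZ p in \<open>auto simp: A_def\<close>)
    then show "(\<lambda>e. mon (p d) d e \<oplus> q e) \<in> T" using subringE(7)[OF T _ q] by (simp add: S_add)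
  qed
  then have "T = carrier S" using S.generate_ring_incl[OF AZ] unfolding T_def by blast
  then have "noeth_subring S (carrier S)"
    using S.finitely_generated_noeth[OF A Z] unfolding T_def by simp
  then show ?thesis by (rule S.noeth_subring_carrier)
qed

text \<open>The coefficientwise description of the extended ideal; it identifies the denominators of
  the extension as the polynomials with some coefficient outside the maximal ideal.\<close>

lemma S_ideal_ext:
  assumes m: "ideal m R"
  shows "Idl\<^bsub>S\<^esub> (mpoly_const R ` m) = {p \<in> carrier S. \<forall>e. p e \<in> m}"
proof
  interpret S: cring S by (rule S_cring)
  have mc: "mpoly_const R ` m \<subseteq> carrier S"
    using const_hom ideal_carr[OF m] unfolding ring_hom_def by auto
  have "ideal {p \<in> carrier S. \<forall>e. p e \<in> m} S"
  proof (rule S.cidealI)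
    fix a x assume a: "a \<in> {p \<in> carrier S. \<forall>e. p e \<in> m}" and x: "x \<in> carrier S"
    let ?A = "{e. x e \<noteq> \<zero>}" and ?B = "{e. a e \<noteq> \<zero>}"
    have f: "finite ?A" "finite ?B" using a x S_supp by auto
    have "mpoly_mult R x a e \<in> m" for e
    proof -
      have "mpoly_mult R x a e = (\<Oplus>z\<in>pairs ?A ?B e. (case z of (e1, e2) \<Rightarrow> x e1 \<otimes> a e2))"
        by (rule mult_pairs[OF x _ f]) (use a in auto)
      also have "\<dots> = lincomb R (pairs ?A ?B e) (\<lambda>y. x (fst y)) (\<lambda>y. a (snd y))"
        unfolding lincomb_def by (rule finsum_cong') (use a x in auto)
      also have "\<dots> \<in> m" by (rule lincomb_mem[OF m finite_pairs[OF f]])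
        (use a x in \<open>auto intro: ideal_lmult_mem[OF m]\<close>)
      finally show ?thesis .
    qed
    then show "x \<otimes>\<^bsub>S\<^esub> a \<in> {p \<in> carrier S. \<forall>e. p e \<in> m}"
      using a x mult_closed by (simp add: S_mult)
  qed (auto simp: S_zero S_add zero_carrier add_closed ideal_zero_mem[OF m] ideal_add_mem[OF m])
  moreover have "mpoly_const R ` m \<subseteq> {p \<in> carrier S. \<forall>e. p e \<in> m}"
    using mc ideal_zero_mem[OF m] by (auto simp: mpoly_const_def)
  ultimately show "Idl\<^bsub>S\<^esub> (mpoly_const R ` m) \<subseteq> {p \<in> carrier S. \<forall>e. p e \<in> m}" by (rule S.genideal_minimal)
  note I = S.genideal_ideal[OF mc]
  show "{p \<in> carrier S. \<forall>e. p e \<in> m} \<subseteq> Idl\<^bsub>S\<^esub> (mpoly_const R ` m)"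
  proof
    fix p assume p: "p \<in> {p \<in> carrier S. \<forall>e. p e \<in> m}"
    then have pS: "p \<in> carrier S" by simp
    show "p \<in> Idl\<^bsub>S\<^esub> (mpoly_const R ` m)"
    proof (rule mpoly_sum_mem[OF pS])
      show "(\<lambda>e. \<zero>) \<in> Idl\<^bsub>S\<^esub> (mpoly_const R ` m)" using S.ideal_zero_mem[OF I] by (simp add: S_zero)
      fix q and d :: "nat \<Rightarrow> nat" assume q: "q \<in> Idl\<^bsub>S\<^esub> (mpoly_const R ` m)" and d: "\<forall>i\<ge>n. d i = 0"
      have "mpoly_const R (p d) \<in> Idl\<^bsub>S\<^esub> (mpoly_const R ` m)" using p S.genideal_self[OF mc] by blast
      then have "mon (p d) d \<in> Idl\<^bsub>S\<^esub> (mpoly_const R ` m)"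
        unfolding mon_factor[OF S_coeff[OF pS] d] using d by (intro S.ideal_lmult_mem[OF I] mon_carrier) auto
      then show "(\<lambda>e. mon (p d) d e \<oplus> q e) \<in> Idl\<^bsub>S\<^esub> (mpoly_const R ` m)"
        using S.ideal_add_mem[OF I _ q] by (simp add: S_add)
    qed
  qed
qed

text \<open>Among the pairs of exponents whose coefficients survive modulo \<open>m\<close> there is one whose sum is
  attained only once, so the corresponding coefficient of the product survives as well.\<close>

lemma S_ideal_ext_prime:
  assumes m: "primeideal m R" and p: "p \<in> carrier S" and q: "q \<in> carrier S"
    and pq: "\<forall>e. mpoly_mult R p q e \<in> m"
  shows "(\<forall>e. p e \<in> m) \<or> (\<forall>e. q e \<in> m)"
proof (rule ccontr)
  assume neg: "\<not> ?thesis"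
  have mi: "ideal m R" using m by (rule primeideal.axioms(1))
  let ?A = "{e. p e \<noteq> \<zero>}" and ?B = "{e. q e \<noteq> \<zero>}"
  have f: "finite ?A" "finite ?B" using p q S_supp by auto
  define A where "A = {e. p e \<notin> m}"
  define B where "B = {e. q e \<notin> m}"
  have AB: "A \<subseteq> ?A" "B \<subseteq> ?B" using ideal_zero_mem[OF mi] unfolding A_def B_def by auto
  have "\<exists>a\<in>A. \<exists>b\<in>B. \<forall>a'\<in>A. \<forall>b'\<in>B. (\<forall>i. a' i + b' i = a i + b i) \<longrightarrow> a' = a \<and> b' = b"
  proof (rule exists_unique_sum[where n = n])
    show "finite A" "finite B" using AB f finite_subset by blast+
    show "A \<noteq> {}" "B \<noteq> {}" using neg unfolding A_def B_def by auto
    have "p e \<noteq> \<zero> \<longrightarrow> (\<forall>i\<ge>n. e i = 0)" "q e \<noteq> \<zero> \<longrightarrow> (\<forall>i\<ge>n. e i = 0)" for e using p q unfolding S_carrier by auto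
    then show "\<And>a a' i. \<lbrakk>a \<in> A; a' \<in> A; n \<le> i\<rbrakk> \<Longrightarrow> a i = a' i"
      "\<And>b b' i. \<lbrakk>b \<in> B; b' \<in> B; n \<le> i\<rbrakk> \<Longrightarrow> b i = b' i"
      using AB by (metis (mono_tags, lifting) mem_Collect_eq subsetD)+
  qed
  then obtain a b where ab: "a \<in> A" "b \<in> B"
    "\<And>a' b'. \<lbrakk>a' \<in> A; b' \<in> B; \<forall>i. a' i + b' i = a i + b i\<rbrakk> \<Longrightarrow> a' = a \<and> b' = b" by blast
  define e where "e = (\<lambda>i. a i + b i)"
  define D where "D = pairs ?A ?B e - {(a, b)}"
  have D: "pairs ?A ?B e = insert (a, b) D" "(a, b) \<notin> D" "finite D"
    using ab(1,2) AB finite_pairs[OF f] unfolding D_def pairs_def e_def by auto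
  have "(\<Oplus>z\<in>D. (case z of (e1, e2) \<Rightarrow> p e1 \<otimes> q e2)) = lincomb R D (\<lambda>y. p (fst y)) (\<lambda>y. q (snd y))"
    unfolding lincomb_def by (rule finsum_cong') (use p q in auto)
  also have "\<dots> \<in> m"
  proof (rule lincomb_mem[OF mi D(3)])
    fix y assume y: "y \<in> D"
    obtain e1 e2 where e: "y = (e1, e2)" by force
    have ne: "\<forall>i. e1 i + e2 i = a i + b i" "(e1, e2) \<noteq> (a, b)" using y e unfolding D_def pairs_def e_def by auto
    then have "p e1 \<in> m \<or> q e2 \<in> m" using ab(3)[of e1 e2] unfolding A_def B_def by auto
    then show "p (fst y) \<otimes> q (snd y) \<in> m"
      using e p q ideal_lmult_mem[OF mi] ideal_rmult_mem[OF mi] by auto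
  qed (use p q in auto)
  finally have rest: "(\<Oplus>z\<in>D. (case z of (e1, e2) \<Rightarrow> p e1 \<otimes> q e2)) \<in> m" .
  have "mpoly_mult R p q e = (\<Oplus>z\<in>insert (a, b) D. (case z of (e1, e2) \<Rightarrow> p e1 \<otimes> q e2))"
    unfolding D(1)[symmetric] by (rule mult_pairs[OF p q f]) auto
  also have "\<dots> = p a \<otimes> q b \<oplus> (\<Oplus>z\<in>D. (case z of (e1, e2) \<Rightarrow> p e1 \<otimes> q e2))"
    by (subst finsum_insert) (use D p q in auto)
  finally have "p a \<otimes> q b \<in> m"
    using pq rest ideal_cancel_right[OF mi] p q by (metis S_coeff m_closed)
  then have "p a \<in> m \<or> q b \<in> m" using primeideal.I_prime[OF m] p q by simp
  then show False using ab(1,2) unfolding A_def B_def by blast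
qed

end

section \<open>Localization\<close>

locale localized = cring A for A (structure) + fixes U :: "'a set"
  assumes U_sub: "U \<subseteq> carrier A" and U_one: "\<one> \<in> U"
    and U_mult: "\<And>s t. \<lbrakk>s \<in> U; t \<in> U\<rbrakk> \<Longrightarrow> s \<otimes> t \<in> U"
begin

abbreviation L where "L \<equiv> localization A U"
abbreviation cls where "cls \<equiv> loc_cls A U"
abbreviation frac where "frac a \<equiv> cls a \<one>"

lemma U_carr: "s \<in> U \<Longrightarrow> s \<in> carrier A" using U_sub by blast

lemma rel_iff: "((a, s), (b, t)) \<in> loc_rel A U \<longleftrightarrow> a \<in> carrier A \<and> b \<in> carrier A \<and> s \<in> U \<and> t \<in> U
    \<and> (\<exists>u\<in>U. u \<otimes> (a \<otimes> t \<ominus> b \<otimes> s) = \<zero>)"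
  unfolding loc_rel_def by blast

lemma rel_refl: "\<lbrakk>a \<in> carrier A; s \<in> U\<rbrakk> \<Longrightarrow> ((a, s), (a, s)) \<in> loc_rel A U"
  unfolding rel_iff using U_one U_carr by (auto intro!: bexI[of _ \<one>] simp: a_minus_def r_neg)

lemma rel_sym: assumes "((a, s), (b, t)) \<in> loc_rel A U" shows "((b, t), (a, s)) \<in> loc_rel A U"
proof -
  obtain u where u: "u \<in> U" "u \<otimes> (a \<otimes> t \<ominus> b \<otimes> s) = \<zero>" using assms unfolding rel_iff by blast
  have c: "a \<in> carrier A" "b \<in> carrier A" "s \<in> carrier A" "t \<in> carrier A" "u \<in> carrier A"
    using assms u U_carr unfolding rel_iff by auto
  have "u \<otimes> (b \<otimes> s \<ominus> a \<otimes> t) = \<ominus> (u \<otimes> (a \<otimes> t \<ominus> b \<otimes> s))" using c by algebra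
  then have "u \<otimes> (b \<otimes> s \<ominus> a \<otimes> t) = \<zero>" using u(2) by simp
  then show ?thesis using assms u(1) unfolding rel_iff by blast
qed

lemma rel_trans:
  assumes "((a, s), (b, t)) \<in> loc_rel A U" "((b, t), (c, w)) \<in> loc_rel A U"
  shows "((a, s), (c, w)) \<in> loc_rel A U"
proof -
  obtain u where u: "u \<in> U" "u \<otimes> (a \<otimes> t \<ominus> b \<otimes> s) = \<zero>" using assms(1) unfolding rel_iff by blast
  obtain v where v: "v \<in> U" "v \<otimes> (b \<otimes> w \<ominus> c \<otimes> t) = \<zero>" using assms(2) unfolding rel_iff by blast
  have U: "s \<in> U" "t \<in> U" "w \<in> U" and ac: "a \<in> carrier A" "c \<in> carrier A"
    using assms unfolding rel_iff by auto
  have cr: "a \<in> carrier A" "b \<in> carrier A" "c \<in> carrier A" "s \<in> carrier A" "t \<in> carrier A" "w \<in> carrier A"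
    "u \<in> carrier A" "v \<in> carrier A"
    using assms u v U_carr unfolding rel_iff by auto
  have "(u \<otimes> v \<otimes> t) \<otimes> (a \<otimes> w \<ominus> c \<otimes> s)
     = (v \<otimes> w) \<otimes> (u \<otimes> (a \<otimes> t \<ominus> b \<otimes> s)) \<oplus> (u \<otimes> s) \<otimes> (v \<otimes> (b \<otimes> w \<ominus> c \<otimes> t))"
    using cr by algebra
  then have "(u \<otimes> v \<otimes> t) \<otimes> (a \<otimes> w \<ominus> c \<otimes> s) = \<zero>" using u(2) v(2) cr by simp
  moreover have "u \<otimes> v \<otimes> t \<in> U" using u v U U_mult by blast
  ultimately show ?thesis using U ac unfolding rel_iff by blast
qed

lemma cls_iff: "(b, t) \<in> cls a s \<longleftrightarrow> ((a, s), (b, t)) \<in> loc_rel A U"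
  unfolding loc_cls_def by blast

lemma cls_eqI: assumes "((a, s), (b, t)) \<in> loc_rel A U" shows "cls a s = cls b t"
proof -
  have "(c, w) \<in> cls a s \<longleftrightarrow> (c, w) \<in> cls b t" for c w
    unfolding cls_iff using assms rel_trans rel_sym by blast
  then show ?thesis by (intro Set.set_eqI) auto
qed

lemma cls_eqD: "\<lbrakk>cls a s = cls b t; b \<in> carrier A; t \<in> U\<rbrakk> \<Longrightarrow> ((a, s), (b, t)) \<in> loc_rel A U"
  using rel_refl[of b t] cls_iff by blast

lemma cls_eq:
  assumes "a \<in> carrier A" "b \<in> carrier A" "s \<in> U" "t \<in> U" "a \<otimes> t = b \<otimes> s"
  shows "cls a s = cls b t"
proof (rule cls_eqI)
  have "\<one> \<otimes> (a \<otimes> t \<ominus> b \<otimes> s) = \<zero>" using assms U_carr by (simp add: a_minus_def r_neg)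
  then show "((a, s), (b, t)) \<in> loc_rel A U" using assms U_one unfolding rel_iff by blast
qed

lemma rep_cls:
  assumes "a \<in> carrier A" "s \<in> U"
  shows "((a, s), loc_rep (cls a s)) \<in> loc_rel A U"
proof -
  have "(a, s) \<in> cls a s" using rel_refl[OF assms] cls_iff by blast
  then have "loc_rep (cls a s) \<in> cls a s" unfolding loc_rep_def by (rule someI)
  then show ?thesis unfolding loc_cls_def by blast
qed

text \<open>The product is defined through arbitrarily chosen representatives, so independence of
  the choice has to be shown. If \<open>u\<close> and \<open>v\<close> witness the two equivalences,
  \<open>u v\<close> witnesses the one between the products.\<close>

lemma mult_cls:
  assumes "a \<in> carrier A" "s \<in> U" "b \<in> carrier A" "t \<in> U"
  shows "cls a s \<otimes>\<^bsub>L\<^esub> cls b t = cls (a \<otimes> b) (s \<otimes> t)"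
proof -
  obtain a' s' where r1: "loc_rep (cls a s) = (a', s')" by force
  obtain b' t' where r2: "loc_rep (cls b t) = (b', t')" by force
  have R1: "((a, s), (a', s')) \<in> loc_rel A U" using rep_cls[OF assms(1,2)] r1 by simp
  have R2: "((b, t), (b', t')) \<in> loc_rel A U" using rep_cls[OF assms(3,4)] r2 by simp
  obtain u where u: "u \<in> U" "u \<otimes> (a \<otimes> s' \<ominus> a' \<otimes> s) = \<zero>" using R1 unfolding rel_iff by blast
  obtain v where v: "v \<in> U" "v \<otimes> (b \<otimes> t' \<ominus> b' \<otimes> t) = \<zero>" using R2 unfolding rel_iff by blast
  have p: "a' \<in> carrier A" "s' \<in> U" "b' \<in> carrier A" "t' \<in> U" using R1 R2 unfolding rel_iff by auto
  have cr: "a \<in> carrier A" "b \<in> carrier A" "s \<in> carrier A" "t \<in> carrier A"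
    "a' \<in> carrier A" "b' \<in> carrier A" "s' \<in> carrier A" "t' \<in> carrier A" "u \<in> carrier A" "v \<in> carrier A"
    using assms p u v U_carr by auto
  have "(u \<otimes> v) \<otimes> ((a \<otimes> b) \<otimes> (s' \<otimes> t') \<ominus> (a' \<otimes> b') \<otimes> (s \<otimes> t))
    = (v \<otimes> b \<otimes> t') \<otimes> (u \<otimes> (a \<otimes> s' \<ominus> a' \<otimes> s)) \<oplus> (u \<otimes> a' \<otimes> s) \<otimes> (v \<otimes> (b \<otimes> t' \<ominus> b' \<otimes> t))"
    using cr by algebra
  then have "(u \<otimes> v) \<otimes> ((a \<otimes> b) \<otimes> (s' \<otimes> t') \<ominus> (a' \<otimes> b') \<otimes> (s \<otimes> t)) = \<zero>" using u(2) v(2) cr by simp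
  then have "((a \<otimes> b, s \<otimes> t), (a' \<otimes> b', s' \<otimes> t')) \<in> loc_rel A U"
    unfolding rel_iff using assms p cr U_mult[OF u(1) v(1)] U_mult by (auto intro!: bexI[of _ "u \<otimes> v"])
  then have "cls (a \<otimes> b) (s \<otimes> t) = cls (a' \<otimes> b') (s' \<otimes> t')" by (rule cls_eqI)
  then show ?thesis by (simp only: localization_def loc_mult_def r1 r2 fst_conv snd_conv monoid.simps)
qed

lemma add_cls:
  assumes "a \<in> carrier A" "s \<in> U" "b \<in> carrier A" "t \<in> U"
  shows "cls a s \<oplus>\<^bsub>L\<^esub> cls b t = cls (a \<otimes> t \<oplus> b \<otimes> s) (s \<otimes> t)"
proof -
  obtain a' s' where r1: "loc_rep (cls a s) = (a', s')" by force
  obtain b' t' where r2: "loc_rep (cls b t) = (b', t')" by force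
  have R1: "((a, s), (a', s')) \<in> loc_rel A U" using rep_cls[OF assms(1,2)] r1 by simp
  have R2: "((b, t), (b', t')) \<in> loc_rel A U" using rep_cls[OF assms(3,4)] r2 by simp
  obtain u where u: "u \<in> U" "u \<otimes> (a \<otimes> s' \<ominus> a' \<otimes> s) = \<zero>" using R1 unfolding rel_iff by blast
  obtain v where v: "v \<in> U" "v \<otimes> (b \<otimes> t' \<ominus> b' \<otimes> t) = \<zero>" using R2 unfolding rel_iff by blast
  have p: "a' \<in> carrier A" "s' \<in> U" "b' \<in> carrier A" "t' \<in> U" using R1 R2 unfolding rel_iff by auto
  have cr: "a \<in> carrier A" "b \<in> carrier A" "s \<in> carrier A" "t \<in> carrier A"
    "a' \<in> carrier A" "b' \<in> carrier A" "s' \<in> carrier A" "t' \<in> carrier A" "u \<in> carrier A" "v \<in> carrier A"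
    using assms p u v U_carr by auto
  have "(u \<otimes> v) \<otimes> ((a \<otimes> t \<oplus> b \<otimes> s) \<otimes> (s' \<otimes> t') \<ominus> (a' \<otimes> t' \<oplus> b' \<otimes> s') \<otimes> (s \<otimes> t))
    = (v \<otimes> t \<otimes> t') \<otimes> (u \<otimes> (a \<otimes> s' \<ominus> a' \<otimes> s)) \<oplus> (u \<otimes> s \<otimes> s') \<otimes> (v \<otimes> (b \<otimes> t' \<ominus> b' \<otimes> t))"
    using cr by algebra
  then have "(u \<otimes> v) \<otimes> ((a \<otimes> t \<oplus> b \<otimes> s) \<otimes> (s' \<otimes> t') \<ominus> (a' \<otimes> t' \<oplus> b' \<otimes> s') \<otimes> (s \<otimes> t)) = \<zero>"
    using u(2) v(2) cr by simp
  then have "((a \<otimes> t \<oplus> b \<otimes> s, s \<otimes> t), (a' \<otimes> t' \<oplus> b' \<otimes> s', s' \<otimes> t')) \<in> loc_rel A U"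
    unfolding rel_iff using assms p cr U_mult[OF u(1) v(1)] U_mult by (auto intro!: bexI[of _ "u \<otimes> v"])
  then have "cls (a \<otimes> t \<oplus> b \<otimes> s) (s \<otimes> t) = cls (a' \<otimes> t' \<oplus> b' \<otimes> s') (s' \<otimes> t')" by (rule cls_eqI)
  then show ?thesis by (simp only: localization_def loc_add_def r1 r2 fst_conv snd_conv ring.simps)
qed

lemma L_carrier: "x \<in> carrier L \<longleftrightarrow> (\<exists>a s. x = cls a s \<and> a \<in> carrier A \<and> s \<in> U)"
  by (simp only: localization_def partial_object.simps mem_Collect_eq)

lemma L_one: "\<one>\<^bsub>L\<^esub> = frac \<one>" by (simp only: localization_def monoid.simps)
lemma L_zero: "\<zero>\<^bsub>L\<^esub> = frac \<zero>" by (simp only: localization_def ring.simps)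

lemma cls_carrier: "\<lbrakk>a \<in> carrier A; s \<in> U\<rbrakk> \<Longrightarrow> cls a s \<in> carrier L"
  unfolding L_carrier by blast

lemma L_cases:
  assumes "x \<in> carrier L" obtains a s where "x = cls a s" "a \<in> carrier A" "s \<in> U" "s \<in> carrier A"
  using assms U_carr unfolding L_carrier by blast

lemma L_cring: "cring L"
proof (rule cringI)
  show "abelian_group L"
  proof (rule abelian_groupI)
    fix x y assume x: "x \<in> carrier L" and y: "y \<in> carrier L"
    obtain a s where a: "x = cls a s" "a \<in> carrier A" "s \<in> U" "s \<in> carrier A" using L_cases[OF x] .
    obtain b t where b: "y = cls b t" "b \<in> carrier A" "t \<in> U" "t \<in> carrier A" using L_cases[OF y] .
    show "x \<oplus>\<^bsub>L\<^esub> y \<in> carrier L" using a b U_mult by (simp add: add_cls cls_carrier)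
    show "x \<oplus>\<^bsub>L\<^esub> y = y \<oplus>\<^bsub>L\<^esub> x"
      using a b by (simp add: add_cls a_comm m_comm)
    fix z assume z: "z \<in> carrier L"
    obtain c w where c: "z = cls c w" "c \<in> carrier A" "w \<in> U" "w \<in> carrier A" using L_cases[OF z] .
    have "x \<oplus>\<^bsub>L\<^esub> y \<oplus>\<^bsub>L\<^esub> z = cls ((a \<otimes> t \<oplus> b \<otimes> s) \<otimes> w \<oplus> c \<otimes> (s \<otimes> t)) (s \<otimes> t \<otimes> w)"
      using a b c U_mult by (simp add: add_cls)
    also have "(a \<otimes> t \<oplus> b \<otimes> s) \<otimes> w \<oplus> c \<otimes> (s \<otimes> t) = a \<otimes> (t \<otimes> w) \<oplus> (b \<otimes> w \<oplus> c \<otimes> t) \<otimes> s"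
      using a(2,4) b(2,4) c(2,4) by algebra
    also have "s \<otimes> t \<otimes> w = s \<otimes> (t \<otimes> w)" using a(4) b(4) c(4) by (rule m_assoc)
    also have "cls (a \<otimes> (t \<otimes> w) \<oplus> (b \<otimes> w \<oplus> c \<otimes> t) \<otimes> s) (s \<otimes> (t \<otimes> w)) = x \<oplus>\<^bsub>L\<^esub> (y \<oplus>\<^bsub>L\<^esub> z)"
      using a b c U_mult by (simp add: add_cls)
    finally show "x \<oplus>\<^bsub>L\<^esub> y \<oplus>\<^bsub>L\<^esub> z = x \<oplus>\<^bsub>L\<^esub> (y \<oplus>\<^bsub>L\<^esub> z)" .
  next
    fix x assume x: "x \<in> carrier L"
    obtain a s where a: "x = cls a s" "a \<in> carrier A" "s \<in> U" "s \<in> carrier A" using L_cases[OF x] .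
    show "\<zero>\<^bsub>L\<^esub> \<oplus>\<^bsub>L\<^esub> x = x" using a U_one by (simp add: L_zero add_cls)
    have "cls (\<ominus> a) s \<oplus>\<^bsub>L\<^esub> cls a s = cls ((\<ominus> a) \<otimes> s \<oplus> a \<otimes> s) (s \<otimes> s)" using a by (simp add: add_cls)
    also have "(\<ominus> a) \<otimes> s \<oplus> a \<otimes> s = \<zero>" using a(2,4) by algebra
    also have "cls \<zero> (s \<otimes> s) = frac \<zero>" by (rule cls_eq) (use a U_one U_mult in auto)
    finally show "\<exists>y\<in>carrier L. y \<oplus>\<^bsub>L\<^esub> x = \<zero>\<^bsub>L\<^esub>" unfolding L_zero a(1)
      by (intro bexI[of _ "cls (\<ominus> a) s"] cls_carrier) (use a in auto)
  qed (use L_zero cls_carrier U_one in auto)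
  show "comm_monoid L"
  proof (rule comm_monoidI)
    fix x y assume x: "x \<in> carrier L" and y: "y \<in> carrier L"
    obtain a s where a: "x = cls a s" "a \<in> carrier A" "s \<in> U" "s \<in> carrier A" using L_cases[OF x] .
    obtain b t where b: "y = cls b t" "b \<in> carrier A" "t \<in> U" "t \<in> carrier A" using L_cases[OF y] .
    show "x \<otimes>\<^bsub>L\<^esub> y \<in> carrier L" using a b U_mult by (simp add: mult_cls cls_carrier)
    show "x \<otimes>\<^bsub>L\<^esub> y = y \<otimes>\<^bsub>L\<^esub> x" using a b by (simp add: mult_cls m_comm)
    fix z assume z: "z \<in> carrier L"
    obtain c w where c: "z = cls c w" "c \<in> carrier A" "w \<in> U" "w \<in> carrier A" using L_cases[OF z] .
    show "x \<otimes>\<^bsub>L\<^esub> y \<otimes>\<^bsub>L\<^esub> z = x \<otimes>\<^bsub>L\<^esub> (y \<otimes>\<^bsub>L\<^esub> z)" using a b c U_mult by (simp add: mult_cls m_assoc)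
  next
    fix x assume x: "x \<in> carrier L"
    obtain a s where a: "x = cls a s" "a \<in> carrier A" "s \<in> U" "s \<in> carrier A" using L_cases[OF x] .
    show "\<one>\<^bsub>L\<^esub> \<otimes>\<^bsub>L\<^esub> x = x" using a U_one by (simp add: L_one mult_cls)
  qed (use L_one cls_carrier U_one in auto)
  fix x y z assume x: "x \<in> carrier L" and y: "y \<in> carrier L" and z: "z \<in> carrier L"
  obtain a s where a: "x = cls a s" "a \<in> carrier A" "s \<in> U" "s \<in> carrier A" using L_cases[OF x] .
  obtain b t where b: "y = cls b t" "b \<in> carrier A" "t \<in> U" "t \<in> carrier A" using L_cases[OF y] .
  obtain c w where c: "z = cls c w" "c \<in> carrier A" "w \<in> U" "w \<in> carrier A" using L_cases[OF z] .
  have "(x \<oplus>\<^bsub>L\<^esub> y) \<otimes>\<^bsub>L\<^esub> z = cls ((a \<otimes> t \<oplus> b \<otimes> s) \<otimes> c) (s \<otimes> t \<otimes> w)"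
    using a b c U_mult by (simp add: add_cls mult_cls)
  also have "\<dots> = cls ((a \<otimes> c) \<otimes> (t \<otimes> w) \<oplus> (b \<otimes> c) \<otimes> (s \<otimes> w)) ((s \<otimes> w) \<otimes> (t \<otimes> w))"
  proof (rule cls_eq)
    show "((a \<otimes> t \<oplus> b \<otimes> s) \<otimes> c) \<otimes> ((s \<otimes> w) \<otimes> (t \<otimes> w))
       = ((a \<otimes> c) \<otimes> (t \<otimes> w) \<oplus> (b \<otimes> c) \<otimes> (s \<otimes> w)) \<otimes> (s \<otimes> t \<otimes> w)"
      using a(2,4) b(2,4) c(2,4) by algebra
  qed (use a b c U_mult in auto)
  also have "\<dots> = x \<otimes>\<^bsub>L\<^esub> z \<oplus>\<^bsub>L\<^esub> y \<otimes>\<^bsub>L\<^esub> z" using a b c U_mult by (simp add: add_cls mult_cls)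
  finally show "(x \<oplus>\<^bsub>L\<^esub> y) \<otimes>\<^bsub>L\<^esub> z = x \<otimes>\<^bsub>L\<^esub> z \<oplus>\<^bsub>L\<^esub> y \<otimes>\<^bsub>L\<^esub> z" .
qed

lemma frac_hom: "frac \<in> ring_hom A L"
  using U_one by (intro ring_hom_memI) (auto simp: cls_carrier mult_cls add_cls L_one)

lemma cls_factor: "\<lbrakk>a \<in> carrier A; s \<in> U\<rbrakk> \<Longrightarrow> cls a s = cls \<one> s \<otimes>\<^bsub>L\<^esub> frac a"
  using U_one U_carr by (simp add: mult_cls)

lemma frac_factor:
  assumes "a \<in> carrier A" "s \<in> U" shows "frac a = frac s \<otimes>\<^bsub>L\<^esub> cls a s"
proof -
  have "frac s \<otimes>\<^bsub>L\<^esub> cls a s = cls (s \<otimes> a) (\<one> \<otimes> s)" using assms U_one U_carr by (simp add: mult_cls)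
  also have "\<dots> = frac a" by (rule cls_eq) (use assms U_one U_carr in \<open>auto simp: m_comm\<close>)
  finally show ?thesis ..
qed

lemma contraction_ideal:
  assumes I: "ideal I L" shows "ideal {a \<in> carrier A. frac a \<in> I} A"
proof -
  interpret L: cring L by (rule L_cring)
  show ?thesis
  proof (rule cidealI)
    show "\<zero> \<in> {a \<in> carrier A. frac a \<in> I}" using L.ideal_zero_mem[OF I] by (simp add: L_zero)
    fix a b assume a: "a \<in> {a \<in> carrier A. frac a \<in> I}"
    show "a \<oplus> b \<in> {a \<in> carrier A. frac a \<in> I}" if b: "b \<in> {a \<in> carrier A. frac a \<in> I}"
      using L.ideal_add_mem[OF I, of "frac a" "frac b"] ring_hom_add[OF frac_hom, of a b] a b by simp
    show "b \<otimes> a \<in> {a \<in> carrier A. frac a \<in> I}" if b: "b \<in> carrier A"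
      using L.ideal_lmult_mem[OF I, of "frac a" "frac b"] ring_hom_mult[OF frac_hom, of b a] a b
        cls_carrier U_one by simp
  qed auto
qed

lemma extension_mem:
  assumes G: "G \<subseteq> carrier A" and a: "a \<in> Idl G" and s: "s \<in> U"
  shows "cls a s \<in> Idl\<^bsub>L\<^esub> (frac ` G)"
proof -
  interpret L: cring L by (rule L_cring)
  have fG: "frac ` G \<subseteq> carrier L" using G cls_carrier U_one by auto
  note I = L.genideal_ideal[OF fG]
  have "Idl G \<subseteq> {a \<in> carrier A. frac a \<in> Idl\<^bsub>L\<^esub> (frac ` G)}"
    by (rule genideal_minimal[OF contraction_ideal[OF I]]) (use G L.genideal_self[OF fG] in auto)
  then have aG: "a \<in> carrier A" "frac a \<in> Idl\<^bsub>L\<^esub> (frac ` G)" using a by auto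
  show ?thesis unfolding cls_factor[OF aG(1) s]
    by (rule L.ideal_lmult_mem[OF I aG(2) cls_carrier[OF one_closed s]])
qed

text \<open>Every ideal of the localization is extended from its contraction, since
  \<open>a / s\<close> and \<open>a / 1\<close> differ by a unit. Generators of the contraction
  therefore generate the ideal.\<close>

lemma L_noetherian:
  assumes "noetherian_ring A" shows "noetherian_ring L"
proof -
  interpret L: cring L by (rule L_cring)
  show ?thesis
  proof (rule L.noetherian_ringI)
    fix I assume I: "ideal I L"
    obtain G where G: "G \<subseteq> carrier A" "finite G" "{a \<in> carrier A. frac a \<in> I} = Idl G"
      using noetherian_ring.finetely_gen[OF assms contraction_ideal[OF I]] by blast
    have fG: "frac ` G \<subseteq> carrier L" using G cls_carrier U_one by auto
    have "frac ` G \<subseteq> I" using G(3) genideal_self[OF G(1)] by blast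
    then have "Idl\<^bsub>L\<^esub> (frac ` G) \<subseteq> I" by (rule L.genideal_minimal[OF I])
    moreover have "I \<subseteq> Idl\<^bsub>L\<^esub> (frac ` G)"
    proof
      fix x assume x: "x \<in> I"
      obtain a s where a: "x = cls a s" "a \<in> carrier A" "s \<in> U" using L_cases[OF L.ideal_carr[OF I x]] by metis
      have "frac a \<in> I"
        using frac_factor[OF a(2,3)] L.ideal_lmult_mem[OF I x, of "frac s"] cls_carrier U_one U_carr a by simp
      then have "a \<in> Idl G" using a G(3) by blast
      then show "x \<in> Idl\<^bsub>L\<^esub> (frac ` G)" unfolding a(1) by (rule extension_mem[OF G(1) _ a(3)])
    qed
    ultimately show "\<exists>B\<subseteq>carrier L. finite B \<and> I = Idl\<^bsub>L\<^esub> B" using fG G(2) by blast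
  qed
qed

end

section \<open>Localization at a prime ideal\<close>

locale localized_prime = localized A "carrier A - P" for A (structure) and P +
  assumes P: "primeideal P A"
begin

definition M where "M = {cls a s | a s. a \<in> P \<and> s \<in> carrier A - P}"

lemma P_ideal: "ideal P A" using P by (rule primeideal.axioms(1))

lemma P_carr: "a \<in> P \<Longrightarrow> a \<in> carrier A" using ideal_carr[OF P_ideal] .

text \<open>Independence of the representative: an equality of fractions gives
  \<open>u (a t - b s) = 0\<close> with \<open>u\<close> and \<open>t\<close> outside
  \<open>P\<close>, and primality cancels both.\<close>

lemma cls_M:
  assumes "a \<in> carrier A" "s \<in> carrier A - P" shows "cls a s \<in> M \<longleftrightarrow> a \<in> P"
proof
  assume "cls a s \<in> M"
  then obtain b t where b: "cls a s = cls b t" "b \<in> P" "t \<in> carrier A - P" unfolding M_def by blast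
  then obtain u where u: "u \<in> carrier A - P" "u \<otimes> (a \<otimes> t \<ominus> b \<otimes> s) = \<zero>"
    using cls_eqD[OF b(1) P_carr[OF b(2)] b(3)] unfolding rel_iff by blast
  have "u \<otimes> (a \<otimes> t \<ominus> b \<otimes> s) \<in> P" using u(2) ideal_zero_mem[OF P_ideal] by simp
  then have "a \<otimes> t \<ominus> b \<otimes> s \<in> P"
    using primeideal.I_prime[OF P, of u "a \<otimes> t \<ominus> b \<otimes> s"] u(1) assms b P_carr by auto
  moreover have bs: "b \<otimes> s \<in> P" using b ideal_rmult_mem[OF P_ideal] assms by blast
  ultimately have "(a \<otimes> t \<ominus> b \<otimes> s) \<oplus> b \<otimes> s \<in> P" using ideal_add_mem[OF P_ideal] by blast
  moreover have "(a \<otimes> t \<ominus> b \<otimes> s) \<oplus> b \<otimes> s = a \<otimes> t"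
  proof -
    have "a \<otimes> t \<in> carrier A" "b \<otimes> s \<in> carrier A" using assms b P_carr by auto
    then show ?thesis by algebra
  qed
  ultimately show "a \<in> P" using primeideal.I_prime[OF P, of a t] assms b by auto
next
  assume "a \<in> P" then show "cls a s \<in> M" unfolding M_def using assms by blast
qed

lemma M_ideal: "ideal M L"
proof -
  interpret L: cring L by (rule L_cring)
  show ?thesis
  proof (rule L.cidealI)
    show "M \<subseteq> carrier L" unfolding M_def using cls_carrier P_carr by blast
    show "\<zero>\<^bsub>L\<^esub> \<in> M" unfolding L_zero using cls_M U_one ideal_zero_mem[OF P_ideal] by simp
    fix x y assume "x \<in> M"
    then obtain a s where a: "x = cls a s" "a \<in> P" "s \<in> carrier A - P" unfolding M_def by blast
    {
      assume "y \<in> M"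
      then obtain b t where b: "y = cls b t" "b \<in> P" "t \<in> carrier A - P" unfolding M_def by blast
      have "x \<oplus>\<^bsub>L\<^esub> y = cls (a \<otimes> t \<oplus> b \<otimes> s) (s \<otimes> t)" using a b P_carr by (simp add: add_cls)
      moreover have "a \<otimes> t \<oplus> b \<otimes> s \<in> P"
        using a b ideal_add_mem[OF P_ideal] ideal_rmult_mem[OF P_ideal] by blast
      ultimately show "x \<oplus>\<^bsub>L\<^esub> y \<in> M" unfolding M_def using U_mult[OF a(3) b(3)] by blast
    }
    {
      assume "y \<in> carrier L"
      then obtain b t where b: "y = cls b t" "b \<in> carrier A" "t \<in> carrier A - P" using L_cases by metis
      have "y \<otimes>\<^bsub>L\<^esub> x = cls (b \<otimes> a) (t \<otimes> s)" using a b P_carr by (simp add: mult_cls)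
      then show "y \<otimes>\<^bsub>L\<^esub> x \<in> M"
        unfolding M_def using U_mult[OF b(3) a(3)] ideal_lmult_mem[OF P_ideal a(2) b(2)] by blast
    }
  qed
qed

lemma proper_sub_M:
  assumes N: "ideal N L" "N \<noteq> carrier L" shows "N \<subseteq> M"
proof (rule ccontr)
  interpret L: cring L by (rule L_cring)
  assume "\<not> N \<subseteq> M"
  then obtain x where x: "x \<in> N" "x \<notin> M" by blast
  obtain a s where a: "x = cls a s" "a \<in> carrier A" "s \<in> carrier A - P"
    using L_cases[OF L.ideal_carr[OF N(1) x(1)]] by metis
  have aP: "a \<in> carrier A - P" using x(2) a cls_M by auto
  have "cls s a \<otimes>\<^bsub>L\<^esub> x \<in> N" using L.ideal_lmult_mem[OF N(1) x(1)] cls_carrier aP a by simp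
  moreover have "cls s a \<otimes>\<^bsub>L\<^esub> x = cls (s \<otimes> a) (a \<otimes> s)" using a aP by (simp add: mult_cls)
  moreover have "cls (s \<otimes> a) (a \<otimes> s) = frac \<one>"
    by (rule cls_eq) (use a aP U_one U_mult[OF aP a(3)] in \<open>auto simp: m_comm\<close>)
  ultimately have "\<one>\<^bsub>L\<^esub> \<in> N" by (simp add: L_one)
  then show False using ideal.one_imp_carrier[OF N(1)] N(2) by blast
qed

lemma M_proper: "M \<noteq> carrier L"
proof
  assume "M = carrier L"
  then have "frac \<one> \<in> M" using cls_carrier U_one by simp
  then have "\<one> \<in> P" using cls_M[OF one_closed U_one] by simp
  then show False using U_one by simp
qed

lemma M_maximal: "maximalideal M L"
proof (rule maximalidealI[OF M_ideal])
  show "carrier L \<noteq> M" using M_proper by simp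
  show "\<And>J. \<lbrakk>ideal J L; M \<subseteq> J; J \<subseteq> carrier L\<rbrakk> \<Longrightarrow> J = M \<or> J = carrier L"
    using proper_sub_M by blast
qed

lemma maximal_eq_M:
  assumes "maximalideal N L" shows "N = M"
proof -
  have N: "ideal N L" using assms by (rule maximalideal.axioms(1))
  have "N \<subseteq> M" using proper_sub_M[OF N] maximalideal.I_notcarr[OF assms] by simp
  then show ?thesis
    using maximalideal.I_maximal[OF assms M_ideal] M_proper ideal.Icarr[OF M_ideal] by blast
qed

lemma L_local: "local_ring L"
  unfolding local_ring_def using L_cring M_maximal maximal_eq_M by blast

lemma L_max_ideal: "max_ideal L = M"
  unfolding max_ideal_def using M_maximal maximal_eq_M by (intro the_equality)

lemma M_generated:
  assumes "G \<subseteq> carrier A" "P = Idl G" shows "M = Idl\<^bsub>L\<^esub> (frac ` G)"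
proof
  interpret L: cring L by (rule L_cring)
  have "frac ` G \<subseteq> M"
    using genideal_self[OF assms(1)] assms(2) cls_M U_one assms(1) by auto
  then show "Idl\<^bsub>L\<^esub> (frac ` G) \<subseteq> M" by (rule L.genideal_minimal[OF M_ideal])
  show "M \<subseteq> Idl\<^bsub>L\<^esub> (frac ` G)" unfolding M_def using extension_mem[OF assms(1)] assms(2) by auto
qed

end

section \<open>Extension of ideals along a homomorphism\<close>

locale extension = R: cring R + T: cring T for R (structure) and T (structure) +
  fixes h assumes h: "h \<in> ring_hom R T"
begin

definition ext where "ext I = Idl\<^bsub>T\<^esub> (h ` I)"

lemma h_sub: "ideal I R \<Longrightarrow> h ` I \<subseteq> carrier T"
  using R.ideal_carr ring_hom_closed[OF h] by blast

lemma ext_ideal: "ideal I R \<Longrightarrow> ideal (ext I) T"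
  unfolding ext_def using T.genideal_ideal h_sub by blast

lemma ext_self: "\<lbrakk>ideal I R; a \<in> I\<rbrakk> \<Longrightarrow> h a \<in> ext I"
  unfolding ext_def using T.genideal_self[OF h_sub] by blast

lemma ext_least: "\<lbrakk>ideal N T; \<And>a. a \<in> I \<Longrightarrow> h a \<in> N\<rbrakk> \<Longrightarrow> ext I \<subseteq> N"
  unfolding ext_def by (rule T.genideal_minimal) auto

lemma preimage_ideal:
  assumes N: "ideal N T" shows "ideal {a \<in> carrier R. h a \<in> N} R"
proof (rule R.cidealI)
  interpret h: ring_hom_ring R T h by (rule ring_hom_ringI2[OF R.ring_axioms T.ring_axioms h])
  show "\<zero>\<^bsub>R\<^esub> \<in> {a \<in> carrier R. h a \<in> N}" using T.ideal_zero_mem[OF N] by simp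
  fix a x assume a: "a \<in> {a \<in> carrier R. h a \<in> N}"
  show "a \<oplus>\<^bsub>R\<^esub> x \<in> {a \<in> carrier R. h a \<in> N}" if "x \<in> {a \<in> carrier R. h a \<in> N}"
    using a that T.ideal_add_mem[OF N] by simp
  show "x \<otimes>\<^bsub>R\<^esub> a \<in> {a \<in> carrier R. h a \<in> N}" if "x \<in> carrier R"
    using a that T.ideal_lmult_mem[OF N] by simp
qed auto

lemma ext_carrier: "ext (carrier R) = carrier T"
proof -
  have "\<one>\<^bsub>T\<^esub> \<in> ext (carrier R)" using ext_self[OF R.oneideal, of "\<one>\<^bsub>R\<^esub>"] ring_hom_one[OF h] by simp
  then show ?thesis using ideal.one_imp_carrier[OF ext_ideal[OF R.oneideal]] by blast
qed

lemma ext_add: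
  assumes I: "ideal I R" and J: "ideal J R"
  shows "ext (I <+>\<^bsub>R\<^esub> J) = ext I <+>\<^bsub>T\<^esub> ext J"
proof
  show "ext (I <+>\<^bsub>R\<^esub> J) \<subseteq> ext I <+>\<^bsub>T\<^esub> ext J"
  proof (rule ext_least[OF T.add_ideals[OF ext_ideal[OF I] ext_ideal[OF J]]])
    fix a assume "a \<in> I <+>\<^bsub>R\<^esub> J"
    then obtain i j where i: "i \<in> I" "j \<in> J" "a = i \<oplus>\<^bsub>R\<^esub> j" by (auto elim: R.set_addE)
    then have "h a = h i \<oplus>\<^bsub>T\<^esub> h j"
      using ring_hom_add[OF h R.ideal_carr[OF I] R.ideal_carr[OF J]] by simp
    then show "h a \<in> ext I <+>\<^bsub>T\<^esub> ext J" using i ext_self I J T.set_addI by simp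
  qed
  have IJ: "ideal (I <+>\<^bsub>R\<^esub> J) R" using R.add_ideals[OF I J] .
  have "ext I \<subseteq> ext (I <+>\<^bsub>R\<^esub> J)"
    by (rule ext_least[OF ext_ideal[OF IJ]]) (use R.set_add_left[OF I J] ext_self[OF IJ] in blast)
  moreover have "ext J \<subseteq> ext (I <+>\<^bsub>R\<^esub> J)"
    by (rule ext_least[OF ext_ideal[OF IJ]]) (use R.set_add_right[OF I J] ext_self[OF IJ] in blast)
  ultimately show "ext I <+>\<^bsub>T\<^esub> ext J \<subseteq> ext (I <+>\<^bsub>R\<^esub> J)" by (rule T.set_add_least[OF ext_ideal[OF IJ]])
qed

text \<open>For the inclusion of the product of extensions, the bilinear statement is known on
  images of \<open>I\<close> and \<open>J\<close> only. It is extended to arbitrary elements in one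
  factor at a time, each time because a colon ideal contains the generators.\<close>

lemma ext_prod:
  assumes I: "ideal I R" and J: "ideal J R"
  shows "ext (I \<cdot>\<^bsub>R\<^esub> J) = ext I \<cdot>\<^bsub>T\<^esub> ext J"
proof
  note pT = T.ideal_prod_is_ideal[OF ext_ideal[OF I] ext_ideal[OF J]]
  have "I \<cdot>\<^bsub>R\<^esub> J \<subseteq> {a \<in> carrier R. h a \<in> ext I \<cdot>\<^bsub>T\<^esub> ext J}"
  proof (rule R.prod_least[OF preimage_ideal[OF pT]])
    fix a b assume a: "a \<in> I" and b: "b \<in> J"
    have c: "a \<in> carrier R" "b \<in> carrier R" using R.ideal_carr[OF I a] R.ideal_carr[OF J b] .
    have "h a \<otimes>\<^bsub>T\<^esub> h b \<in> ext I \<cdot>\<^bsub>T\<^esub> ext J" using ext_self[OF I a] ext_self[OF J b] by (rule ideal_prod.prod)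
    then show "a \<otimes>\<^bsub>R\<^esub> b \<in> {a \<in> carrier R. h a \<in> ext I \<cdot>\<^bsub>T\<^esub> ext J}" using c ring_hom_mult[OF h c] by simp
  qed
  then show "ext (I \<cdot>\<^bsub>R\<^esub> J) \<subseteq> ext I \<cdot>\<^bsub>T\<^esub> ext J" by (intro ext_least[OF pT]) auto
  define N where "N = ext (I \<cdot>\<^bsub>R\<^esub> J)"
  have IJ: "ideal (I \<cdot>\<^bsub>R\<^esub> J) R" using R.ideal_prod_is_ideal[OF I J] .
  have N: "ideal N T" unfolding N_def by (rule ext_ideal[OF IJ])
  have sub: "ext I \<subseteq> colon T N (h ` J)"
  proof (rule ext_least[OF T.colon_ideal[OF N h_sub[OF J]]])
    fix a assume a: "a \<in> I"
    have ac: "a \<in> carrier R" using R.ideal_carr[OF I a] .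
    have "h a \<otimes>\<^bsub>T\<^esub> h b \<in> N" if b: "b \<in> J" for b
      using ring_hom_mult[OF h ac R.ideal_carr[OF J b]] ext_self[OF IJ ideal_prod.prod[OF a b]] by (simp add: N_def)
    then show "h a \<in> colon T N (h ` J)" using ring_hom_closed[OF h ac] by (auto simp: colon_def)
  qed
  have "ext J \<subseteq> colon T N (ext I)"
  proof (rule ext_least[OF T.colon_ideal[OF N T.ideal_sub[OF ext_ideal[OF I]]]])
    fix b assume b: "b \<in> J"
    have bc: "h b \<in> carrier T" using ring_hom_closed[OF h R.ideal_carr[OF J b]] .
    have "h b \<otimes>\<^bsub>T\<^esub> a \<in> N" if a: "a \<in> ext I" for a
    proof -
      have "a \<otimes>\<^bsub>T\<^esub> h b \<in> N" using sub a b by (auto simp: colon_def)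
      then show ?thesis using T.m_comm[OF bc T.ideal_carr[OF ext_ideal[OF I] a]] by simp
    qed
    then show "h b \<in> colon T N (ext I)" using bc by (auto simp: colon_def)
  qed
  then have "a \<otimes>\<^bsub>T\<^esub> b \<in> N" if "a \<in> ext I" "b \<in> ext J" for a b
    using that T.m_comm[OF T.ideal_carr[OF ext_ideal[OF I] that(1)] T.ideal_carr[OF ext_ideal[OF J] that(2)]]
    by (auto simp: colon_def)
  then show "ext I \<cdot>\<^bsub>T\<^esub> ext J \<subseteq> ext (I \<cdot>\<^bsub>R\<^esub> J)" unfolding N_def[symmetric] by (rule T.prod_least[OF N])
qed

lemma ext_pow:
  assumes I: "ideal I R" shows "ext (ideal_pow R I n) = ideal_pow T (ext I) n"
  by (induct n) (simp_all add: ext_carrier ext_prod[OF I R.pow_ideal[OF I]] ideal_pow.simps)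

end

section \<open>The faithfully flat extension with infinite residue field\<close>

context noetherian_local
begin

abbreviation \<mu> where "\<mu> \<equiv> min_num_gens R \<mm>"

sublocale S: mpoly R \<mu>
  by unfold_locales

lemma poly_ext_S_eq: "poly_ext_S R = S.S"
  by (simp only: poly_ext_S_def)

definition mS where "mS = {p \<in> carrier S.S. \<forall>e. p e \<in> \<mm>}"

lemma mS_eq: "Idl\<^bsub>S.S\<^esub> (mpoly_const R ` \<mm>) = mS"
  unfolding mS_def by (rule S.S_ideal_ext[OF mm_ideal])

lemma mm_primeideal: "primeideal \<mm> R"
  using maximalideal_prime[OF mm_max] .

lemma const_mm_sub: "mpoly_const R ` \<mm> \<subseteq> carrier S.S"
  using ring_hom_closed[OF S.const_hom] mm_carr by blast

lemma mS_prime: "primeideal mS S.S"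
proof -
  interpret SS: cring S.S by (rule S.S_cring)
  show ?thesis
  proof (rule primeidealI)
    show "ideal mS S.S" unfolding mS_eq[symmetric] by (rule SS.genideal_ideal[OF const_mm_sub])
    show "cring S.S" by (rule S.S_cring)
    have "\<one>\<^bsub>S.S\<^esub> (\<lambda>_. 0) = \<one>" by (simp add: S.S_one mpoly_mon_def)
    then have "\<one>\<^bsub>S.S\<^esub> \<notin> mS" using one_notin_mm unfolding mS_def by (metis (mono_tags, lifting) mem_Collect_eq)
    then show "carrier S.S \<noteq> mS" using SS.one_closed by blast
    fix a b assume "a \<in> carrier S.S" "b \<in> carrier S.S" "a \<otimes>\<^bsub>S.S\<^esub> b \<in> mS"
    then show "a \<in> mS \<or> b \<in> mS"
      using S.S_ideal_ext_prime[OF mm_primeideal] unfolding mS_def S.S_mult by blast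
  qed
qed

lemma poly_ext_U_eq: "poly_ext_U R = carrier S.S - mS"
  by (simp only: poly_ext_U_def poly_ext_S_eq mS_eq)

sublocale L: localized_prime S.S mS
proof (rule localized_prime.intro)
  have "localized_axioms S.S (carrier S.S - mS)"
  proof
    show "carrier S.S - mS \<subseteq> carrier S.S" by blast
    show "\<one>\<^bsub>S.S\<^esub> \<in> carrier S.S - mS"
      using primeideal.I_notcarr[OF mS_prime] ideal.one_imp_carrier[OF primeideal.axioms(1)[OF mS_prime]]
        cring.cring_simprules(6)[OF S.S_cring] by auto
    fix s t assume "s \<in> carrier S.S - mS" "t \<in> carrier S.S - mS"
    then show "s \<otimes>\<^bsub>S.S\<^esub> t \<in> carrier S.S - mS"
      using primeideal.I_prime[OF mS_prime, of s t] cring.cring_simprules(5)[OF S.S_cring, of s t] by auto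
  qed
  then show "localized S.S (carrier S.S - mS)" by (rule localized.intro[OF S.S_cring])
  show "localized_prime_axioms S.S mS" by (rule localized_prime_axioms.intro[OF mS_prime])
qed

lemma poly_ext_eq: "poly_ext R = L.L"
  by (simp only: poly_ext_def poly_ext_S_eq poly_ext_U_eq)

lemma poly_ext_map_eq: "poly_ext_map R r = L.frac (mpoly_const R r)"
  by (simp only: poly_ext_map_def poly_ext_S_eq poly_ext_U_eq)

lemma poly_ext_noetherian_local: "noetherian_local (poly_ext R)"
  unfolding poly_ext_eq noetherian_local_def noetherian_local_axioms_def
  using L.L_noetherian[OF S.S_noetherian[OF noetherian_ring_axioms]] L.L_cring L.L_local by blast

lemma poly_ext_map_hom: "poly_ext_map R \<in> ring_hom R (poly_ext R)"
proof -
  have "L.frac \<circ> mpoly_const R \<in> ring_hom R L.L" using ring_hom_trans[OF S.const_hom L.frac_hom] .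
  moreover have "L.frac \<circ> mpoly_const R = poly_ext_map R" by (auto simp: poly_ext_map_eq)
  ultimately show ?thesis by (simp only: poly_ext_eq)
qed

sublocale E: extension R "poly_ext R" "poly_ext_map R"
proof -
  interpret T: noetherian_local "poly_ext R" by (rule poly_ext_noetherian_local)
  show "extension R (poly_ext R) (poly_ext_map R)" by unfold_locales (rule poly_ext_map_hom)
qed

lemma ext_ideal_eq: "ext_ideal R I = E.ext I"
  by (simp only: ext_ideal_def E.ext_def)

text \<open>The maximal ideal of the extension is itself an extended ideal. Consequently its powers
  are extended too, and perturbed ideals of \<open>R\<close> extend to perturbed ideals of the same
  shape.\<close>

lemma max_ideal_poly_ext: "max_ideal (poly_ext R) = E.ext \<mm>"
proof -
  have "L.M = Idl\<^bsub>L.L\<^esub> (L.frac ` (mpoly_const R ` \<mm>))"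
    by (rule L.M_generated[OF const_mm_sub mS_eq[symmetric]])
  also have "L.frac ` (mpoly_const R ` \<mm>) = poly_ext_map R ` \<mm>"
    unfolding image_image by (rule image_cong) (simp_all only: poly_ext_map_eq)
  finally have "max_ideal (poly_ext R) = Idl\<^bsub>poly_ext R\<^esub> (poly_ext_map R ` \<mm>)"
    by (simp only: poly_ext_eq L.L_max_ideal)
  then show ?thesis by (simp only: E.ext_def[symmetric])
qed

text \<open>The powers of the first variable have pairwise distinct residues: a difference of two of
  them has a coefficient \<open>1\<close>, which lies outside \<open>\<mm>\<close>. The hypothesis
  guarantees that a variable exists.\<close>

lemma residue_field_poly_ext:
  assumes "\<mu> > 0" shows "residue_field_infinite (poly_ext R)"
proof -
  interpret T: cring L.L by (rule L.L_cring)
  define d :: "nat \<Rightarrow> nat \<Rightarrow> nat" where "d k = (\<lambda>i. if i = 0 then k else 0)" for k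
  define x where "x k = S.mon \<one> (d k)" for k
  have x: "x k \<in> carrier S.S" for k
    unfolding x_def by (rule S.mon_carrier) (use assms in \<open>auto simp: d_def\<close>)
  define y where "y k = L.frac (x k)" for k
  have y: "y k \<in> carrier L.L" for k unfolding y_def using L.cls_carrier[OF x L.U_one] .
  have ne: "y j \<ominus>\<^bsub>L.L\<^esub> y k \<notin> L.M" if jk: "j \<noteq> k" for j k
  proof
    assume M: "y j \<ominus>\<^bsub>L.L\<^esub> y k \<in> L.M"
    interpret h: ring_hom_ring S.S L.L L.frac
      by (rule ring_hom_ringI2[OF L.ring_axioms T.ring_axioms L.frac_hom])
    have "y j \<ominus>\<^bsub>L.L\<^esub> y k = L.frac (x j \<ominus>\<^bsub>S.S\<^esub> x k)"
      unfolding y_def a_minus_def using x by simp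
    then have P: "x j \<ominus>\<^bsub>S.S\<^esub> x k \<in> mS" using M L.cls_M[OF _ L.U_one] x by simp
    have "(x j \<ominus>\<^bsub>S.S\<^esub> x k) \<oplus>\<^bsub>S.S\<^esub> x k = x j" using x[of j] x[of k] by algebra
    then have "((x j \<ominus>\<^bsub>S.S\<^esub> x k) \<oplus>\<^bsub>S.S\<^esub> x k) (d j) = x j (d j)" by simp
    then have "(x j \<ominus>\<^bsub>S.S\<^esub> x k) (d j) \<oplus> x k (d j) = x j (d j)" by (simp only: S.S_add)
    moreover have "d j \<noteq> d k" using jk unfolding d_def by (metis (full_types))
    ultimately have "(x j \<ominus>\<^bsub>S.S\<^esub> x k) (d j) \<oplus> \<zero> = \<one>" by (simp add: x_def mpoly_mon_def)
    moreover have "(x j \<ominus>\<^bsub>S.S\<^esub> x k) (d j) \<in> \<mm>" using P unfolding mS_def by blast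
    ultimately show False using one_notin_mm mm_carr by simp
  qed
  have "inj (\<lambda>k. a_r_coset L.L L.M (y k))"
    using ne T.quotient_eq_iff_same_a_r_cos[OF L.M_ideal y y] by (meson injI)
  then have inf: "infinite (range (\<lambda>k. a_r_coset L.L L.M (y k)))" by (simp add: finite_image_iff)
  have "range (\<lambda>k. a_r_coset L.L L.M (y k)) \<subseteq> carrier (L.L Quot L.M)"
    using y unfolding FactRing_def A_RCOSETS_def' by auto
  then show ?thesis
    unfolding residue_field_infinite_def poly_ext_eq L.L_max_ideal using inf by (rule infinite_super)
qed

section \<open>Reduction of a finite residue field to the infinite case\<close>

lemma ext_J_seq:
  assumes "ideal J R" "ideal K R"
  shows "ext_ideal R (J <+>\<^bsub>R\<^esub> (K \<cdot>\<^bsub>R\<^esub> ideal_pow R \<mm> n))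
    = ext_ideal R J <+>\<^bsub>poly_ext R\<^esub> (ext_ideal R K \<cdot>\<^bsub>poly_ext R\<^esub> ideal_pow (poly_ext R) (max_ideal (poly_ext R)) n)"
  unfolding ext_ideal_eq max_ideal_poly_ext
  using E.ext_add[OF assms(1) Kp_ideal[OF assms(2)]] E.ext_prod[OF assms(2) pp_ideal] E.ext_pow[OF mm_ideal]
  by simp

text \<open>With no generators \<open>\<mm>\<close> is zero, and so are its positive powers. The
  index starts at \<open>Suc n\<close> because the power with exponent 0 is the whole ring.\<close>

lemma J_seq_mm_zero:
  assumes "\<mu> = 0" and J: "ideal J R" and K: "ideal K R"
  shows "J <+>\<^bsub>R\<^esub> (K \<cdot>\<^bsub>R\<^esub> ideal_pow R \<mm> (Suc n)) = J"
proof -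
  obtain ys where "Idl (ys ` {..<\<mu>}) = \<mm>" by (rule mm_generators)
  then have "Idl {} = \<mm>" using assms(1) by simp
  moreover have "Idl {} \<subseteq> {\<zero>}" by (rule genideal_minimal[OF zeroideal]) simp
  ultimately have m0: "\<mm> \<subseteq> {\<zero>}" by simp
  have "ideal_pow R \<mm> (Suc n) \<subseteq> {\<zero>}"
    using ideal_prod_inter[OF mm_ideal pp_ideal, of n] m0 by (auto simp: ideal_pow.simps)
  then have "K \<cdot> ideal_pow R \<mm> (Suc n) \<subseteq> J"
    using ideal_prod_inter[OF K pp_ideal, of "Suc n"] ideal_zero_mem[OF J] by auto
  then have "J <+>\<^bsub>R\<^esub> (K \<cdot> ideal_pow R \<mm> (Suc n)) \<subseteq> J" by (intro set_add_least[OF J]) auto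
  then show ?thesis using set_add_left[OF J Kp_ideal[OF K]] by blast
qed

text \<open>If \<open>\<mm>\<close> is nonzero, the extension has an infinite residue field and the
  equivalences proved there carry over to \<open>R\<close> through \<open>ext_J_seq\<close>. If
  \<open>\<mu> = 0\<close>, the perturbed ideals equal \<open>J\<close> from index 1 on, so the
  equivalence holds for every property whatsoever.\<close>

theorem full_asymptotic_finite:
  assumes fin: "\<not> residue_field_infinite R" and J: "ideal J R" and K: "ideal K R"
  shows "(m_full R J \<longleftrightarrow> (\<exists>n0. \<forall>n\<ge>n0. m_full R (J_seq J K n)))
    \<and> (full R J \<longleftrightarrow> (\<exists>n0. \<forall>n\<ge>n0. full R (J_seq J K n)))"
proof (cases "\<mu> = 0")
  case True
  have *: "Q J \<longleftrightarrow> (\<exists>n0. \<forall>n\<ge>n0. Q (J_seq J K n))" for Q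
  proof
    assume "Q J"
    have "Q (J_seq J K n)" if "n \<ge> Suc 0" for n
      using that \<open>Q J\<close> J_seq_mm_zero[OF True J K] by (cases n) auto
    then show "\<exists>n0. \<forall>n\<ge>n0. Q (J_seq J K n)" by blast
  next
    assume "\<exists>n0. \<forall>n\<ge>n0. Q (J_seq J K n)"
    then obtain n0 where "\<forall>n\<ge>n0. Q (J_seq J K n)" by blast
    then have "Q (J_seq J K (Suc n0))" by simp
    then show "Q J" using J_seq_mm_zero[OF True J K] by simp
  qed
  show ?thesis using *[of "m_full R"] *[of "full R"] by blast
next
  case False
  interpret T: noetherian_local "poly_ext R" by (rule poly_ext_noetherian_local)
  have inf: "residue_field_infinite (poly_ext R)" using residue_field_poly_ext False by simp
  have J': "ideal (ext_ideal R J) (poly_ext R)" and K': "ideal (ext_ideal R K) (poly_ext R)"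
    unfolding ext_ideal_eq by (rule E.ext_ideal[OF J] E.ext_ideal[OF K])+
  show ?thesis
    using T.m_full_inf_asymptotic[OF inf J' K'] T.full_inf_asymptotic[OF inf J' K'] fin
    by (simp add: m_full_def full_def ext_J_seq[OF J K])
qed

end

theorem theorem3p4:
  fixes R :: "('a, 'b) ring_scheme" and J K :: "'a set"
  assumes "noetherian_ring R" and "local_ring R"
    and "ideal J R" and "ideal K R"
  shows "(m_full R J \<longleftrightarrow>
            (\<exists>n0. \<forall>n\<ge>n0. m_full R (J <+>\<^bsub>R\<^esub> (K \<cdot>\<^bsub>R\<^esub> ideal_pow R (max_ideal R) n))))
       \<and> (weakly_m_full R J \<longleftrightarrow>
            (\<exists>n0. \<forall>n\<ge>n0. weakly_m_full R (J <+>\<^bsub>R\<^esub> (K \<cdot>\<^bsub>R\<^esub> ideal_pow R (max_ideal R) n))))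
       \<and> (full R J \<longleftrightarrow>
            (\<exists>n0. \<forall>n\<ge>n0. full R (J <+>\<^bsub>R\<^esub> (K \<cdot>\<^bsub>R\<^esub> ideal_pow R (max_ideal R) n))))"
proof -
  interpret noetherian_local R
    using assms(1,2) by (simp add: noetherian_local_def noetherian_local_axioms_def local_ring_def)
  show ?thesis
  proof (cases "residue_field_infinite R")
    case True
    then show ?thesis
      using m_full_inf_asymptotic[OF True assms(3,4)] full_inf_asymptotic[OF True assms(3,4)]
        weakly_m_full_asymptotic[OF assms(3,4)]
      by (simp add: m_full_def full_def)
  next
    case False
    then show ?thesis
      using full_asymptotic_finite[OF False assms(3,4)] weakly_m_full_asymptotic[OF assms(3,4)] by blast
  qed
qed

end
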